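(* Let $d\ge 1$ and $n\ge 2$. Then $F(\mathbb R^d,n)$ contains, as an $\mathfrak S_n$-equivariant strong deformation retract, a finite regular CW complex $X(d,n)$ of dimension $(d-1)(n-1)$ with $n!$ vertices and $n!$ maximal cells (and, when $d\ge 2$, $(n-1)\,n!$ cells of dimension $(d-1)(n-1)-1$), such that: (1) the non-empty cells $\check c(\sigma,\mathbf i)$ of $X(d,n)$ are indexed by the elements $(\sigma,\mathbf i)=(\sigma_1\prec_{i_1}\cdots\prec_{i_{n-1}}\sigma_n)$ of $P'(d,n)$, i.e. $\sigma\in\mathfrak S_n$ and $\mathbf i\in\{1,\dots,d\}^{n-1}$; (2) $\dim\check c(\sigma,\mathbf i)=(i_1+\dots+i_{n-1})-(n-1)$; (3) $\check c(\sigma,\mathbf i)\subseteq \check c(\sigma',\mathbf i')$ iff $(\sigma,\mathbf i)\preceq(\sigma',\mathbf i')$, where $(\sigma,\mathbf i)\preceq(\sigma',\mathbf i')$ means: for all distinct letters $a,b$ with $a$ before $b$ in $\sigma'$, either $a$ is before $b$ in $\sigma$ and $m_{\sigma,\mathbf i}(a,b)\le m_{\sigma',\mathbf i'}(a,b)$, or $b$ is before $a$ in $\sigma$ and $m_{\sigma,\mathbf i}(a,b)<m_{\sigma',\mathbf i'}(a,b)$; (4) the barycentric subdivision of $X(d,n)$ (the order complex $\Delta P'(d,n)$) is geometrically realized in $W_n^{\oplus d}\subset\mathbb R^{d\times n}$ by the simplices $\operatorname{conv}\{v(c_0),\dots,v(c_k)\}$ for chains $c_0\prec\dots\prec c_k$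 in $P'(d,n)$, where for $(\sigma,\mathbf i)\in P'(d,n)$ the point $v(\sigma,\mathbf i)=(x_1,\dots,x_n)$ is given by $\tilde x_{\sigma_1}=0$, $\tilde x_{\sigma_{j+1}}=\tilde x_{\sigma_j}+e_{i_j}$ ($e_i$ the standard unit vectors of $\mathbb R^d$) and $x_j=\tilde x_j-\frac1n(\tilde x_1+\dots+\tilde x_n)$; this realization $\Delta(d,n)$ is contained in $F(\mathbb R^d,n)$ and is an $\mathfrak S_n$-equivariant strong deformation retract of $F(\mathbb R^d,n)$; (5) $\mathfrak S_n$ acts on $P'(d,n)$ by $\pi\cdot(\sigma,\mathbf i)=(\pi\sigma,\mathbf i)$ (where $\pi\sigma=\pi(\sigma_1)\cdots\pi(\sigma_n)$), and correspondingly on the realization by $\pi\cdot v(\sigma,\mathbf i)=v(\pi\sigma,\mathbf i)$, this being the restriction of the column-permutation action.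
   Context: $F(\mathbb R^d,n)$ is the set of real $d\times n$ matrices with pairwise distinct columns, with $\mathfrak S_n$ acting by permuting columns; $W_n^{\oplus d}=\{(x_1,\dots,x_n)\in\mathbb R^{d\times n}:\sum_j x_j=0\}$. A regular CW complex is one whose closed cells are attached by homeomorphisms of their boundaries. For a string $(\sigma,\mathbf i)=(\sigma_1\prec_{i_1}\cdots\prec_{i_{n-1}}\sigma_n)$ with $\sigma\in\mathfrak S_n$ and distinct letters $a,b$ occupying positions $p<q$ in $\sigma$ (in either order), put $m_{\sigma,\mathbf i}(a,b)=\min\{i_p,\dots,i_{q-1}\}$. $P'(d,n)$ is the set of all such strings with $\mathbf i\in\{1,\dots,d\}^{n-1}$, partially ordered by $\preceq$ as in (3). (These cells are dual to the Fox–Neuwirth strata of $W_n^{\oplus d}$ lying in the complement of the subspaces $x_a=x_b$, the stratum of $(x_1,\dots,x_n)$ being determined by sorting columns lexicographically with index $i_j$ the first coordinate in which consecutive columns differ.) *)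

theory Defs
  imports "HOL-Analysis.Analysis"
begin

text \<open>Points of R^(d x n): an element x of real^'d^'n, the column x_j being x $ j.
  Here d = CARD('d), n = CARD('n). The coordinates of R^d are numbered 1..d
  by the (arbitrary) linear order on 'd.\<close>

definition coord :: "nat \<Rightarrow> 'd::{finite,linorder}" where
  "coord k = sorted_list_of_set (UNIV::'d set) ! (k - 1)"

definition unitv :: "nat \<Rightarrow> real^'d::{finite,linorder}" where
  "unitv k = axis (coord k) 1"

definition conf_space :: "(real^'d^'n) set" where
  "conf_space = {x. \<forall>j k. j \<noteq> k \<longrightarrow> x $ j \<noteq> x $ k}"

definition W_space :: "(real^'d^'n) set" where
  "W_space = {x. (\<Sum>j\<in>UNIV. x $ j) = 0}"

text \<open>column permutation action: the column in position j moves to position pi j\<close>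
definition perm_act :: "('n \<Rightarrow> 'n) \<Rightarrow> real^'d^'n \<Rightarrow> real^'d^'n" where
  "perm_act \<pi> x = (\<chi> j. x $ (inv \<pi> j))"

text \<open>strings (sigma, i): sigma a word listing each letter of 'n exactly once,
  i the list (i_1,...,i_(n-1)) of indices; i ! k sits between sigma ! k and sigma ! (k+1)\<close>
type_synonym ('d,'n) mat = "real^'d^'n"

type_synonym 'n string = "'n list \<times> nat list"

definition Pprime :: "('d::{finite,linorder}) itself \<Rightarrow> ('n::finite) string set" where
  "Pprime _ = {(\<sigma>, i). distinct \<sigma> \<and> set \<sigma> = UNIV \<and> length i = CARD('n) - 1
                       \<and> set i \<subseteq> {1..CARD('d)}}"

definition pos :: "'n list \<Rightarrow> 'n \<Rightarrow> nat" where
  "pos \<sigma> a = (THE k. k < length \<sigma> \<and> \<sigma> ! k = a)"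

definition before :: "'n list \<Rightarrow> 'n \<Rightarrow> 'n \<Rightarrow> bool" where
  "before \<sigma> a b \<longleftrightarrow> pos \<sigma> a < pos \<sigma> b"

text \<open>m_(sigma,i)(a,b) = min {i_p,...,i_(q-1)} (1-indexed), p,q the positions of a,b\<close>
definition mval :: "'n string \<Rightarrow> 'n \<Rightarrow> 'n \<Rightarrow> nat" where
  "mval s a b = (let \<sigma> = fst s; i = snd s in
     Min ((\<lambda>k. i ! k) ` {min (pos \<sigma> a) (pos \<sigma> b) ..< max (pos \<sigma> a) (pos \<sigma> b)}))"

definition prec :: "'n string \<Rightarrow> 'n string \<Rightarrow> bool" where
  "prec s s' \<longleftrightarrow> (\<forall>a b. a \<noteq> b \<and> before (fst s') a b \<longrightarrow>
       (before (fst s) a b \<and> mval s a b \<le> mval s' a b) \<or>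
       (before (fst s) b a \<and> mval s a b < mval s' a b))"

definition cdim :: "'n::finite string \<Rightarrow> nat" where
  "cdim s = sum_list (snd s) - (CARD('n) - 1)"

definition str_act :: "('n \<Rightarrow> 'n) \<Rightarrow> 'n string \<Rightarrow> 'n string" where
  "str_act \<pi> s = (map \<pi> (fst s), snd s)"

definition vtilde :: "'n string \<Rightarrow> 'n \<Rightarrow> real^'d::{finite,linorder}" where
  "vtilde s a = (\<Sum>j<pos (fst s) a. unitv (snd s ! j))"

definition vpt :: "('n::finite) string \<Rightarrow> real^'d::{finite,linorder}^'n" where
  "vpt s = (\<chi> a. vtilde s a - (1 / real CARD('n)) *\<^sub>R (\<Sum>b\<in>UNIV. vtilde s b))"

definition is_chain :: "'n string set \<Rightarrow> bool" where
  "is_chain C \<longleftrightarrow> (\<forall>x\<in>C. \<forall>y\<in>C. prec x y \<or> prec y x)"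

definition chains :: "('d::{finite,linorder}) itself \<Rightarrow> ('n::finite) string set set" where
  "chains D = {C. C \<subseteq> Pprime D \<and> C \<noteq> {} \<and> is_chain C}"

definition Delta :: "'d itself \<Rightarrow> (real^('d::{finite,linorder})^('n::finite)) set" where
  "Delta D = (\<Union>C\<in>chains D. convex hull (vpt ` C))"

definition cell :: "'d itself \<Rightarrow> ('n::finite) string \<Rightarrow> (real^('d::{finite,linorder})^'n) set" where
  "cell D s = (\<Union>C\<in>{C\<in>chains D. \<forall>c\<in>C. prec c s}. convex hull (vpt ` C))"

definition regular_cw_complex ::
  "'a::euclidean_space set \<Rightarrow> 'c set \<Rightarrow> ('c \<Rightarrow> 'a set) \<Rightarrow> ('c \<Rightarrow> nat) \<Rightarrow> bool" where
  "regular_cw_complex X I cl dm \<longleftrightarrow> finite I \<and> X = (\<Union>c\<in>I. cl c) \<and>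
     (\<exists>(T :: 'c \<Rightarrow> 'a set) h. \<forall>c\<in>I. subspace (T c) \<and> dim (T c) = dm c \<and>
        (\<exists>g. homeomorphism (cball 0 1 \<inter> T c) (cl c) (h c) g) \<and>
        h c ` (sphere 0 1 \<inter> T c) \<subseteq> (\<Union>c'\<in>{c'\<in>I. dm c' < dm c}. cl c') \<and>
        (\<forall>c'\<in>I. c' \<noteq> c \<longrightarrow> h c ` (ball 0 1 \<inter> T c) \<inter> h c' ` (ball 0 1 \<inter> T c') = {}))"

definition equivariant_sdr :: "(real^'d^'n) set \<Rightarrow> (real^'d^'n) set \<Rightarrow> bool" where
  "equivariant_sdr A Y \<longleftrightarrow> A \<subseteq> Y \<and>
     (\<forall>\<pi>. \<pi> permutes (UNIV::'n set) \<longrightarrow> perm_act \<pi> ` A \<subseteq> A) \<and>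
     (\<exists>H. continuous_on ({0..1::real} \<times> Y) H \<and> H ` ({0..1} \<times> Y) \<subseteq> Y \<and>
        (\<forall>x\<in>Y. H (0, x) = x \<and> H (1, x) \<in> A) \<and>
        (\<forall>t\<in>{0..1}. \<forall>a\<in>A. H (t, a) = a) \<and>
        (\<forall>\<pi> t x. \<pi> permutes (UNIV::'n set) \<and> t \<in> {0..1} \<and> x \<in> Y \<longrightarrow>
             H (t, perm_act \<pi> x) = perm_act \<pi> (H (t, x))))"

end

theory Submission
  imports Defs "HOL-Combinatorics.Multiset_Permutations"
begin

text \<open>
  Every matrix has a sign pattern, which records for each pair of columns the first coordinate in
  which they differ and the sign of that difference. Patterns stratify the space into convex cones,
  ordered by reverse closure inclusion, and the elements of \<open>P'(d,n)\<close> are the patterns without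
  coinciding columns. Choose a representative \<open>v q\<close> in each stratum. Starting from \<open>x\<close> in the
  stratum \<open>q\<close> and moving in direction \<open>- v q\<close> until one leaves that stratum, one arrives in a strictly
  larger pattern; iterating this writes \<open>x\<close> uniquely as a nonnegative combination of representatives
  along a chain, modulo the span of the smallest stratum, and the coefficients depend continuously
  on \<open>x\<close>. This is used twice. Globally it shows that the order complex is embedded, and forgetting
  the coefficients of patterns with coinciding columns retracts the configuration space.
  Locally, at the stratum of a string \<open>s\<close>, the same argument applies to the signs of
  \<open>v s + \<epsilon> x\<close> for infinitesimal \<open>\<epsilon>\<close>; modulo the span of the stratum it presents the cell of \<open>s\<close> as
  a star-shaped neighbourhood of the origin in the normal space, hence as a ball.
\<close>

text \<open>The points \<open>vpt s\<close> are prescribed, so the simplices cannot be put in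
  general position and must be shown to fit together. What makes them fit is absorption: if
  \<open>y\<close> lies in the closure of the stratum \<open>q\<close>, then adding any positive
  multiple of a vector of \<open>q\<close> moves \<open>y\<close> into \<open>q\<close> itself.
  Hence the least member of a chain expansion can be read off from the signs of \<open>x\<close>,
  and its coefficient is the time at which the line leaves the stratum. The expansion sees a
  representative only through its stratum, which is why the prescribed points serve as well as any
  others. The global expansion cannot avoid coinciding columns, since a line leaving a stratum may
  run into them; patterns outside \<open>P'(d,n)\<close> therefore need representatives too. In a
  cell they do not arise, because every pattern below that of a string is again that of a string.
  The smallest stratum is set apart because it is a linear subspace: a position along it is not
  measured by a nonnegative coefficient, so expansions are taken modulo it.\<close>

lemma finite_chain_least:
  assumes "finite C" "C \<noteq> {}" "\<And>x y. x \<in> C \<Longrightarrow> y \<in> C \<Longrightarrow> r x y \<or> r y x"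
    and "\<And>x y z. r x y \<Longrightarrow> r y z \<Longrightarrow> r x z"
  obtains m where "m \<in> C" "\<And>x. x \<in> C \<Longrightarrow> r m x"
proof -
  have "\<exists>m\<in>C. \<forall>x\<in>C. r m x"
    using assms(1-3)
  proof (induction C rule: finite_ne_induct)
    case (singleton x)
    then show ?case by auto
  next
    case (insert x F)
    then obtain m where m: "m \<in> F" "\<forall>y\<in>F. r m y" by auto
    show ?case
    proof (cases "r m x")
      case True
      then show ?thesis using m by auto
    next
      case False
      then have "r x m" "r x x" using insert.prems m by auto
      then show ?thesis using m assms(4) by blast
    qed
  qed
  then show ?thesis using that by blast
qed

lemma convex_hull_finite_image:
  assumes "finite C" "inj_on v C"
  shows "convex hull (v ` C) =
    {\<Sum>q\<in>C. u q *\<^sub>R v q | u. (\<forall>q\<in>C. 0 \<le> u q) \<and> sum u C = (1::real)}"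
proof -
  have "z \<in> convex hull (v ` C) \<longleftrightarrow> (\<exists>u. z = (\<Sum>q\<in>C. u q *\<^sub>R v q) \<and> (\<forall>q\<in>C. 0 \<le> u q) \<and> sum u C = 1)" for z
  proof
    assume "z \<in> convex hull (v ` C)"
    then obtain u where u: "\<forall>x\<in>v ` C. 0 \<le> u x" "sum u (v ` C) = 1" "(\<Sum>x\<in>v ` C. u x *\<^sub>R x) = z"
      using assms by (auto simp: convex_hull_finite)
    then show "\<exists>u. z = (\<Sum>q\<in>C. u q *\<^sub>R v q) \<and> (\<forall>q\<in>C. 0 \<le> u q) \<and> sum u C = 1"
      using assms(2) by (intro exI[of _ "u \<circ> v"]) (auto simp: sum.reindex o_def)
  next
    assume "\<exists>u. z = (\<Sum>q\<in>C. u q *\<^sub>R v q) \<and> (\<forall>q\<in>C. 0 \<le> u q) \<and> sum u C = 1"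
    then obtain u where u: "z = (\<Sum>q\<in>C. u q *\<^sub>R v q)" "\<forall>q\<in>C. 0 \<le> u q" "sum u C = 1" by blast
    show "z \<in> convex hull (v ` C)"
      unfolding u(1) by (rule convex_sum) (use assms(1) u in \<open>auto intro: hull_inc\<close>)
  qed
  then show ?thesis by blast
qed

section \<open>Conical stratifications\<close>

text \<open>Read \<open>le p q\<close> as: stratum \<open>q\<close> lies in the closure of stratum
  \<open>p\<close>. The apex is the most degenerate stratum and coincides with the subspace
  \<open>L\<close>. No topology is assumed; continuity of the coefficients is derived from
  \<open>absorb\<close>, \<open>exit\<close> and finiteness.\<close>

locale cone_stratification =
  fixes Q :: "'q set" and le :: "'q \<Rightarrow> 'q \<Rightarrow> bool" and apex :: 'q
    and strat :: "'a::euclidean_space \<Rightarrow> 'q" and v :: "'q \<Rightarrow> 'a" and L :: "'a set"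
  assumes finite_Q: "finite Q"
    and apex_in: "apex \<in> Q"
    and le_refl: "le q q"
    and le_trans: "le p q \<Longrightarrow> le q r \<Longrightarrow> le p r"
    and le_antisym: "le p q \<Longrightarrow> le q p \<Longrightarrow> p = q"
    and le_apex: "q \<in> Q \<Longrightarrow> le q apex"
    and strat_in: "strat x \<in> Q"
    and subspace_L: "subspace L"
    and mem_L: "x \<in> L \<longleftrightarrow> strat x = apex"
    and absorb: "q \<in> Q \<Longrightarrow> le q (strat y) \<Longrightarrow> 0 < t \<Longrightarrow> strat (y + t *\<^sub>R v q) = q"
    and exit: "strat x \<noteq> apex \<Longrightarrow> \<exists>t>0. le (strat x) (strat (x - t *\<^sub>R v (strat x)))
                 \<and> strat (x - t *\<^sub>R v (strat x)) \<noteq> strat x"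
begin

section \<open>Existence and uniqueness of chain expansions\<close>

definition chain :: "'q set \<Rightarrow> bool" where
  "chain C \<longleftrightarrow> (\<forall>x\<in>C. \<forall>y\<in>C. le x y \<or> le y x)"

text \<open>The apex is barred from the support because \<open>v apex\<close> lies in
  \<open>L\<close>: its coefficient would be arbitrary and uniqueness would fail.\<close>

definition rep :: "'a \<Rightarrow> ('q \<Rightarrow> real) \<Rightarrow> bool" where
  "rep x t \<longleftrightarrow> (\<forall>q. 0 \<le> t q) \<and> {q. t q \<noteq> 0} \<subseteq> Q - {apex} \<and> chain {q. t q \<noteq> 0}
     \<and> x - (\<Sum>q\<in>Q. t q *\<^sub>R v q) \<in> L"

lemma chain_subset: "chain C \<Longrightarrow> C' \<subseteq> C \<Longrightarrow> chain C'"
  unfolding chain_def by blast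

lemma chain_insert_apex: "chain C \<Longrightarrow> C \<subseteq> Q \<Longrightarrow> chain (insert apex C)"
  unfolding chain_def using le_apex le_refl by (metis insert_iff subsetD)

lemma strat_v: "q \<in> Q \<Longrightarrow> strat (v q) = q"
  using absorb[of q 0 1] mem_L[of 0] subspace_0[OF subspace_L] le_apex by auto

lemma inj_v: "inj_on v Q"
  by (metis inj_onI strat_v)

lemma v_apex_in_L: "v apex \<in> L"
  using mem_L strat_v apex_in by blast

lemma rep_finite_support: "rep x t \<Longrightarrow> finite {q. t q \<noteq> 0}"
  unfolding rep_def using finite_Q finite_subset by blast

lemma rep_remove:
  assumes "rep x t" "q \<in> Q"
  shows "rep (x - t q *\<^sub>R v q) (t(q := 0))"
proof -
  have "(\<Sum>p\<in>Q. t p *\<^sub>R v p) = t q *\<^sub>R v q + (\<Sum>p\<in>Q - {q}. t p *\<^sub>R v p)"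
    using finite_Q assms(2) by (simp add: sum.remove)
  moreover have "(\<Sum>p\<in>Q. (t(q := 0)) p *\<^sub>R v p) = (\<Sum>p\<in>Q - {q}. (t(q := 0)) p *\<^sub>R v p)"
    using finite_Q assms(2) by (simp add: sum.remove)
  moreover have "(\<Sum>p\<in>Q - {q}. (t(q := 0)) p *\<^sub>R v p) = (\<Sum>p\<in>Q - {q}. t p *\<^sub>R v p)"
    by (rule sum.cong) auto
  ultimately have "x - t q *\<^sub>R v q - (\<Sum>p\<in>Q. (t(q := 0)) p *\<^sub>R v p) = x - (\<Sum>p\<in>Q. t p *\<^sub>R v p)"
    by simp
  moreover have "{p. (t(q := 0)) p \<noteq> 0} \<subseteq> {p. t p \<noteq> 0}" by auto
  then have "chain {p. (t(q := 0)) p \<noteq> 0}" "{p. (t(q := 0)) p \<noteq> 0} \<subseteq> Q - {apex}"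
    using assms(1) chain_subset unfolding rep_def by blast+
  ultimately show ?thesis
    using assms(1) unfolding rep_def by (metis fun_upd_apply order_refl)
qed

lemma support_remove: "{p. (t(q := 0)) p \<noteq> (0::real)} = {p. t p \<noteq> 0} - {q}"
  by auto

text \<open>Strip off the least member \<open>q\<close> of the support. By induction the remainder
  lies in a stratum above \<open>q\<close>, so \<open>absorb\<close> puts \<open>x\<close> back into
  \<open>q\<close>.\<close>

lemma rep_strat:
  assumes "rep x t"
  shows "({q. t q \<noteq> 0} = {} \<and> strat x = apex)
    \<or> (t (strat x) \<noteq> 0 \<and> (\<forall>q. t q \<noteq> 0 \<longrightarrow> le (strat x) q))"
  using assms
proof (induction "card {q. t q \<noteq> 0}" arbitrary: x t rule: less_induct)
  case less
  show ?case
  proof (cases "{q. t q \<noteq> 0} = {}")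
    case True
    then have "\<And>q. t q = 0" by auto
    then have "x \<in> L" using less.prems unfolding rep_def by simp
    then show ?thesis using True mem_L by auto
  next
    case False
    obtain q where q: "q \<in> {q. t q \<noteq> 0}" "\<And>p. p \<in> {q. t q \<noteq> 0} \<Longrightarrow> le q p"
    proof (rule finite_chain_least[OF rep_finite_support[OF less.prems] False, of le])
      show "le x y \<or> le y x" if "x \<in> {q. t q \<noteq> 0}" "y \<in> {q. t q \<noteq> 0}" for x y
        using that less.prems unfolding rep_def chain_def by blast
    qed (use le_trans that in blast)+
    have qQ: "q \<in> Q" using q(1) less.prems unfolding rep_def by auto
    have tq: "t q > 0" using q(1) less.prems unfolding rep_def by (simp add: less_le)
    let ?x = "x - t q *\<^sub>R v q" and ?t = "t(q := 0)"
    have r: "rep ?x ?t" by (rule rep_remove[OF less.prems qQ])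
    have "card {p. ?t p \<noteq> 0} < card {q. t q \<noteq> 0}"
      unfolding support_remove using rep_finite_support[OF less.prems] q(1) by (rule card_Diff1_less)
    from less.hyps[OF this r] have "le q (strat ?x)"
      using le_apex[OF qQ] q(2) by (auto split: if_splits)
    from absorb[OF qQ this tq] have "strat x = q" by simp
    then show ?thesis using q by auto
  qed
qed

text \<open>By \<open>rep_strat\<close> both expansions begin with \<open>strat x\<close>. Once
  their coefficients there agree, induction handles the remainders.\<close>

lemma rep_unique:
  assumes "rep x t" "rep x t'"
  shows "t = t'"
  using assms
proof (induction "card {q. t q \<noteq> 0}" arbitrary: x t t' rule: less_induct)
  case less
  have nt: "t apex = 0" "t' apex = 0" using less.prems unfolding rep_def by auto
  show ?case
  proof (cases "strat x = apex")
    case True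
    then have "{q. t q \<noteq> 0} = {}" "{q. t' q \<noteq> 0} = {}"
      using rep_strat[OF less.prems(1)] rep_strat[OF less.prems(2)] nt by auto
    then show ?thesis by auto
  next
    case False
    define q where "q = strat x"
    have q: "q \<in> Q" "t q \<noteq> 0" "t' q \<noteq> 0"
      using rep_strat[OF less.prems(1)] rep_strat[OF less.prems(2)] False strat_in by (auto simp: q_def)
    have le_rest: "le q (strat (x - s q *\<^sub>R v q)) \<and> strat (x - s q *\<^sub>R v q) \<noteq> q" if s: "rep x s" for s
    proof -
      have "rep (x - s q *\<^sub>R v q) (s(q := 0))" by (rule rep_remove[OF s q(1)])
      from rep_strat[OF this] rep_strat[OF s] False le_apex q(1) show ?thesis
        by (auto simp: q_def split: if_splits)
    qed
    \<comment> \<open>With unequal coefficients one remainder would be the other plus a positive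
      multiple of \<open>v q\<close>; \<open>absorb\<close> would place it in \<open>q\<close>,
      contrary to \<open>le_rest\<close>.\<close>
    have not_less: "\<not> s q < s' q" if s: "rep x s" "rep x s'" for s s'
    proof
      assume lt: "s q < s' q"
      have "strat (x - s' q *\<^sub>R v q + (s' q - s q) *\<^sub>R v q) = q"
        using absorb[OF q(1), of "x - s' q *\<^sub>R v q" "s' q - s q"] le_rest[OF s(2)] lt by simp
      moreover have "x - s' q *\<^sub>R v q + (s' q - s q) *\<^sub>R v q = x - s q *\<^sub>R v q"
        by (simp add: algebra_simps)
      ultimately show False using le_rest[OF s(1)] by simp
    qed
    have eq: "t q = t' q" using not_less less.prems by (meson linorder_less_linear)
    have "card {p. (t(q := 0)) p \<noteq> 0} < card {q. t q \<noteq> 0}"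
      unfolding support_remove using rep_finite_support[OF less.prems(1)] q(2)
      by (intro card_Diff1_less) auto
    from less.hyps[OF this rep_remove[OF less.prems(1) q(1)]] rep_remove[OF less.prems(2) q(1)]
    have "t(q := 0) = t'(q := 0)" by (simp only: eq)
    then show ?thesis using eq by (metis fun_upd_triv fun_upd_upd)
  qed
qed

text \<open>Induction on the number of strata above \<open>strat x\<close>: \<open>exit\<close>
  reaches a strictly larger stratum, and \<open>strat x\<close> becomes the new least member of the
  chain found there.\<close>

lemma rep_exists: "\<exists>t. rep x t"
proof (induction "card {q\<in>Q. le (strat x) q}" arbitrary: x rule: less_induct)
  case less
  show ?case
  proof (cases "strat x = apex")
    case True
    then have "rep x (\<lambda>_. 0)" unfolding rep_def chain_def using mem_L by auto
    then show ?thesis by blast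
  next
    case False
    define q where "q = strat x"
    obtain a where a: "a > 0" "le q (strat (x - a *\<^sub>R v q))" "strat (x - a *\<^sub>R v q) \<noteq> q"
      using exit[OF False] by (auto simp: q_def)
    define y where "y = x - a *\<^sub>R v q"
    have q: "q \<in> Q" "q \<noteq> apex" using strat_in False by (auto simp: q_def)
    have "{p\<in>Q. le (strat y) p} \<subset> {p\<in>Q. le q p}"
      using a le_trans le_antisym le_refl q(1) unfolding y_def by blast
    then have "card {p\<in>Q. le (strat y) p} < card {p\<in>Q. le (strat x) p}"
      using finite_Q by (simp add: psubset_card_mono q_def)
    from less[OF this] obtain t where t: "rep y t" by blast
    have ge: "le (strat y) p" if "t p \<noteq> 0" for p using rep_strat[OF t] that by auto
    have tq: "t q = 0" using ge a(2,3) le_antisym unfolding y_def by blast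
    have sup: "{p. (t(q := a)) p \<noteq> 0} = insert q {p. t p \<noteq> 0}" using a(1) by auto
    have "chain (insert q {p. t p \<noteq> 0})"
      using t ge a(2) le_trans le_refl unfolding rep_def chain_def y_def by blast
    moreover have "(\<Sum>p\<in>Q. (t(q := a)) p *\<^sub>R v p) = a *\<^sub>R v q + (\<Sum>p\<in>Q. t p *\<^sub>R v p)"
    proof -
      have "(\<Sum>p\<in>Q - {q}. (t(q := a)) p *\<^sub>R v p) = (\<Sum>p\<in>Q - {q}. t p *\<^sub>R v p)"
        by (rule sum.cong) auto
      then show ?thesis using finite_Q q(1) tq by (simp add: sum.remove)
    qed
    ultimately have "rep x (t(q := a))"
      using t a(1) q unfolding rep_def sup y_def by (auto simp: algebra_simps)
    then show ?thesis by blast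
  qed
qed

definition coef :: "'a \<Rightarrow> 'q \<Rightarrow> real" where
  "coef x = (THE t. rep x t)"

lemma rep_coef: "rep x (coef x)"
  unfolding coef_def using rep_exists rep_unique by (metis theI)

lemma coef_eqI: "rep x t \<Longrightarrow> coef x = t"
  using rep_coef rep_unique by blast

lemma coef_nonneg: "0 \<le> coef x q"
  using rep_coef unfolding rep_def by blast

lemma coef_support: "coef x q \<noteq> 0 \<Longrightarrow> q \<in> Q \<and> q \<noteq> apex"
  using rep_coef unfolding rep_def by blast

lemma coef_chain: "chain {q. coef x q \<noteq> 0}"
  using rep_coef unfolding rep_def by blast

lemma coef_sum: "x - (\<Sum>q\<in>Q. coef x q *\<^sub>R v q) \<in> L"
  using rep_coef unfolding rep_def by blast

section \<open>The coefficients as functions of the point\<close>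

lemma coef_cong:
  assumes "x - y \<in> L"
  shows "coef x = coef y"
proof (rule coef_eqI)
  have "x - (\<Sum>q\<in>Q. coef y q *\<^sub>R v q) = (x - y) + (y - (\<Sum>q\<in>Q. coef y q *\<^sub>R v q))" by simp
  also have "\<dots> \<in> L" by (intro subspace_add subspace_L assms coef_sum)
  finally show "rep x (coef y)" using rep_coef[of y] unfolding rep_def by blast
qed

lemma coef_scaleR:
  assumes "0 \<le> a"
  shows "coef (a *\<^sub>R x) q = a * coef x q"
proof -
  have "rep (a *\<^sub>R x) (\<lambda>q. a * coef x q)"
  proof -
    have "a *\<^sub>R x - (\<Sum>q\<in>Q. (a * coef x q) *\<^sub>R v q) = a *\<^sub>R (x - (\<Sum>q\<in>Q. coef x q *\<^sub>R v q))"
      by (simp add: scaleR_sum_right scaleR_diff_right)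
    also have "\<dots> \<in> L" by (intro subspace_scale subspace_L coef_sum)
    finally show ?thesis
      using assms coef_nonneg coef_support chain_subset[OF coef_chain[of x], of "{q. a * coef x q \<noteq> 0}"]
      unfolding rep_def by auto
  qed
  from coef_eqI[OF this] show ?thesis by simp
qed

lemma coef_sum_v:
  assumes "C \<subseteq> Q - {apex}" "chain C" "\<And>q. q \<in> C \<Longrightarrow> 0 \<le> t q"
  shows "coef (\<Sum>q\<in>C. t q *\<^sub>R v q) q = (if q \<in> C then t q else 0)"
proof -
  have "(\<Sum>q\<in>Q. (if q \<in> C then t q else 0) *\<^sub>R v q) = (\<Sum>q\<in>C. t q *\<^sub>R v q)"
    using finite_Q assms(1) by (intro sum.mono_neutral_cong_right) auto
  then have "rep (\<Sum>q\<in>C. t q *\<^sub>R v q) (\<lambda>q. if q \<in> C then t q else 0)"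
    unfolding rep_def using assms subspace_0[OF subspace_L]
    by (auto split: if_splits intro: chain_subset)
  from coef_eqI[OF this] show ?thesis by simp
qed

text \<open>Split the coefficients into positive and negative parts. The two resulting sums are
  congruent modulo \<open>L\<close> and expand along the same chain, so uniqueness equates the
  parts, and only 0 has equal positive and negative part.\<close>

lemma independent_mod_L:
  assumes "C \<subseteq> Q - {apex}" "chain C" "(\<Sum>q\<in>C. a q *\<^sub>R v q) \<in> L" "q \<in> C"
  shows "a q = 0"
proof -
  let ?x = "\<Sum>q\<in>C. max (a q) 0 *\<^sub>R v q" and ?y = "\<Sum>q\<in>C. max (- a q) 0 *\<^sub>R v q"
  have "?x - ?y = (\<Sum>q\<in>C. (max (a q) 0 - max (- a q) 0) *\<^sub>R v q)"
    by (simp add: sum_subtractf scaleR_diff_left)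
  also have "\<dots> = (\<Sum>q\<in>C. a q *\<^sub>R v q)"
    by (rule sum.cong) (auto simp: max_def)
  finally have "coef ?x = coef ?y" using assms(3) by (intro coef_cong) simp
  moreover have "coef ?x q = max (a q) 0"
    using coef_sum_v[OF assms(1,2), of "\<lambda>q. max (a q) 0"] assms(4) by simp
  moreover have "coef ?y q = max (- a q) 0"
    using coef_sum_v[OF assms(1,2), of "\<lambda>q. max (- a q) 0"] assms(4) by simp
  ultimately show ?thesis by (auto simp: max_def split: if_splits)
qed

text \<open>Pairing with \<open>z\<close> reads off the coefficient of \<open>q\<close> on the whole
  cone over \<open>C\<close>, which shows that this coefficient is linear there. The vector is the
  rescaled component of \<open>v q\<close> orthogonal to \<open>L\<close> and the other
  representatives, nonzero by \<open>independent_mod_L\<close>.\<close>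

lemma dual_vector:
  assumes "C \<subseteq> Q - {apex}" "chain C" "q \<in> C"
  shows "\<exists>z. (\<forall>l\<in>L. z \<bullet> l = 0) \<and> (\<forall>p\<in>C - {q}. z \<bullet> v p = 0) \<and> z \<bullet> v q = 1"
proof -
  let ?S = "span (L \<union> v ` (C - {q}))"
  have fin: "finite C" using assms(1) finite_Q finite_subset by blast
  obtain y w where yw: "y \<in> ?S" "\<And>u. u \<in> ?S \<Longrightarrow> orthogonal w u" "v q = y + w"
    using orthogonal_subspace_decomp_exists[of "L \<union> v ` (C - {q})" "v q"] by blast
  have "w \<noteq> 0"
  proof
    assume "w = 0"
    with yw have "v q \<in> ?S" by simp
    then have "\<exists>l m. v q = l + m \<and> l \<in> span L \<and> m \<in> span (v ` (C - {q}))"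
      unfolding span_Un by (rule CollectD)
    then obtain l m where lm: "l \<in> span L" "m \<in> span (v ` (C - {q}))" "v q = l + m"
      by blast
    have "inj_on v (C - {q})" by (rule inj_on_subset[OF inj_v]) (use assms(1) in auto)
    with lm(2) obtain u where m: "m = (\<Sum>p\<in>C - {q}. u p *\<^sub>R v p)"
      using fin by (auto simp: span_finite sum.reindex)
    have "(\<Sum>p\<in>C. (if p = q then 1 else - u p) *\<^sub>R v p)
      = v q + (\<Sum>p\<in>C - {q}. (if p = q then 1 else - u p) *\<^sub>R v p)"
      using fin assms(3) by (simp add: sum.remove)
    also have "(\<Sum>p\<in>C - {q}. (if p = q then 1 else - u p) *\<^sub>R v p) = - m"
      unfolding m sum_negf[symmetric] by (rule sum.cong) auto
    also have "v q + - m = l" using lm(3) by simp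
    finally have "(\<Sum>p\<in>C. (if p = q then 1 else - u p) *\<^sub>R v p) \<in> L"
      using lm(1) span_eq_iff[THEN iffD2, OF subspace_L] by simp
    from independent_mod_L[OF assms(1,2) this assms(3)] show False by simp
  qed
  moreover have "w \<bullet> v q = w \<bullet> w"
    using yw(2)[OF yw(1)] unfolding yw(3) by (simp add: inner_add_right orthogonal_def)
  moreover have "w \<bullet> u = 0" if "u \<in> L \<union> v ` (C - {q})" for u
    using yw(2)[OF span_base[OF that]] by (simp add: orthogonal_def)
  ultimately show ?thesis
    by (intro exI[of _ "(1 / (w \<bullet> w)) *\<^sub>R w"]) auto
qed

text \<open>The simplicial cones over the chains form a finite closed cover, on each member of which the
  coefficients are linear.\<close>

lemma continuous_coef: "continuous_on UNIV (\<lambda>x. coef x q)"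
proof -
  let ?I = "{C. C \<subseteq> Q - {apex} \<and> chain C}"
  define z where "z C q = (SOME z. (\<forall>l\<in>L. z \<bullet> l = 0) \<and> (\<forall>p\<in>C - {q}. z \<bullet> v p = 0) \<and> z \<bullet> v q = 1)" for C q
  have z_all: "(\<forall>l\<in>L. z C q \<bullet> l = 0) \<and> (\<forall>p\<in>C - {q}. z C q \<bullet> v p = 0) \<and> z C q \<bullet> v q = 1"
    if "C \<in> ?I" "q \<in> C" for C q
    unfolding z_def by (rule someI_ex, rule dual_vector) (use that in auto)
  have z: "\<And>C q l. C \<in> ?I \<Longrightarrow> q \<in> C \<Longrightarrow> l \<in> L \<Longrightarrow> z C q \<bullet> l = 0"
      "\<And>C q p. C \<in> ?I \<Longrightarrow> q \<in> C \<Longrightarrow> p \<in> C \<Longrightarrow> p \<noteq> q \<Longrightarrow> z C q \<bullet> v p = 0"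
      "\<And>C q. C \<in> ?I \<Longrightarrow> q \<in> C \<Longrightarrow> z C q \<bullet> v q = 1"
    using z_all by simp_all
  \<comment> \<open>The cone over \<open>C\<close> thickened by \<open>L\<close>, described through
    the dual vectors so that it is visibly closed.\<close>
  define K where "K C = (\<Inter>q\<in>C. {x. 0 \<le> z C q \<bullet> x}) \<inter> (\<lambda>x. x - (\<Sum>q\<in>C. (z C q \<bullet> x) *\<^sub>R v q)) -` L" for C
  have closed_K: "closed (K C)" for C
    unfolding K_def
    by (intro closed_Int closed_INT ballI closed_Collect_le continuous_intros
        closed_vimage closed_subspace subspace_L)
  have cont_K: "continuous_on (K C) (\<lambda>x. coef x q)" if C: "C \<in> ?I" for C
  proof -
    have eq: "(if q \<in> C then z C q \<bullet> x else 0) = coef x q" if "x \<in> K C" for x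
    proof -
      have "coef x = coef (\<Sum>q\<in>C. (z C q \<bullet> x) *\<^sub>R v q)"
        using that by (intro coef_cong) (simp add: K_def)
      then show ?thesis
        using coef_sum_v[of C "\<lambda>q. z C q \<bullet> x" q] C that by (simp add: K_def)
    qed
    have "continuous_on (K C) (\<lambda>x. if q \<in> C then z C q \<bullet> x else 0)"
      by (cases "q \<in> C") (auto intro!: continuous_intros)
    then show ?thesis by (rule continuous_on_eq) (rule eq)
  qed
  have fin_I: "finite ?I" using finite_Q by simp
  have cover: "(\<Union>C\<in>?I. K C) = UNIV"
  proof -
    have "x \<in> K {q. coef x q \<noteq> 0} \<and> {q. coef x q \<noteq> 0} \<in> ?I" for x
    proof -
      let ?C = "{q. coef x q \<noteq> 0}"
      have C: "?C \<in> ?I" using coef_support coef_chain by auto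
      have fin: "finite ?C" using C finite_Q finite_subset by blast
      define l where "l = x - (\<Sum>q\<in>?C. coef x q *\<^sub>R v q)"
      have "(\<Sum>q\<in>?C. coef x q *\<^sub>R v q) = (\<Sum>q\<in>Q. coef x q *\<^sub>R v q)"
        using finite_Q coef_support by (intro sum.mono_neutral_left) auto
      then have l: "l \<in> L" using coef_sum by (simp add: l_def)
      have x: "x = l + (\<Sum>q\<in>?C. coef x q *\<^sub>R v q)" by (simp add: l_def)
      have zx: "z ?C q \<bullet> x = coef x q" if q: "q \<in> ?C" for q
      proof -
        have "z ?C q \<bullet> x = z ?C q \<bullet> l + (\<Sum>p\<in>?C. coef x p * (z ?C q \<bullet> v p))"
          by (subst x) (simp add: inner_add_right inner_sum_right)
        also have "(\<Sum>p\<in>?C. coef x p * (z ?C q \<bullet> v p)) = (\<Sum>p\<in>?C. if p = q then coef x q else 0)"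
          by (rule sum.cong) (use z[OF C q] z(3)[OF C q] in auto)
        also have "\<dots> = coef x q" using fin q by simp
        finally show ?thesis using z(1)[OF C q l] by simp
      qed
      have "x - (\<Sum>q\<in>?C. (z ?C q \<bullet> x) *\<^sub>R v q) = l"
        unfolding l_def using zx by simp
      then show ?thesis using C l zx coef_nonneg by (auto simp: K_def)
    qed
    then show ?thesis by blast
  qed
  have "continuous_on (\<Union>C\<in>?I. K C) (\<lambda>x. coef x q)"
    by (intro continuous_on_closed_Union fin_I closed_K cont_K)
  then show ?thesis by (simp only: cover)
qed

text \<open>The complex is a cone with tip \<open>v apex\<close>. A point \<open>y\<close> goes to
  its expansion with weights rescaled to total \<open>norm y\<close>, and the tip receives the
  remaining \<open>1 - norm y\<close>; so the centre goes to the tip and the sphere to the chains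
  avoiding it. The weights are kept in the conclusion because they later separate the interior of a
  cell from its boundary.\<close>

lemma homeomorphism_ball_chain_complex:
  assumes T: "subspace T" and L: "L = {x. \<forall>y\<in>T. y \<bullet> x = 0}"
  shows "\<exists>h g. homeomorphism (cball 0 1 \<inter> T) (\<Union>C\<in>{C. C \<subseteq> Q \<and> C \<noteq> {} \<and> chain C}. convex hull (v ` C)) h g
    \<and> (\<forall>y\<in>cball 0 1 \<inter> T. \<exists>w. h y = (\<Sum>q\<in>Q. w q *\<^sub>R v q) \<and> (\<forall>q. 0 \<le> w q) \<and> sum w Q = 1
          \<and> {q. w q \<noteq> 0} \<subseteq> Q \<and> chain {q. w q \<noteq> 0} \<and> w apex = 1 - norm y)"
proof -
  define p where "p y = (\<Sum>q\<in>Q. coef y q)" for y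
  \<comment> \<open>At the origin numerator and denominator vanish, and the quotient is 0 by
    convention.\<close>
  define a where "a y = norm y / p y" for y
  define w where "w y q = (if q = apex then 1 - norm y else a y * coef y q)" for y q
  define h where "h y = (\<Sum>q\<in>Q. w y q *\<^sub>R v q)" for y
  have coef_apex: "coef y apex = 0" for y using coef_support by blast
  have p_nonneg: "0 \<le> p y" for y unfolding p_def by (intro sum_nonneg coef_nonneg)
  have coef_le_p: "coef y q \<le> p y" for y q
  proof (cases "q \<in> Q")
    case True
    then show ?thesis unfolding p_def using finite_Q coef_nonneg by (intro member_le_sum) auto
  next
    case False
    then have "coef y q = 0" using coef_support by blast
    then show ?thesis using p_nonneg by simp
  qed
  have TL: "y = 0" if "y \<in> T" "y \<in> L" for y using that unfolding L by auto
  have p_pos: "0 < p y" if "y \<in> T" "y \<noteq> 0" for y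
  proof (rule ccontr)
    assume "\<not> 0 < p y"
    then have "coef y q = 0" for q using coef_le_p[of y q] coef_nonneg[of y q] by simp
    then show False using coef_sum[of y] TL that by simp
  qed
  have p_scale: "p (b *\<^sub>R y) = b * p y" if "0 \<le> b" for b y
    unfolding p_def using coef_scaleR[OF that] by (simp add: sum_distrib_left)
  have a_nonneg: "0 \<le> a y" for y unfolding a_def using p_nonneg by simp
  have ap: "a y * p y = norm y" if "y \<in> T" for y
    using p_pos[OF that] unfolding a_def by (cases "y = 0") auto
  have h_split: "h y = (1 - norm y) *\<^sub>R v apex + a y *\<^sub>R (\<Sum>q\<in>Q. coef y q *\<^sub>R v q)" for y
  proof -
    have "h y = (1 - norm y) *\<^sub>R v apex + (\<Sum>q\<in>Q - {apex}. w y q *\<^sub>R v q)"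
      unfolding h_def using finite_Q apex_in by (simp add: sum.remove w_def)
    also have "(\<Sum>q\<in>Q - {apex}. w y q *\<^sub>R v q) = (\<Sum>q\<in>Q. (a y * coef y q) *\<^sub>R v q)"
      using finite_Q coef_apex by (intro sum.mono_neutral_cong_left) (auto simp: w_def)
    finally show ?thesis by (simp add: scaleR_sum_right)
  qed
  \<comment> \<open>Modulo \<open>L\<close> the map merely rescales \<open>y\<close>. Since
    \<open>T\<close> meets \<open>L\<close> only in 0, injectivity reduces to comparing
    norms.\<close>
  have h_mod_L: "h y - a y *\<^sub>R y \<in> L" for y
  proof -
    have "h y - a y *\<^sub>R y = (1 - norm y) *\<^sub>R v apex - a y *\<^sub>R (y - (\<Sum>q\<in>Q. coef y q *\<^sub>R v q))"
      unfolding h_split by (simp add: scaleR_diff_right)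
    also have "\<dots> \<in> L"
      by (intro subspace_diff subspace_scale subspace_L v_apex_in_L coef_sum)
    finally show ?thesis .
  qed
  have w_nonneg: "0 \<le> w y q" if "norm y \<le> 1" for y q
    using that a_nonneg coef_nonneg by (simp add: w_def)
  have w_sum: "sum (w y) Q = 1" if "y \<in> T" for y
  proof -
    have "sum (w y) Q = (1 - norm y) + (\<Sum>q\<in>Q - {apex}. w y q)"
      using finite_Q apex_in by (simp add: sum.remove w_def)
    also have "(\<Sum>q\<in>Q - {apex}. w y q) = (\<Sum>q\<in>Q. a y * coef y q)"
      using finite_Q coef_apex by (intro sum.mono_neutral_cong_left) (auto simp: w_def)
    also have "\<dots> = norm y" using ap[OF that] by (simp add: p_def sum_distrib_left)
    finally show ?thesis by simp
  qed
  have w_support: "{q. w y q \<noteq> 0} \<subseteq> insert apex {q. coef y q \<noteq> 0}" for y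
    by (auto simp: w_def)
  then have w_Q: "{q. w y q \<noteq> 0} \<subseteq> Q" for y using coef_support apex_in by blast
  have w_chain: "chain {q. w y q \<noteq> 0}" for y
    by (rule chain_subset[OF chain_insert_apex w_support]) (use coef_chain coef_support in auto)
  have cont_w: "continuous_on T (\<lambda>y. w y q)" for q
  proof (cases "q = apex")
    case True
    then show ?thesis by (simp add: w_def) (intro continuous_intros)
  next
    case False
    have "continuous (at y within T) (\<lambda>y. a y * coef y q)" if y: "y \<in> T" for y
    proof (cases "y = 0")
      case True
      \<comment> \<open>No coefficient exceeds \<open>p\<close>, so each rescaled weight is bounded
        by the norm. This gives continuity at the origin, where \<open>a\<close> itself need not be
        continuous.\<close>
      have bnd: "norm (a x * coef x q) \<le> norm x" for x
      proof -
        have "norm x * coef x q \<le> norm x * p x" using coef_le_p by (intro mult_left_mono) auto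
        then show ?thesis
          using p_nonneg[of x] coef_nonneg[of x q] by (cases "p x = 0") (auto simp: a_def field_simps)
      qed
      have "((\<lambda>x. a x * coef x q) \<longlongrightarrow> 0) (at 0 within T)"
        by (rule Lim_null_comparison[OF always_eventually[OF allI[OF bnd]]
              tendsto_norm_zero[OF tendsto_ident_at]])
      then show ?thesis using True by (simp add: continuous_within a_def)
    next
      case False
      have c: "continuous (at y within T) (\<lambda>x. coef x r)" for r
        using continuous_coef by (meson UNIV_I continuous_on_eq_continuous_within continuous_within_subset subset_UNIV)
      show ?thesis unfolding a_def using p_pos[OF y False] unfolding p_def
        by (intro continuous_intros c) auto
    qed
    then show ?thesis using False by (simp add: w_def continuous_on_eq_continuous_within)
  qed
  have cont_h: "continuous_on (cball 0 1 \<inter> T) h"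
    unfolding h_def by (intro continuous_intros continuous_on_subset[OF cont_w]) auto
  have inj_h: "inj_on h (cball 0 1 \<inter> T)"
  proof (rule inj_onI)
    fix y z assume y: "y \<in> cball 0 1 \<inter> T" and z: "z \<in> cball 0 1 \<inter> T" and e: "h y = h z"
    have "(h z - a z *\<^sub>R z) - (h y - a y *\<^sub>R y) \<in> L"
      by (intro subspace_diff subspace_L h_mod_L)
    then have "a y *\<^sub>R y - a z *\<^sub>R z \<in> L" using e by simp
    moreover have "a y *\<^sub>R y - a z *\<^sub>R z \<in> T"
      using y z T by (intro subspace_diff subspace_scale) auto
    ultimately have eq: "a y *\<^sub>R y = a z *\<^sub>R z" using TL by fastforce
    then have nn: "norm y = norm z"
      using p_scale[OF a_nonneg, of y y] p_scale[OF a_nonneg, of z z] ap y z by simp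
    show "y = z"
    proof (cases "y = 0")
      case True
      then show ?thesis using nn by simp
    next
      case False
      have "a y * norm y = a z * norm z"
        using arg_cong[OF eq, of norm] a_nonneg by simp
      then have "a y = a z" using nn False by auto
      moreover have "a y \<noteq> 0" using False p_pos[of y] y by (simp add: a_def)
      ultimately show ?thesis using eq by simp
    qed
  qed
  have "h ` (cball 0 1 \<inter> T) = (\<Union>C\<in>{C. C \<subseteq> Q \<and> C \<noteq> {} \<and> chain C}. convex hull (v ` C))"
  proof (intro equalityI subsetI)
    fix x assume "x \<in> h ` (cball 0 1 \<inter> T)"
    then obtain y where y: "x = h y" "norm y \<le> 1" "y \<in> T" by auto
    let ?C = "{q. w y q \<noteq> 0}"
    have fin: "finite ?C" using w_Q finite_Q finite_subset by blast
    have hC: "h y = (\<Sum>q\<in>?C. w y q *\<^sub>R v q)"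
      unfolding h_def using finite_Q w_Q by (intro sum.mono_neutral_right) auto
    have sC: "sum (w y) ?C = 1"
      unfolding w_sum[OF y(3), symmetric] using finite_Q w_Q by (intro sum.mono_neutral_left) auto
    then have "?C \<noteq> {}" by force
    have "x \<in> convex hull (v ` ?C)"
      unfolding y(1) convex_hull_finite_image[OF fin inj_on_subset[OF inj_v w_Q]] mem_Collect_eq
      using hC sC w_nonneg[OF y(2)] by (intro exI[of _ "w y"]) simp
    then show "x \<in> (\<Union>C\<in>{C. C \<subseteq> Q \<and> C \<noteq> {} \<and> chain C}. convex hull (v ` C))"
      using w_Q w_chain \<open>?C \<noteq> {}\<close> by blast
  next
    fix x assume "x \<in> (\<Union>C\<in>{C. C \<subseteq> Q \<and> C \<noteq> {} \<and> chain C}. convex hull (v ` C))"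
    then obtain C where C: "C \<subseteq> Q" "chain C" "x \<in> convex hull (v ` C)" by blast
    have fin: "finite C" "inj_on v C"
      using finite_subset[OF C(1) finite_Q] inj_on_subset[OF inj_v C(1)] by auto
    from C(3) obtain u where u: "x = (\<Sum>q\<in>C. u q *\<^sub>R v q)" "\<forall>q\<in>C. 0 \<le> u q" "sum u C = 1"
      unfolding convex_hull_finite_image[OF fin] by blast
    define u' where "u' q = (if q \<in> C then u q else 0)" for q
    have u'_nonneg: "0 \<le> u' q" for q using u by (simp add: u'_def)
    have x: "x = (\<Sum>q\<in>Q. u' q *\<^sub>R v q)" unfolding u(1) u'_def
      using finite_Q C(1) by (intro sum.mono_neutral_cong_left) auto
    have u'_sum: "sum u' Q = 1" unfolding u(3)[symmetric] u'_def
      using finite_Q C(1) by (intro sum.mono_neutral_cong_right) auto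
    \<comment> \<open>The total weight off the apex, hence the norm that the preimage must
      have.\<close>
    define lam where "lam = 1 - u' apex"
    have lam: "lam = sum u' (Q - {apex})"
      using u'_sum finite_Q apex_in by (simp add: lam_def sum.remove)
    then have lam_nonneg: "0 \<le> lam" using u'_nonneg by (simp add: sum_nonneg)
    define x0 where "x0 = (\<Sum>q\<in>C - {apex}. u q *\<^sub>R v q)"
    have coef_x0: "coef x0 q = (if q = apex then 0 else u' q)" for q
    proof -
      have "coef x0 q = (if q \<in> C - {apex} then u q else 0)" unfolding x0_def
        by (rule coef_sum_v) (use C chain_subset u(2) in auto)
      then show ?thesis by (auto simp: u'_def)
    qed
    \<comment> \<open>Orthogonal projection onto \<open>T\<close> changes \<open>x0\<close> only by
      an element of \<open>L\<close>, so the coefficients survive; rescaling to norm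
      \<open>lam\<close> then gives the preimage.\<close>
    obtain y0 z where yz: "y0 \<in> span T" "\<And>t. t \<in> span T \<Longrightarrow> orthogonal z t" "x0 = y0 + z"
      using orthogonal_subspace_decomp_exists[of T x0] by blast
    have y0: "y0 \<in> T" using yz(1) span_eq_iff[THEN iffD2, OF T] by simp
    have "x0 - y0 \<in> L" unfolding L using yz(2,3) span_base by (auto simp: orthogonal_def inner_commute)
    then have cy0: "coef y0 q = (if q = apex then 0 else u' q)" for q using coef_cong[of x0 y0] coef_x0 by simp
    have "(\<Sum>q\<in>Q. coef y0 q) = (\<Sum>q\<in>Q - {apex}. u' q)"
      using finite_Q by (intro sum.mono_neutral_cong_right) (auto simp: cy0)
    then have py0: "p y0 = lam" by (simp add: p_def lam)
    define y where "y = (if y0 = 0 then 0 else (lam / norm y0) *\<^sub>R y0)"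
    have y: "y \<in> T" using y0 T by (simp add: y_def subspace_0 subspace_scale)
    have lam0: "lam = 0 \<longleftrightarrow> y0 = 0"
      using py0 p_pos[OF y0] p_scale[of 0 y0] by (cases "y0 = 0") auto
    have ny: "norm y = lam" using lam0 lam_nonneg by (simp add: y_def)
    have "w y q = u' q" for q
    proof (cases "q = apex")
      case True
      then show ?thesis by (simp add: w_def ny lam_def)
    next
      case q: False
      show ?thesis
      proof (cases "y0 = 0")
        case True
        have "coef y0 q \<le> p y0" by (rule coef_le_p)
        then have "u' q = 0" using py0 lam0 True cy0 q u'_nonneg[of q] by auto
        then show ?thesis using q True by (simp add: w_def y_def a_def)
      next
        case False
        then have "p y = lam * lam / norm y0" "coef y q = lam / norm y0 * u' q"
          using p_scale[of "lam / norm y0" y0] coef_scaleR[of "lam / norm y0" y0 q] lam_nonneg py0 cy0 q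
          by (auto simp: y_def)
        then show ?thesis using q False lam0 by (simp add: w_def a_def ny)
      qed
    qed
    then have "h y = x" by (simp add: h_def x)
    moreover have "norm y \<le> 1" using ny lam_def u'_nonneg[of apex] by simp
    ultimately show "x \<in> h ` (cball 0 1 \<inter> T)" using y by auto
  qed
  moreover have "compact (cball 0 1 \<inter> T)" using T closed_subspace by (intro compact_Int_closed) auto
  ultimately obtain g where "homeomorphism (cball 0 1 \<inter> T)
      (\<Union>C\<in>{C. C \<subseteq> Q \<and> C \<noteq> {} \<and> chain C}. convex hull (v ` C)) h g"
    using homeomorphism_compact cont_h inj_h by metis
  moreover have "\<exists>w. h y = (\<Sum>q\<in>Q. w q *\<^sub>R v q) \<and> (\<forall>q. 0 \<le> w q) \<and> sum w Q = 1
      \<and> {q. w q \<noteq> 0} \<subseteq> Q \<and> chain {q. w q \<noteq> 0} \<and> w apex = 1 - norm y" if "y \<in> cball 0 1 \<inter> T" for y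
    using that w_nonneg w_sum w_Q w_chain by (intro exI[of _ "w y"]) (auto simp: h_def w_def)
  ultimately show ?thesis by blast
qed

end

section \<open>Leading signs\<close>

text \<open>The sentinel \<open>(d + 1, False)\<close> encodes vanishing in all coordinates 1 to
  \<open>d\<close>. It keeps \<open>LEAST\<close> well defined and makes coincidence of two columns
  the highest level.\<close>

definition lead :: "nat \<Rightarrow> (nat \<Rightarrow> real) \<Rightarrow> nat \<times> bool" where
  "lead d u = (let m = (LEAST k. 1 \<le> k \<and> (d < k \<or> u k \<noteq> 0)) in (m, m \<le> d \<and> 0 < u m))"

lemma lead_iff:
  "lead d u = (m, e) \<longleftrightarrow> 1 \<le> m \<and> m \<le> Suc d \<and> (\<forall>k. 1 \<le> k \<and> k < m \<longrightarrow> u k = 0)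
     \<and> (if m \<le> d then u m \<noteq> 0 \<and> (e \<longleftrightarrow> 0 < u m) else \<not> e)"
proof -
  let ?P = "\<lambda>k. 1 \<le> k \<and> (d < k \<or> u k \<noteq> 0)"
  have "?P (Suc d)" by simp
  then have P: "?P (Least ?P)" "Least ?P \<le> Suc d" by (rule LeastI, rule Least_le)
  have below: "\<not> ?P k" if "k < Least ?P" for k using that by (rule not_less_Least)
  show ?thesis
  proof
    assume "lead d u = (m, e)"
    then show "1 \<le> m \<and> m \<le> Suc d \<and> (\<forall>k. 1 \<le> k \<and> k < m \<longrightarrow> u k = 0)
     \<and> (if m \<le> d then u m \<noteq> 0 \<and> (e \<longleftrightarrow> 0 < u m) else \<not> e)"
      using P below by (auto simp: lead_def Let_def)
  next
    assume a: "1 \<le> m \<and> m \<le> Suc d \<and> (\<forall>k. 1 \<le> k \<and> k < m \<longrightarrow> u k = 0)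
     \<and> (if m \<le> d then u m \<noteq> 0 \<and> (e \<longleftrightarrow> 0 < u m) else \<not> e)"
    have "Least ?P = m"
    proof (rule Least_equality)
      show "?P m" using a by (auto split: if_splits)
      show "m \<le> y" if "?P y" for y
        using that a by (meson Suc_leI leI le_trans)
    qed
    then show "lead d u = (m, e)" using a by (auto simp: lead_def Let_def split: if_splits)
  qed
qed

lemma lead_cases:
  obtains m e where "lead d u = (m, e)" "1 \<le> m" "m \<le> Suc d" "\<And>k. 1 \<le> k \<Longrightarrow> k < m \<Longrightarrow> u k = 0"
    "m \<le> d \<Longrightarrow> u m \<noteq> 0" "m \<le> d \<Longrightarrow> e \<longleftrightarrow> 0 < u m" "\<not> m \<le> d \<Longrightarrow> \<not> e"
proof (cases "lead d u")
  case (Pair m e)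
  with that[of m e] show ?thesis unfolding lead_iff by (auto split: if_splits)
qed

lemma le_fst_lead:
  assumes "m \<le> Suc d"
  shows "m \<le> fst (lead d u) \<longleftrightarrow> (\<forall>k. 1 \<le> k \<and> k < m \<longrightarrow> u k = 0)"
proof (rule lead_cases[of d u])
  fix j e assume "lead d u = (j, e)" "1 \<le> j" "j \<le> Suc d" "\<And>k. 1 \<le> k \<Longrightarrow> k < j \<Longrightarrow> u k = 0"
    "j \<le> d \<Longrightarrow> u j \<noteq> 0"
  then show ?thesis using assms by (cases "m \<le> j") auto
qed

text \<open>Oriented so that a positive leading entry means that column \<open>a\<close> precedes
  column \<open>b\<close> lexicographically.\<close>

definition cdiff :: "real^'d::{finite,linorder}^'n \<Rightarrow> 'n \<Rightarrow> 'n \<Rightarrow> nat \<Rightarrow> real" where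
  "cdiff x a b k = x $ b $ coord k - x $ a $ coord k"

lemma cdiff_add: "cdiff (x + y) a b k = cdiff x a b k + cdiff y a b k"
  and cdiff_diff: "cdiff (x - y) a b k = cdiff x a b k - cdiff y a b k"
  and cdiff_scaleR: "cdiff (t *\<^sub>R x) a b k = t * cdiff x a b k"
  and cdiff_zero: "cdiff 0 a b k = 0"
  and cdiff_self: "cdiff x a a k = 0"
  and cdiff_swap: "cdiff x b a k = - cdiff x a b k"
  and cdiff_trans: "cdiff x a c k = cdiff x a b k + cdiff x b c k"
  by (simp_all add: cdiff_def algebra_simps)

type_synonym 'n signs = "'n \<Rightarrow> 'n \<Rightarrow> nat \<times> bool"

definition signs :: "real^'d::{finite,linorder}^'n \<Rightarrow> 'n signs" where
  "signs x a b = lead CARD('d) (cdiff x a b)"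

text \<open>Passing to a limit can only postpone the first coordinate in which two columns differ,
  and a pair whose level stays the same keeps its sign.\<close>

definition sle :: "'n signs \<Rightarrow> 'n signs \<Rightarrow> bool" where
  "sle p q \<longleftrightarrow> (\<forall>a b. fst (p a b) < fst (q a b) \<or> p a b = q a b)"

text \<open>The signs of \<open>y + \<epsilon> x\<close> for small \<open>\<epsilon> > 0\<close>, where \<open>s\<close> are the signs of \<open>y\<close>.\<close>

definition local_signs :: "'n signs \<Rightarrow> real^'d::{finite,linorder}^'n \<Rightarrow> 'n signs" where
  "local_signs s x a b = (if fst (signs x a b) < fst (s a b) then signs x a b else s a b)"

text \<open>Only the equations of the stratum remain, its inequalities being dropped. For the zero
  pattern this is the diagonal, the matrices with all columns equal.\<close>

definition stratum_span :: "'n signs \<Rightarrow> (real^'d::{finite,linorder}^'n) set" where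
  "stratum_span s = {x. \<forall>a b k. 1 \<le> k \<and> k < fst (s a b) \<longrightarrow> cdiff x a b k = 0}"

lemma sle_refl: "sle p p"
  and sle_trans: "sle p q \<Longrightarrow> sle q r \<Longrightarrow> sle p r"
  and sle_antisym: "sle p q \<Longrightarrow> sle q p \<Longrightarrow> p = q"
proof -
  show "sle p p" by (simp add: sle_def)
  show "sle p r" if "sle p q" "sle q r" using that unfolding sle_def by (metis less_trans)
  show "p = q" if pq: "sle p q" "sle q p"
  proof (intro ext)
    fix a b show "p a b = q a b" using pq unfolding sle_def by (metis less_asym)
  qed
qed

lemma finite_range_signs: "finite (range (signs :: real^'d::{finite,linorder}^'n::finite \<Rightarrow> _))"
proof -
  have fin: "finite {g :: 'n \<Rightarrow> 'x. \<forall>b. g b \<in> S}" if "finite S" for S :: "'x set"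
  proof -
    have "{g. \<forall>b. g b \<in> S} = PiE UNIV (\<lambda>_::'n. S)" by (auto simp: PiE_def)
    then show ?thesis using that by (simp add: finite_PiE)
  qed
  have "signs x a b \<in> {..Suc CARD('d)} \<times> UNIV" for x :: "('d,'n) mat" and a b
    unfolding signs_def by (rule lead_cases[of "CARD('d)" "cdiff x a b"]) auto
  then have "range (signs :: ('d,'n) mat \<Rightarrow> _) \<subseteq> {f. \<forall>a. f a \<in> {g. \<forall>b. g b \<in> {..Suc CARD('d)} \<times> UNIV}}"
    by blast
  moreover have "finite {f :: 'n signs. \<forall>a. f a \<in> {g. \<forall>b. g b \<in> {..Suc CARD('d)} \<times> UNIV}}"
    by (intro fin) simp
  ultimately show ?thesis by (rule finite_subset)
qed

text \<open>A pair that \<open>x\<close> resolves at an earlier level than \<open>y\<close> takes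
  the sign of \<open>x\<close> for every \<open>e > 0\<close>; at the other pairs the leading entry
  of \<open>y\<close> dominates for small \<open>e\<close>. There are finitely many pairs, so one
  \<open>e\<close> serves all, and local patterns are patterns of actual matrices.\<close>

lemma local_signs_realized:
  fixes x y :: "real^'d::{finite,linorder}^'n::finite"
  shows "\<exists>e>0. signs (y + e *\<^sub>R x) = local_signs (signs y) x"
proof -
  have "eventually (\<lambda>e. signs (y + e *\<^sub>R x) a b = local_signs (signs y) x a b) (at_right 0)" for a b
  proof -
    let ?d = "CARD('d)"
    let ?u = "cdiff y a b" and ?w = "cdiff x a b"
    obtain m f where u: "lead ?d ?u = (m, f)" "1 \<le> m" "m \<le> Suc ?d" "\<And>k. 1 \<le> k \<Longrightarrow> k < m \<Longrightarrow> ?u k = 0"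
      "m \<le> ?d \<Longrightarrow> ?u m \<noteq> 0" "m \<le> ?d \<Longrightarrow> f \<longleftrightarrow> 0 < ?u m" "\<not> m \<le> ?d \<Longrightarrow> \<not> f"
      by (rule lead_cases[of ?d ?u]) blast
    obtain j g where w: "lead ?d ?w = (j, g)" "1 \<le> j" "j \<le> Suc ?d" "\<And>k. 1 \<le> k \<Longrightarrow> k < j \<Longrightarrow> ?w k = 0"
      "j \<le> ?d \<Longrightarrow> ?w j \<noteq> 0" "j \<le> ?d \<Longrightarrow> g \<longleftrightarrow> 0 < ?w j" "\<not> j \<le> ?d \<Longrightarrow> \<not> g"
      by (rule lead_cases[of ?d ?w]) blast
    have su: "signs y a b = (m, f)" and sw: "signs x a b = (j, g)" using u w by (simp_all add: signs_def)
    show ?thesis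
    proof (cases "j < m")
      case True
      have "signs (y + e *\<^sub>R x) a b = (j, g)" if "0 < e" for e
        unfolding signs_def lead_iff using True that u w
        by (auto simp: cdiff_add cdiff_scaleR zero_less_mult_iff)
      then show ?thesis
        using True su sw by (auto simp: local_signs_def eventually_at_filter)
    next
      case False
      have "eventually (\<lambda>e. m \<le> ?d \<longrightarrow> ?u m + e * ?w m \<noteq> 0 \<and> (f \<longleftrightarrow> 0 < ?u m + e * ?w m)) (at_right 0)"
      proof (cases "m \<le> ?d")
        case True
        have lim: "((\<lambda>e. ?u m + e * ?w m) \<longlongrightarrow> ?u m + 0 * ?w m) (at_right 0)"
          by (intro tendsto_intros)
        show ?thesis
        proof (cases f)
          case True
          then have "0 < ?u m" using u \<open>m \<le> ?d\<close> by simp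
          then have "eventually (\<lambda>e. 0 < ?u m + e * ?w m) (at_right 0)"
            using order_tendstoD(1)[OF lim, of 0] by simp
          then show ?thesis by eventually_elim (use True in auto)
        next
          case False
          then have "?u m < 0" using u \<open>m \<le> ?d\<close> by force
          then have "eventually (\<lambda>e. ?u m + e * ?w m < 0) (at_right 0)"
            using order_tendstoD(2)[OF lim, of 0] by simp
          then show ?thesis by eventually_elim (use False in auto)
        qed
      qed auto
      then show ?thesis
      proof eventually_elim
        case (elim e)
        have "signs (y + e *\<^sub>R x) a b = (m, f)"
          unfolding signs_def lead_iff using elim False u w by (auto simp: cdiff_add cdiff_scaleR)
        then show ?case using False su sw by (simp add: local_signs_def)
      qed
    qed
  qed
  then have "eventually (\<lambda>e. \<forall>a b. signs (y + e *\<^sub>R x) a b = local_signs (signs y) x a b) (at_right 0)"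
    by (intro eventually_all_finite)
  then have "eventually (\<lambda>e. 0 < e \<and> (\<forall>a b. signs (y + e *\<^sub>R x) a b = local_signs (signs y) x a b)) (at_right 0)"
    using eventually_at_right_less[of "0::real"] by eventually_elim auto
  then obtain e where "0 < e" "\<forall>a b. signs (y + e *\<^sub>R x) a b = local_signs (signs y) x a b"
    using eventually_happens trivial_limit_at_right_real by blast
  then show ?thesis by (intro exI[of _ e]) (auto intro!: ext)
qed

text \<open>This makes the global stratification the local one at the zero matrix.\<close>

lemma local_signs_zero:
  fixes x :: "real^'d::{finite,linorder}^'n"
  shows "local_signs (signs (0 :: ('d,'n) mat)) x = signs x"
proof (intro ext)
  fix a b
  have z: "signs (0 :: ('d,'n) mat) a b = (Suc CARD('d), False)"
    unfolding signs_def lead_iff by (simp add: cdiff_zero)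
  show "local_signs (signs (0 :: ('d,'n) mat)) x a b = signs x a b"
    unfolding local_signs_def z
    by (rule lead_cases[of "CARD('d)" "cdiff x a b"]) (auto simp: signs_def)
qed

lemma sle_signs_zero:
  fixes x :: "real^'d::{finite,linorder}^'n"
  shows "sle (signs x) (signs (0 :: ('d,'n) mat))"
  unfolding sle_def local_signs_zero[of x, symmetric] unfolding local_signs_def by auto

lemma fst_signs_le: "fst (signs (x :: real^'d::{finite,linorder}^'n) a b) \<le> Suc CARD('d)"
  unfolding signs_def by (rule lead_cases[of "CARD('d)" "cdiff x a b"]) auto

lemma le_fst_signs:
  fixes x y :: "real^'d::{finite,linorder}^'n"
  shows "fst (signs y a b) \<le> fst (signs x a b) \<longleftrightarrow> (\<forall>k. 1 \<le> k \<and> k < fst (signs y a b) \<longrightarrow> cdiff x a b k = 0)"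
  using le_fst_lead[OF fst_signs_le[of y a b], of "cdiff x a b"] unfolding signs_def .

lemma stratum_span_iff:
  fixes x y :: "real^'d::{finite,linorder}^'n"
  shows "x \<in> stratum_span (signs y) \<longleftrightarrow> local_signs (signs y) x = signs y"
proof
  assume "x \<in> stratum_span (signs y)"
  then have "fst (signs y a b) \<le> fst (signs x a b)" for a b
    unfolding le_fst_signs stratum_span_def by blast
  then show "local_signs (signs y) x = signs y"
    by (intro ext) (simp add: local_signs_def leD)
next
  assume e: "local_signs (signs y) x = signs y"
  have "fst (signs y a b) \<le> fst (signs x a b)" for a b
    using fun_cong[OF fun_cong[OF e], of a b] by (auto simp: local_signs_def split: if_splits)
  then show "x \<in> stratum_span (signs y)" unfolding le_fst_signs stratum_span_def by blast
qed

lemma subspace_stratum_span: "subspace (stratum_span s)"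
  unfolding subspace_def stratum_span_def by (auto simp: cdiff_zero cdiff_add cdiff_scaleR)

text \<open>At a pair that \<open>z\<close> resolves before \<open>y\<close> does, \<open>x\<close>
  vanishes below the level of \<open>z\<close> and at that level is zero or has the sign of
  \<open>z\<close>, so nothing cancels. At the other pairs neither \<open>x\<close> nor
  \<open>z\<close> has a nonzero entry below the level of \<open>y\<close>.\<close>

lemma local_signs_absorb:
  fixes x y z :: "real^'d::{finite,linorder}^'n"
  assumes "sle (signs z) (signs y)" "sle (signs z) (local_signs (signs y) x)" "0 < t"
  shows "local_signs (signs y) (x + t *\<^sub>R z) = signs z"
proof (intro ext)
  fix a b
  obtain m e where z: "signs z a b = (m, e)" by force
  have zc: "1 \<le> m" "m \<le> Suc CARD('d)" "\<And>k. 1 \<le> k \<Longrightarrow> k < m \<Longrightarrow> cdiff z a b k = 0"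
      "m \<le> CARD('d) \<Longrightarrow> cdiff z a b m \<noteq> 0 \<and> (e \<longleftrightarrow> 0 < cdiff z a b m)"
    using z unfolding signs_def lead_iff by auto
  show "local_signs (signs y) (x + t *\<^sub>R z) a b = signs z a b"
  proof (cases "m < fst (signs y a b)")
    case True
    then have md: "m \<le> CARD('d)" using fst_signs_le[of y a b] by simp
    have "m < fst (signs x a b) \<or> signs x a b = (m, e)"
      using assms(2)[unfolded sle_def, rule_format, of a b] True z
      by (auto simp: local_signs_def split: if_splits)
    then have xc: "\<And>k. 1 \<le> k \<Longrightarrow> k < m \<Longrightarrow> cdiff x a b k = 0"
      "cdiff x a b m = 0 \<or> cdiff x a b m \<noteq> 0 \<and> (e \<longleftrightarrow> 0 < cdiff x a b m)"
    proof -
      obtain j f where x: "signs x a b = (j, f)" by force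
      assume "m < fst (signs x a b) \<or> signs x a b = (m, e)"
      then have "m < j \<or> j = m \<and> f = e" using x by auto
      then show "\<And>k. 1 \<le> k \<Longrightarrow> k < m \<Longrightarrow> cdiff x a b k = 0"
        "cdiff x a b m = 0 \<or> cdiff x a b m \<noteq> 0 \<and> (e \<longleftrightarrow> 0 < cdiff x a b m)"
        using x md zc(1) unfolding signs_def lead_iff by auto
    qed
    have "signs (x + t *\<^sub>R z) a b = (m, e)"
    proof -
      have *: "cdiff x a b m + t * cdiff z a b m \<noteq> 0 \<and> (e \<longleftrightarrow> 0 < cdiff x a b m + t * cdiff z a b m)"
      proof (cases e)
        case True
        then have "0 \<le> cdiff x a b m" "0 < t * cdiff z a b m" using xc(2) zc(4) md assms(3) by auto
        then show ?thesis using True by linarith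
      next
        case False
        then have "cdiff x a b m \<le> 0" "cdiff z a b m < 0" using xc(2) zc(4) md by auto
        then have "t * cdiff z a b m < 0" using assms(3) by (simp add: mult_pos_neg)
        then show ?thesis using False \<open>cdiff x a b m \<le> 0\<close> by linarith
      qed
      show ?thesis unfolding signs_def lead_iff
        using * xc(1) zc md by (simp add: cdiff_add cdiff_scaleR)
    qed
    then show ?thesis using True z by (simp add: local_signs_def)
  next
    case False
    then have zy: "signs z a b = signs y a b"
      using assms(1)[unfolded sle_def, rule_format, of a b] z by auto
    have "fst (signs z a b) \<le> fst (signs x a b)"
      using assms(2)[unfolded sle_def, rule_format, of a b] unfolding zy
      by (auto simp: local_signs_def split: if_splits)
    then have "fst (signs z a b) \<le> fst (signs (x + t *\<^sub>R z) a b)"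
      unfolding le_fst_signs using zc(3) z by (simp add: cdiff_add cdiff_scaleR)
    then show ?thesis unfolding zy by (simp add: local_signs_def)
  qed
qed

text \<open>Moving in direction \<open>- z\<close>, the leading entries at the pairs in
  \<open>I\<close> change linearly towards 0, and \<open>t\<close> is the first time one of them
  vanishes. The pairs that have not yet vanished keep their signs, and those that vanish rise to a
  later level.\<close>

lemma local_signs_exit:
  fixes x y z :: "real^'d::{finite,linorder}^'n::finite"
  assumes z: "signs z = local_signs (signs y) x" and ne: "signs z \<noteq> signs y"
  shows "\<exists>t>0. sle (signs z) (local_signs (signs y) (x - t *\<^sub>R z)) \<and> local_signs (signs y) (x - t *\<^sub>R z) \<noteq> signs z"
proof -
  define I where "I = {(a, b). fst (signs x a b) < fst (signs y a b)}"
  define m where "m a b = fst (signs z a b)" for a b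
  \<comment> \<open>The vanishing time of the leading entry of a pair; positive on \<open>I\<close>,
    because \<open>x\<close> and \<open>z\<close> have the same signs there.\<close>
  define r where "r = (\<lambda>(a, b). cdiff x a b (m a b) / cdiff z a b (m a b))"
  define t where "t = Min (r ` I)"
  have fin: "finite I" by simp
  have "I \<noteq> {}"
  proof
    assume "I = {}"
    then have "signs z = signs y" unfolding z by (intro ext) (auto simp: I_def local_signs_def)
    then show False using ne by simp
  qed
  then have t_in: "t \<in> r ` I" unfolding t_def using fin by (intro Min_in) auto
  have zx: "signs z a b = signs x a b" "m a b < fst (signs y a b)" if "(a, b) \<in> I" for a b
    using that unfolding m_def z by (auto simp: I_def local_signs_def)
  have zy: "signs z a b = signs y a b" "fst (signs y a b) \<le> fst (signs x a b)" if "(a, b) \<notin> I" for a b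
    using that unfolding z by (auto simp: I_def local_signs_def)
  have m: "1 \<le> m a b" "m a b \<le> CARD('d)" "\<And>k. 1 \<le> k \<Longrightarrow> k < m a b \<Longrightarrow> cdiff x a b k = 0 \<and> cdiff z a b k = 0"
    "cdiff x a b (m a b) \<noteq> 0" "cdiff z a b (m a b) \<noteq> 0"
    "snd (signs z a b) \<longleftrightarrow> 0 < cdiff x a b (m a b)" "snd (signs z a b) \<longleftrightarrow> 0 < cdiff z a b (m a b)"
    if I: "(a, b) \<in> I" for a b
  proof -
    have md: "m a b \<le> CARD('d)" using zx(2)[OF I] fst_signs_le[of y a b] by simp
    have 1: "signs z a b = (m a b, snd (signs z a b))" and 2: "signs x a b = (m a b, snd (signs z a b))"
      using zx(1)[OF I] by (auto simp: m_def)
    show "1 \<le> m a b" "m a b \<le> CARD('d)" "\<And>k. 1 \<le> k \<Longrightarrow> k < m a b \<Longrightarrow> cdiff x a b k = 0 \<and> cdiff z a b k = 0"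
      "cdiff x a b (m a b) \<noteq> 0" "cdiff z a b (m a b) \<noteq> 0"
      "snd (signs z a b) \<longleftrightarrow> 0 < cdiff x a b (m a b)" "snd (signs z a b) \<longleftrightarrow> 0 < cdiff z a b (m a b)"
      using 1[unfolded signs_def lead_iff] 2[unfolded signs_def lead_iff] md by (auto simp: signs_def)
  qed
  have "0 < r p" if "p \<in> I" for p
    using m[of "fst p" "snd p"] that unfolding r_def
    by (cases p) (auto simp: zero_less_divide_iff)
  then have t_pos: "0 < t" using t_in by auto
  let ?x = "x - t *\<^sub>R z"
  have level: "m a b \<le> fst (signs ?x a b)" for a b
  proof (cases "(a, b) \<in> I")
    case True
    show ?thesis unfolding m_def le_fst_signs unfolding m_def[symmetric]
      using m(3)[OF True] by (simp add: cdiff_diff cdiff_scaleR)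
  next
    case False
    have "cdiff x a b k = 0 \<and> cdiff z a b k = 0" if "1 \<le> k" "k < m a b" for k
    proof -
      have "fst (signs z a b) \<le> fst (signs x a b)" using zy[OF False] by simp
      moreover have "fst (signs z a b) \<le> fst (signs z a b)" by simp
      ultimately show ?thesis unfolding le_fst_signs using that by (simp add: m_def)
    qed
    then show ?thesis unfolding m_def le_fst_signs unfolding m_def[symmetric]
      by (simp add: cdiff_diff cdiff_scaleR)
  qed
  have at_m: "cdiff ?x a b (m a b) = cdiff z a b (m a b) * (r (a, b) - t)" if "(a, b) \<in> I" for a b
    using m(5)[OF that] by (simp add: r_def cdiff_diff cdiff_scaleR field_simps)
  have above: "m a b < fst (signs ?x a b)" if I: "(a, b) \<in> I" and "r (a, b) = t" for a b
  proof -
    have "Suc (m a b) \<le> fst (lead CARD('d) (cdiff ?x a b))"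
    proof (subst le_fst_lead)
      show "Suc (m a b) \<le> Suc CARD('d)" using m(2)[OF I] by simp
      show "\<forall>k. 1 \<le> k \<and> k < Suc (m a b) \<longrightarrow> cdiff ?x a b k = 0"
        using at_m[OF I] m(3)[OF I] that(2) by (auto simp: less_Suc_eq cdiff_diff cdiff_scaleR)
    qed
    then show ?thesis by (simp add: signs_def)
  qed
  have "fst (signs z a b) < fst (local_signs (signs y) ?x a b) \<or> signs z a b = local_signs (signs y) ?x a b" for a b
  proof (cases "(a, b) \<in> I")
    case I: True
    have "t \<le> r (a, b)" unfolding t_def using fin I by simp
    then consider "r (a, b) = t" | "t < r (a, b)" by linarith
    then show ?thesis
    proof cases
      case 1
      then show ?thesis using above[OF I] zx(2)[OF I] by (auto simp: local_signs_def m_def)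
    next
      case 2
      have "signs ?x a b = (m a b, snd (signs z a b))"
        unfolding signs_def[of ?x] lead_iff using 2 m[OF I] at_m[OF I]
        by (auto simp: cdiff_diff cdiff_scaleR zero_less_mult_iff)
      then show ?thesis using zx(2)[OF I] by (auto simp: local_signs_def m_def)
    qed
  next
    case False
    then show ?thesis using level[of a b] zy[OF False] by (auto simp: local_signs_def m_def)
  qed
  then have "sle (signs z) (local_signs (signs y) ?x)" unfolding sle_def by blast
  moreover have "local_signs (signs y) ?x \<noteq> signs z"
  proof -
    obtain a b where I: "(a, b) \<in> I" and "t = r (a, b)" using t_in by auto
    then have "fst (local_signs (signs y) ?x a b) \<noteq> m a b"
      using above[OF I] zx(2)[OF I] by (auto simp: local_signs_def)
    then show ?thesis unfolding m_def by metis
  qed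
  ultimately show ?thesis using t_pos by blast
qed

text \<open>The representatives are left arbitrary, so that a single equivariant choice can serve at
  all strata simultaneously.\<close>

lemma cone_stratification_signs:
  fixes v :: "'n signs \<Rightarrow> real^'d::{finite,linorder}^'n::finite"
  assumes v: "\<And>q. q \<in> range (signs :: ('d,'n) mat \<Rightarrow> _) \<Longrightarrow> signs (v q) = q"
    and s: "s \<in> range (signs :: ('d,'n) mat \<Rightarrow> _)"
  shows "cone_stratification {q \<in> range (signs :: ('d,'n) mat \<Rightarrow> _). sle q s} sle s (local_signs s) v (stratum_span s)"
proof -
  obtain y :: "('d,'n) mat" where y: "s = signs y" using s by auto
  have in_range: "local_signs s x \<in> range (signs :: ('d,'n) mat \<Rightarrow> _)" for x :: "('d,'n) mat"
    using local_signs_realized[of y x] unfolding y by (metis rangeI)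
  have le: "sle (local_signs s x) s" for x :: "('d,'n) mat"
    by (simp add: sle_def local_signs_def)
  show ?thesis
  proof
    show "finite {q \<in> range (signs :: ('d,'n) mat \<Rightarrow> _). sle q s}"
      by (rule finite_subset[OF _ finite_range_signs]) auto
    show "local_signs s (x + t *\<^sub>R v q) = q"
      if "q \<in> {q \<in> range (signs :: ('d,'n) mat \<Rightarrow> _). sle q s}" "sle q (local_signs s x)" "0 < t" for q x t
      using local_signs_absorb[of "v q" y x t] that v[of q] unfolding y by auto
    show "\<exists>t>0. sle (local_signs s x) (local_signs s (x - t *\<^sub>R v (local_signs s x)))
        \<and> local_signs s (x - t *\<^sub>R v (local_signs s x)) \<noteq> local_signs s x"
      if "local_signs s x \<noteq> s" for x
      using local_signs_exit[of "v (local_signs s x)" y x] that v[OF in_range[of x]] unfolding y by auto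
    show "x \<in> stratum_span s \<longleftrightarrow> local_signs s x = s" for x :: "('d,'n) mat"
      unfolding y by (rule stratum_span_iff)
  qed (use s in_range le sle_refl sle_trans sle_antisym subspace_stratum_span in auto)
qed

section \<open>Strings\<close>

lemma coord_inj: "inj_on (coord :: nat \<Rightarrow> 'd::{finite,linorder}) {1..CARD('d)}"
proof (rule inj_onI)
  fix k l assume k: "k \<in> {1..CARD('d)}" and l: "l \<in> {1..CARD('d)}" and e: "(coord k :: 'd) = coord l"
  have "k - 1 < length (sorted_list_of_set (UNIV :: 'd set))" "l - 1 < length (sorted_list_of_set (UNIV :: 'd set))"
    using k l by auto
  then have "k - 1 = l - 1"
    using e nth_eq_iff_index_eq[OF distinct_sorted_list_of_set[of "UNIV :: 'd set"]] unfolding coord_def by blast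
  then show "k = l" using k l by auto
qed

lemma coord_surj: "\<exists>k\<in>{1..CARD('d)}. coord k = (i :: 'd::{finite,linorder})"
proof -
  have "i \<in> set (sorted_list_of_set (UNIV :: 'd set))" by simp
  then obtain j where j: "j < CARD('d)" "sorted_list_of_set (UNIV :: 'd set) ! j = i"
    unfolding in_set_conv_nth length_sorted_list_of_set by blast
  then show ?thesis by (intro bexI[of _ "Suc j"]) (auto simp: coord_def)
qed

lemma unitv_coord:
  assumes "k \<in> {1..CARD('d)}" "l \<in> {1..CARD('d)}"
  shows "(unitv k :: real^'d::{finite,linorder}) $ coord l = (if l = k then 1 else 0)"
  using inj_onD[OF coord_inj _ assms(2,1)] by (auto simp: unitv_def axis_def)

lemma vec_eq_coord_iff:
  "x = y \<longleftrightarrow> (\<forall>k\<in>{1..CARD('d)}. x $ coord k = y $ coord k)" for x y :: "real^'d::{finite,linorder}"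
  unfolding vec_eq_iff using coord_surj by metis

lemma conf_space_iff:
  "x \<in> conf_space \<longleftrightarrow> (\<forall>a b. a \<noteq> b \<longrightarrow> fst (signs x a b) \<le> CARD('d))"
  for x :: "real^'d::{finite,linorder}^'n"
proof -
  have "x $ a = x $ b \<longleftrightarrow> Suc CARD('d) \<le> fst (signs x a b)" for a b
    unfolding vec_eq_coord_iff signs_def le_fst_lead[OF order_refl] by (auto simp: cdiff_def less_Suc_eq_le)
  then show ?thesis unfolding conf_space_def by (auto simp: not_less_eq_eq)
qed

lemma signs_self: "signs x a a = (Suc CARD('d), False)" for x :: "real^'d::{finite,linorder}^'n"
  unfolding signs_def lead_iff by (simp add: cdiff_self)

lemma signs_eqD:
  fixes x :: "real^'d::{finite,linorder}^'n"
  assumes "signs x a b = (m, e)"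
  shows "1 \<le> m" "m \<le> Suc CARD('d)" "1 \<le> k \<Longrightarrow> k < m \<Longrightarrow> cdiff x a b k = 0"
    "m \<le> CARD('d) \<Longrightarrow> cdiff x a b m \<noteq> 0" "m \<le> CARD('d) \<Longrightarrow> e \<longleftrightarrow> 0 < cdiff x a b m"
    "e \<Longrightarrow> m \<le> CARD('d)"
  using assms unfolding signs_def lead_iff by presburger+

lemma signs_eqI:
  fixes x :: "real^'d::{finite,linorder}^'n"
  assumes "1 \<le> m" "m \<le> CARD('d)" "\<And>k. 1 \<le> k \<Longrightarrow> k < m \<Longrightarrow> cdiff x a b k = 0" "0 < cdiff x a b m"
  shows "signs x a b = (m, True)"
  using assms unfolding signs_def lead_iff by simp

lemma signs_swap:
  fixes x :: "real^'d::{finite,linorder}^'n"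
  assumes "signs x a b = (m, True)"
  shows "signs x b a = (m, False)"
proof -
  have "cdiff x b a = (\<lambda>k. - cdiff x a b k)" using cdiff_swap by blast
  moreover have "lead CARD('d) (\<lambda>k. - u k) = (m, False)" if "lead CARD('d) u = (m, True)" for u
    using that unfolding lead_iff by (cases "m \<le> CARD('d)") simp_all
  ultimately show ?thesis using assms by (simp add: signs_def)
qed

text \<open>The pattern that \<open>vpt c\<close> turns out to have. The parameter \<open>d\<close>
  is visible only on the diagonal, so comparisons between strings hold for every value of it, and
  some later ones take 0.\<close>

definition string_signs :: "nat \<Rightarrow> 'n string \<Rightarrow> 'n signs" where
  "string_signs d c a b = (if a = b then (Suc d, False) else (mval c a b, before (fst c) a b))"

lemma pos_nth: "distinct \<sigma> \<Longrightarrow> k < length \<sigma> \<Longrightarrow> pos \<sigma> (\<sigma> ! k) = k"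
  unfolding pos_def by (rule the_equality) (auto simp: nth_eq_iff_index_eq)

lemma Pprime_iff:
  "(\<sigma>, i) \<in> Pprime (D :: 'd::{finite,linorder} itself) \<longleftrightarrow> distinct \<sigma> \<and> set \<sigma> = UNIV
     \<and> length \<sigma> = CARD('n) \<and> length i = CARD('n) - 1 \<and> set i \<subseteq> {1..CARD('d)}"
  for \<sigma> :: "'n::finite list"
  unfolding Pprime_def using distinct_card[of \<sigma>] by auto

lemma Pprime_nth:
  fixes \<sigma> :: "'n::finite list"
  assumes "(\<sigma>, i) \<in> Pprime (D :: 'd::{finite,linorder} itself)" "j < CARD('n) - 1"
  shows "i ! j \<in> {1..CARD('d)}"
proof -
  have "i ! j \<in> set i" using assms by (intro nth_mem) (simp add: Pprime_iff)
  then show ?thesis using assms unfolding Pprime_iff by blast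
qed

lemma nth_pos:
  fixes a :: "'n::finite"
  assumes "(\<sigma>, i) \<in> Pprime (D :: 'd::{finite,linorder} itself)"
  shows "pos \<sigma> a < CARD('n)" "\<sigma> ! pos \<sigma> a = a"
proof -
  have \<sigma>: "distinct \<sigma>" "set \<sigma> = UNIV" "length \<sigma> = CARD('n)" using assms by (auto simp: Pprime_iff)
  then obtain k where "k < length \<sigma>" "\<sigma> ! k = a" by (metis UNIV_I in_set_conv_nth)
  then show "pos \<sigma> a < CARD('n)" "\<sigma> ! pos \<sigma> a = a" using \<sigma> pos_nth[of \<sigma> k] by auto
qed

text \<open>Telescope over the steps from \<open>p\<close> to \<open>q\<close>: below the minimal
  index every step vanishes, and at that index all steps are nonnegative and at least one is
  positive. This is where the minimum in \<open>mval\<close> comes from.\<close>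

lemma signs_nth:
  fixes x :: "real^'d::{finite,linorder}^'n::finite"
  assumes P: "(\<sigma>, i) \<in> Pprime (D :: 'd itself)"
    and step: "\<And>j. j < CARD('n) - 1 \<Longrightarrow> signs x (\<sigma> ! j) (\<sigma> ! Suc j) = (i ! j, True)"
    and pq: "p < q" "q < CARD('n)"
  shows "signs x (\<sigma> ! p) (\<sigma> ! q) = (Min ((!) i ` {p..<q}), True)"
proof -
  let ?m = "Min ((!) i ` {p..<q})"
  have m_in: "?m \<in> (!) i ` {p..<q}" using pq by (intro Min_in) auto
  have m_le: "?m \<le> i ! j" if "j \<in> {p..<q}" for j using that by (intro Min_le) auto
  obtain j0 where j0: "j0 \<in> {p..<q}" "i ! j0 = ?m" using m_in by auto
  have md: "1 \<le> ?m" "?m \<le> CARD('d)"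
  proof -
    have "i ! j0 \<in> {1..CARD('d)}" using j0 pq by (intro Pprime_nth[OF P]) auto
    then show "1 \<le> ?m" "?m \<le> CARD('d)" using j0(2) by auto
  qed
  have tel: "cdiff x (\<sigma> ! p) (\<sigma> ! q) k = (\<Sum>j\<in>{p..<q}. cdiff x (\<sigma> ! j) (\<sigma> ! Suc j) k)" for k
    unfolding cdiff_def using sum_Suc_diff'[of p q "\<lambda>j. x $ (\<sigma> ! j) $ coord k"] pq by simp
  have jn: "j < CARD('n) - 1" if "j \<in> {p..<q}" for j using that pq by auto
  have step': "cdiff x (\<sigma> ! j) (\<sigma> ! Suc j) k = 0" if "j \<in> {p..<q}" "1 \<le> k" "k < i ! j" for j k
    by (rule signs_eqD(3)[OF step[OF jn[OF that(1)]] that(2,3)])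
  have pos_step: "0 < cdiff x (\<sigma> ! j) (\<sigma> ! Suc j) (i ! j)" if "j \<in> {p..<q}" for j
    using signs_eqD(5,6)[OF step[OF jn[OF that]]] by simp
  have "cdiff x (\<sigma> ! p) (\<sigma> ! q) k = 0" if "1 \<le> k" "k < ?m" for k
    unfolding tel using that step' m_le by (intro sum.neutral) (meson less_le_trans)
  moreover have "0 < cdiff x (\<sigma> ! p) (\<sigma> ! q) ?m"
    unfolding tel
  proof (rule sum_pos2[of _ j0])
    show "0 < cdiff x (\<sigma> ! j0) (\<sigma> ! Suc j0) ?m" using pos_step[OF j0(1)] j0(2) by simp
    show "0 \<le> cdiff x (\<sigma> ! j) (\<sigma> ! Suc j) ?m" if "j \<in> {p..<q}" for j
      using step'[OF that, of ?m] pos_step[OF that] m_le[OF that] md by (cases "?m = i ! j") (simp_all add: less_le)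
  qed (use j0 in auto)
  ultimately show ?thesis unfolding signs_def lead_iff using md by auto
qed

lemma signs_eq_string_signs:
  fixes x :: "real^'d::{finite,linorder}^'n::finite"
  assumes P: "(\<sigma>, i) \<in> Pprime (D :: 'd itself)"
    and step: "\<And>j. j < CARD('n) - 1 \<Longrightarrow> signs x (\<sigma> ! j) (\<sigma> ! Suc j) = (i ! j, True)"
  shows "signs x = string_signs CARD('d) (\<sigma>, i)"
proof (intro ext)
  fix a b :: 'n
  have ab: "pos \<sigma> a < CARD('n)" "\<sigma> ! pos \<sigma> a = a" "pos \<sigma> b < CARD('n)" "\<sigma> ! pos \<sigma> b = b"
    using nth_pos[OF P] by auto
  consider "a = b" | "pos \<sigma> a < pos \<sigma> b" | "pos \<sigma> b < pos \<sigma> a" using ab by (metis linorder_neqE_nat)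
  then show "signs x a b = string_signs CARD('d) (\<sigma>, i) a b"
  proof cases
    case 1
    then show ?thesis by (simp add: signs_self string_signs_def)
  next
    case 2
    then show ?thesis
      using signs_nth[OF P step 2] ab
      by (auto simp: string_signs_def mval_def before_def Let_def)
  next
    case 3
    then have "signs x b a = (Min ((!) i ` {pos \<sigma> b..<pos \<sigma> a}), True)"
      using signs_nth[OF P step 3] ab by simp
    from signs_swap[OF this] show ?thesis
      using 3 by (auto simp: string_signs_def mval_def before_def Let_def)
  qed
qed

lemma cdiff_vpt:
  "cdiff (vpt c :: ('d,'n::finite) mat) a b k = (vtilde c b - vtilde c a :: real^'d::{finite,linorder}) $ coord k"
  by (simp add: cdiff_def vpt_def)

lemma signs_vpt:
  assumes "c \<in> Pprime (D :: 'd::{finite,linorder} itself)"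
  shows "signs (vpt c :: ('d,'n::finite) mat) = string_signs CARD('d) c"
proof -
  obtain \<sigma> i where c: "c = (\<sigma>, i)" by force
  have P: "(\<sigma>, i) \<in> Pprime D" using assms c by simp
  show ?thesis unfolding c
  proof (rule signs_eq_string_signs[OF P])
    fix j assume j: "j < CARD('n) - 1"
    have ij: "i ! j \<in> {1..CARD('d)}" by (rule Pprime_nth[OF P j])
    have "cdiff (vpt (\<sigma>, i) :: ('d,'n) mat) (\<sigma> ! j) (\<sigma> ! Suc j) k = unitv (i ! j) $ (coord k :: 'd)" for k
      unfolding cdiff_vpt vtilde_def using P j pos_nth[of \<sigma>] by (simp add: Pprime_iff)
    moreover have "unitv (i ! j) $ (coord k :: 'd) = (if k = i ! j then 1 else 0)" if "1 \<le> k" "k \<le> CARD('d)" for k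
      using unitv_coord[OF ij, of k] that by auto
    ultimately show "signs (vpt (\<sigma>, i) :: ('d,'n) mat) (\<sigma> ! j) (\<sigma> ! Suc j) = (i ! j, True)"
      unfolding signs_def lead_iff using ij by auto
  qed
qed

text \<open>The position of a letter is the number of letters before it, which the signs record.
  Each index is then recovered as the level of two adjacent letters.\<close>

lemma string_signs_inj: "inj_on (string_signs d) (Pprime (D :: 'd::{finite,linorder} itself) :: 'n::finite string set)"
proof (rule inj_onI, clarify)
  fix \<sigma> \<sigma>' :: "'n list" and i i'
  assume P: "(\<sigma>, i) \<in> Pprime D" and P': "(\<sigma>', i') \<in> Pprime D"
    and e: "string_signs d (\<sigma>, i) = string_signs d (\<sigma>', i')"
  have eq: "mval (\<sigma>, i) a b = mval (\<sigma>', i') a b" "before \<sigma> a b = before \<sigma>' a b" if "a \<noteq> b" for a b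
    using fun_cong[OF fun_cong[OF e], of a b] that by (auto simp: string_signs_def)
  have card_pos: "pos s a = card {b. before s b a}" if s: "(s, j) \<in> Pprime D" for s :: "'n list" and j a
  proof -
    have "bij_betw (pos s) {b. before s b a} {..<pos s a}"
      unfolding bij_betw_def
    proof
      show "inj_on (pos s) {b. before s b a}" by (rule inj_onI) (metis nth_pos[OF s])
      have "k \<in> pos s ` {b. before s b a}" if k: "k < pos s a" for k
      proof -
        have "k < CARD('n)" using k nth_pos[OF s, of a] by (metis less_trans)
        then have "pos s (s ! k) = k" using s pos_nth[of s k] by (auto simp: Pprime_iff)
        then show ?thesis using k by (intro image_eqI[of _ _ "s ! k"]) (simp_all add: before_def)
      qed
      then show "pos s ` {b. before s b a} = {..<pos s a}" by (auto simp: before_def)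
    qed
    then show ?thesis using bij_betw_same_card by fastforce
  qed
  have pos_eq: "pos \<sigma> a = pos \<sigma>' a" for a
  proof -
    have "before \<sigma> b a = before \<sigma>' b a" for b using eq(2)[of b a] by (cases "b = a") (auto simp: before_def)
    then show ?thesis using card_pos[OF P] card_pos[OF P'] by simp
  qed
  have \<sigma>: "\<sigma> = \<sigma>'"
  proof (rule nth_equalityI)
    show "length \<sigma> = length \<sigma>'" using P P' by (simp add: Pprime_iff)
    show "\<sigma> ! k = \<sigma>' ! k" if "k < length \<sigma>" for k
      using that P pos_nth[of \<sigma> k] pos_eq[of "\<sigma> ! k"] nth_pos[OF P', of "\<sigma> ! k"]
      by (metis Pprime_iff)
  qed
  have "i = i'"
  proof (rule nth_equalityI)
    show "length i = length i'" using P P' by (simp add: Pprime_iff)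
    fix k assume "k < length i"
    then have k: "Suc k < CARD('n)" using P by (auto simp: Pprime_iff)
    then have "pos \<sigma> (\<sigma> ! k) = k" "pos \<sigma> (\<sigma> ! Suc k) = Suc k"
      using P pos_nth[of \<sigma> k] pos_nth[of \<sigma> "Suc k"] by (auto simp: Pprime_iff)
    then have "mval (\<sigma>, j) (\<sigma> ! k) (\<sigma> ! Suc k) = j ! k" for j by (simp add: mval_def)
    moreover have "\<sigma> ! k \<noteq> \<sigma> ! Suc k" using k P by (auto simp: Pprime_iff nth_eq_iff_index_eq)
    ultimately show "i ! k = i' ! k" using eq(1) \<sigma> by metis
  qed
  then show "\<sigma> = \<sigma>' \<and> i = i'" using \<sigma> by simp
qed

lemma before_total:
  assumes "c \<in> Pprime (D :: 'd::{finite,linorder} itself)" "a \<noteq> (b :: 'n::finite)"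
  shows "before (fst c) b a \<longleftrightarrow> \<not> before (fst c) a b"
proof -
  have "(fst c, snd c) \<in> Pprime D" using assms by simp
  then have "pos (fst c) a \<noteq> pos (fst c) b" using nth_pos assms(2) by metis
  then show ?thesis by (auto simp: before_def)
qed

lemma mval_commute: "mval c a b = mval c b a"
  by (simp add: mval_def min.commute max.commute)

text \<open>A pair in opposite order carries different signs, so \<open>sle\<close> demands a
  strictly smaller level; this is the strict alternative in \<open>prec\<close>.\<close>

lemma prec_iff_sle:
  fixes c c' :: "'n::finite string"
  assumes P: "c \<in> Pprime (D :: 'd::{finite,linorder} itself)" and P': "c' \<in> Pprime D"
  shows "prec c c' \<longleftrightarrow> sle (string_signs d c) (string_signs d c')"
proof
  assume p: "prec c c'"
  show "sle (string_signs d c) (string_signs d c')"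
    unfolding sle_def
  proof (intro allI)
    fix a b
    show "fst (string_signs d c a b) < fst (string_signs d c' a b) \<or> string_signs d c a b = string_signs d c' a b"
    proof (cases "a = b")
      case False
      then show ?thesis
        using p[unfolded prec_def, rule_format, of a b] p[unfolded prec_def, rule_format, of b a]
          before_total[OF P False] before_total[OF P' False] mval_commute[of _ b a]
        by (auto simp: string_signs_def)
    qed (simp add: string_signs_def)
  qed
next
  assume s: "sle (string_signs d c) (string_signs d c')"
  show "prec c c'"
    unfolding prec_def
  proof (intro allI impI)
    fix a b assume ab: "a \<noteq> b \<and> before (fst c') a b"
    then show "before (fst c) a b \<and> mval c a b \<le> mval c' a b \<or> before (fst c) b a \<and> mval c a b < mval c' a b"
      using s[unfolded sle_def, rule_format, of a b] before_total[OF P, of a b]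
      by (auto simp: string_signs_def)
  qed
qed

lemma signs_trans:
  assumes "snd (signs x a b)" "snd (signs x b c)"
  shows "snd (signs (x :: real^'d::{finite,linorder}^'n) a c)"
proof -
  obtain m m' where s: "signs x a b = (m, True)" "signs x b c = (m', True)"
    using assms by (metis (full_types) prod.collapse)
  have "signs x a c = (min m m', True)"
  proof (rule signs_eqI)
    note m = signs_eqD[OF s(1)] and m' = signs_eqD[OF s(2)]
    show "1 \<le> min m m'" "min m m' \<le> CARD('d)" using m(1,6) m'(1) by auto
    show "cdiff x a c k = 0" if "1 \<le> k" "k < min m m'" for k
      using m(3)[of k] m'(3)[of k] that by (simp add: cdiff_trans[of x a c k b])
    have pos: "0 < cdiff x a b m" "0 < cdiff x b c m'" using m(5,6) m'(5,6) by auto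
    show "0 < cdiff x a c (min m m')"
    proof (cases m m' rule: linorder_cases)
      case less
      then show ?thesis using pos m'(3)[of m] m(1) by (simp add: cdiff_trans[of x a c _ b])
    next
      case equal
      then show ?thesis using pos by (simp add: cdiff_trans[of x a c _ b])
    next
      case greater
      then show ?thesis using pos m(3)[of m'] m'(1) by (simp add: cdiff_trans[of x a c _ b])
    qed
  qed
  then show ?thesis by simp
qed

text \<open>Sort the columns lexicographically: the rank of a column counts the columns preceding
  it, and the indices are the levels of neighbours.\<close>

lemma string_signs_surj:
  fixes x :: "real^'d::{finite,linorder}^'n::finite"
  assumes x: "x \<in> conf_space"
  shows "\<exists>c\<in>Pprime (D :: 'd itself). string_signs CARD('d) c = signs x"
proof -
  define R where "R a b \<longleftrightarrow> snd (signs x a b)" for a b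
  define rank where "rank a = card {b. R b a}" for a
  have irrefl: "\<not> R a a" for a by (simp add: R_def signs_self)
  have trans: "R a b \<Longrightarrow> R b c \<Longrightarrow> R a c" for a b c unfolding R_def by (rule signs_trans)
  have total: "R a b \<or> R b a" if "a \<noteq> b" for a b
  proof -
    obtain m e where s: "signs x a b = (m, e)" by force
    then have "m \<le> CARD('d)" using x that unfolding conf_space_iff by force
    then show ?thesis
    proof (cases e)
      case False
      have "signs x b a = (m, True)"
        using s \<open>m \<le> CARD('d)\<close> False unfolding signs_def lead_iff by (auto simp: cdiff_swap[of x b a])
      then show ?thesis by (simp add: R_def)
    qed (use s in \<open>simp add: R_def\<close>)
  qed
  have rank_less: "rank a < rank b" if "R a b" for a b
  proof -
    have "{c. R c a} \<subset> {c. R c b}" using that trans irrefl by blast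
    then show ?thesis unfolding rank_def by (intro psubset_card_mono) auto
  qed
  have inj: "inj rank"
    by (rule injI) (metis total rank_less less_irrefl)
  have "rank a < CARD('n)" for a
    unfolding rank_def using irrefl by (intro psubset_card_mono) auto
  then have "rank ` UNIV = {..<CARD('n)}"
    using inj by (intro card_subset_eq) (auto simp: card_image)
  then have rank_inv: "rank (inv rank k) = k" if "k < CARD('n)" for k
    using that by (intro f_inv_into_f) auto
  define \<sigma> where "\<sigma> = map (inv rank) [0..<CARD('n)]"
  define i where "i = map (\<lambda>j. fst (signs x (\<sigma> ! j) (\<sigma> ! Suc j))) [0..<CARD('n) - 1]"
  have \<sigma>: "distinct \<sigma>" "set \<sigma> = UNIV"
  proof -
    have "inj_on (inv rank) {0..<CARD('n)}" using rank_inv by (metis atLeastLessThan_iff inj_onI)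
    then show "distinct \<sigma>" by (simp add: \<sigma>_def distinct_map)
    have "a \<in> set \<sigma>" for a
    proof -
      have "a = inv rank (rank a)" using inj by simp
      moreover have "rank a < CARD('n)" using \<open>rank ` UNIV = {..<CARD('n)}\<close> by auto
      ultimately show ?thesis unfolding \<sigma>_def by force
    qed
    then show "set \<sigma> = UNIV" by auto
  qed
  have step: "R (\<sigma> ! j) (\<sigma> ! Suc j)" if "j < CARD('n) - 1" for j
  proof -
    have "rank (\<sigma> ! j) = j" "rank (\<sigma> ! Suc j) = Suc j" using that rank_inv by (auto simp: \<sigma>_def)
    then show ?thesis using total[of "\<sigma> ! j" "\<sigma> ! Suc j"] rank_less[of "\<sigma> ! Suc j" "\<sigma> ! j"] by fastforce
  qed
  have "fst (signs x (\<sigma> ! j) (\<sigma> ! Suc j)) \<in> {1..CARD('d)}" if "j < CARD('n) - 1" for j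
  proof -
    have "\<sigma> ! j \<noteq> \<sigma> ! Suc j" using step[OF that] irrefl by metis
    moreover have "1 \<le> fst (signs x (\<sigma> ! j) (\<sigma> ! Suc j))"
      unfolding signs_def by (rule lead_cases[of "CARD('d)" "cdiff x (\<sigma> ! j) (\<sigma> ! Suc j)"]) auto
    ultimately show ?thesis using x by (auto simp: conf_space_iff)
  qed
  then have P: "(\<sigma>, i) \<in> Pprime D"
    unfolding Pprime_def using \<sigma> by (auto simp: i_def)
  have "signs x = string_signs CARD('d) (\<sigma>, i)"
  proof (rule signs_eq_string_signs[OF P])
    show "signs x (\<sigma> ! j) (\<sigma> ! Suc j) = (i ! j, True)" if "j < CARD('n) - 1" for j
      using step[OF that] that by (simp add: i_def R_def prod_eq_iff)
  qed
  then show ?thesis using P by metis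
qed

lemma mval_in_set:
  assumes P: "c \<in> Pprime (D :: 'd::{finite,linorder} itself)" and "a \<noteq> (b :: 'n::finite)"
  shows "mval c a b \<in> set (snd c)"
proof -
  obtain \<sigma> i where c: "c = (\<sigma>, i)" by force
  have ab: "pos \<sigma> a < CARD('n)" "pos \<sigma> b < CARD('n)" "pos \<sigma> a \<noteq> pos \<sigma> b"
    using nth_pos[OF P[unfolded c]] assms(2) by metis+
  let ?K = "{min (pos \<sigma> a) (pos \<sigma> b)..<max (pos \<sigma> a) (pos \<sigma> b)}"
  have "Min ((!) i ` ?K) \<in> (!) i ` ?K" using ab by (intro Min_in) auto
  also have "\<dots> \<subseteq> set i" using ab P[unfolded c] by (auto simp: Pprime_iff intro!: nth_mem)
  finally show ?thesis by (simp add: c mval_def)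
qed

lemma mval_bounds:
  assumes P: "c \<in> Pprime (D :: 'd::{finite,linorder} itself)" and "a \<noteq> (b :: 'n::finite)"
  shows "mval c a b \<in> {1..CARD('d)}"
  using mval_in_set[OF assms] P by (cases c) (auto simp: Pprime_iff)

lemma vpt_in_conf_space:
  assumes "c \<in> Pprime (D :: 'd::{finite,linorder} itself)"
  shows "(vpt c :: ('d,'n::finite) mat) \<in> conf_space"
  unfolding conf_space_iff signs_vpt[OF assms] using mval_bounds[OF assms] by (simp add: string_signs_def)

lemma conf_space_iff_string_signs:
  "x \<in> conf_space \<longleftrightarrow> signs x \<in> string_signs CARD('d) ` Pprime (D :: 'd itself)"
  for x :: "real^'d::{finite,linorder}^'n::finite"
proof
  show "signs x \<in> string_signs CARD('d) ` Pprime D" if "x \<in> conf_space"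
    using string_signs_surj[OF that, of D] by force
  assume "signs x \<in> string_signs CARD('d) ` Pprime D"
  then obtain c where "c \<in> Pprime D" "signs x = signs (vpt c :: ('d,'n) mat)" using signs_vpt by force
  then show "x \<in> conf_space" using vpt_in_conf_space[of c D] unfolding conf_space_iff by auto
qed

text \<open>Levels cannot increase on passing to a smaller pattern, so distinct columns stay
  distinct. This is what confines the local stratification at a string to strings.\<close>

lemma sle_string_signs_in:
  assumes "q \<in> range (signs :: real^'d::{finite,linorder}^'n::finite \<Rightarrow> _)"
    and "sle q q'" "q' \<in> string_signs CARD('d) ` Pprime (D :: 'd itself)"
  shows "q \<in> string_signs CARD('d) ` Pprime D"
proof -
  obtain x :: "('d,'n) mat" where x: "q = signs x" using assms(1) by auto
  obtain c where "c \<in> Pprime D" "q' = signs (vpt c :: ('d,'n) mat)" using assms(3) signs_vpt by force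
  then have q': "fst (q' a b) \<le> CARD('d)" if "a \<noteq> b" for a b
    using vpt_in_conf_space[of c D] that unfolding conf_space_iff by auto
  have "fst (q a b) \<le> fst (q' a b)" for a b using assms(2) unfolding sle_def by (metis less_imp_le order_refl)
  then have "x \<in> conf_space" unfolding conf_space_iff x[symmetric] using q' by (meson le_trans)
  then show ?thesis unfolding x using conf_space_iff_string_signs by blast
qed

section \<open>Representative vectors\<close>

text \<open>A representative of every stratum, including those with coinciding columns, that is chosen
  compatibly with the symmetric group.\<close>

definition count_vec :: "'n signs \<Rightarrow> real^'d::{finite,linorder}^'n" where
  "count_vec q = (\<chi> a. \<Sum>k=1..CARD('d). real (card {c. q c a = (k, True)}) *\<^sub>R unitv k)"

lemma count_vec_coord:
  assumes "k \<in> {1..CARD('d)}"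
  shows "(count_vec q :: ('d::{finite,linorder},'n::finite) mat) $ a $ coord k = real (card {c. q c a = (k, True)})"
proof -
  have "(count_vec q :: ('d,'n) mat) $ a $ coord k
      = (\<Sum>l=1..CARD('d). real (card {c. q c a = (l, True)}) * (unitv l :: (real,'d) vec) $ coord k)"
    by (simp add: count_vec_def)
  also have "\<dots> = (\<Sum>l=1..CARD('d). if k = l then real (card {c. q c a = (k, True)}) else 0)"
  proof (rule sum.cong)
    fix l assume l: "l \<in> {1..CARD('d)}"
    show "real (card {c. q c a = (l, True)}) * (unitv l :: (real,'d) vec) $ coord k
        = (if k = l then real (card {c. q c a = (k, True)}) else 0)"
      unfolding unitv_coord[OF l assms] by simp
  qed simp
  also have "\<dots> = real (card {c. q c a = (k, True)})" using assms by (simp add: sum.delta')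
  finally show ?thesis .
qed

lemma signs_swap':
  fixes x :: "real^'d::{finite,linorder}^'n"
  assumes "signs x a b = (m, False)" "m \<le> CARD('d)"
  shows "signs x b a = (m, True)"
  by (rule signs_eqI) (use signs_eqD[OF assms(1)] assms(2) in \<open>auto simp: cdiff_swap[of x b a]\<close>)

lemma signs_shift:
  fixes x :: "real^'d::{finite,linorder}^'n"
  assumes s: "signs x c a = (k, True)" and z: "\<And>l. 1 \<le> l \<Longrightarrow> l < k \<Longrightarrow> cdiff x a b l = 0" "0 \<le> cdiff x a b k"
  shows "signs x c b = (k, True)"
proof (rule signs_eqI)
  note m = signs_eqD[OF s]
  show "1 \<le> k" "k \<le> CARD('d)" using m by auto
  show "cdiff x c b l = 0" if "1 \<le> l" "l < k" for l
    using m(3)[OF that] z(1)[OF that] by (simp add: cdiff_trans[of x c b l a])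
  show "0 < cdiff x c b k" using m(5,6) z(2) by (simp add: cdiff_trans[of x c b k a])
qed

text \<open>Coordinate \<open>k\<close> of column \<open>a\<close> counts the columns that precede
  \<open>a\<close> with first difference at \<open>k\<close>. If \<open>a\<close> and
  \<open>b\<close> agree up to \<open>k\<close>, the same columns are counted for both. If
  \<open>a\<close> precedes \<open>b\<close> with first difference at \<open>m\<close>, every column
  counted at \<open>m\<close> for \<open>a\<close> is counted for \<open>b\<close>, and so is
  \<open>a\<close> itself.\<close>

lemma signs_count_vec: "signs (count_vec (signs x) :: ('d,'n) mat) = signs x"
  for x :: "real^'d::{finite,linorder}^'n::finite"
proof (intro ext)
  fix a b
  let ?y = "count_vec (signs x) :: ('d,'n) mat"
  have zero: "cdiff ?y a b k = 0" if k: "1 \<le> k" "k \<le> CARD('d)" and z: "\<And>l. 1 \<le> l \<Longrightarrow> l \<le> k \<Longrightarrow> cdiff x a b l = 0" for a b k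
  proof -
    have z': "cdiff x b a l = 0" if "1 \<le> l" "l \<le> k" for l using z[OF that] by (simp add: cdiff_swap[of x b a])
    have "signs x c a = (k, True) \<longleftrightarrow> signs x c b = (k, True)" for c
      using signs_shift[of x c a k b] signs_shift[of x c b k a] z z' k by auto
    then show ?thesis using k by (simp add: cdiff_def count_vec_coord)
  qed
  have pos: "signs ?y a b = (m, True)" if s: "signs x a b = (m, True)" for a b m
  proof (rule signs_eqI)
    note m = signs_eqD[OF s]
    show m1: "1 \<le> m" "m \<le> CARD('d)" using m by auto
    show "cdiff ?y a b k = 0" if "1 \<le> k" "k < m" for k
      using that m1 m(3) by (intro zero) auto
    have "signs x c b = (m, True)" if "signs x c a = (m, True)" for c
      using that by (rule signs_shift) (use m in auto)
    moreover have "signs x a a \<noteq> (m, True)" by (simp add: signs_self)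
    ultimately have "{c. signs x c a = (m, True)} \<subset> {c. signs x c b = (m, True)}" using s by blast
    then have "card {c. signs x c a = (m, True)} < card {c. signs x c b = (m, True)}"
      by (intro psubset_card_mono) auto
    then show "0 < cdiff ?y a b m" using m1 by (simp add: cdiff_def count_vec_coord)
  qed
  obtain m e where s: "signs x a b = (m, e)" by force
  consider e | "\<not> e" "m \<le> CARD('d)" | "\<not> e" "m = Suc CARD('d)" using signs_eqD(2)[OF s] by linarith
  then show "signs ?y a b = signs x a b"
  proof cases
    case 1
    then show ?thesis using pos s by simp
  next
    case 2
    then show ?thesis using signs_swap[OF pos[OF signs_swap'[of x a b m]]] s by simp
  next
    case 3
    have "cdiff ?y a b k = 0" if "1 \<le> k" "k \<le> CARD('d)" for k
      using that signs_eqD(3)[OF s] 3 by (intro zero) auto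
    then have "signs ?y a b = (Suc CARD('d), False)" unfolding signs_def lead_iff by simp
    then show ?thesis using s 3 by simp
  qed
qed

text \<open>On strings the theorem prescribes \<open>vpt\<close>. Column permutations preserve each
  of the two cases, so the combined choice remains equivariant.\<close>

definition sign_vec :: "'n signs \<Rightarrow> real^'d::{finite,linorder}^'n::finite" where
  "sign_vec q = (if q \<in> string_signs CARD('d) ` Pprime TYPE('d)
     then vpt (the_inv_into (Pprime TYPE('d)) (string_signs CARD('d)) q) else count_vec q)"

lemma Pprime_TYPE: "Pprime D = Pprime TYPE('d)" for D :: "'d::{finite,linorder} itself"
  by (simp add: Pprime_def)

lemma sign_vec_string_signs:
  assumes "c \<in> Pprime (D :: 'd::{finite,linorder} itself)"
  shows "(sign_vec (string_signs CARD('d) c) :: ('d,'n::finite) mat) = vpt c"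
proof -
  have c: "c \<in> Pprime TYPE('d)" using assms Pprime_TYPE by blast
  then show ?thesis unfolding sign_vec_def
    using the_inv_into_f_f[OF string_signs_inj[of "CARD('d)" "TYPE('d)"] c] by simp
qed

lemma signs_sign_vec:
  assumes "q \<in> range (signs :: ('d::{finite,linorder},'n::finite) mat \<Rightarrow> _)"
  shows "signs (sign_vec q :: ('d,'n) mat) = q"
proof (cases "q \<in> string_signs CARD('d) ` Pprime TYPE('d)")
  case True
  then obtain c where c: "c \<in> Pprime TYPE('d)" "q = string_signs CARD('d) c" by blast
  then show ?thesis using signs_vpt[OF c(1)] sign_vec_string_signs[OF c(1)] by simp
next
  case False
  obtain x :: "('d,'n) mat" where "q = signs x" using assms by blast
  then show ?thesis using False signs_count_vec[of x] by (simp add: sign_vec_def)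
qed

section \<open>Equivariance of representatives and coefficients\<close>

definition sign_act :: "('n \<Rightarrow> 'n) \<Rightarrow> 'n signs \<Rightarrow> 'n signs" where
  "sign_act \<pi> q = (\<lambda>a b. q (inv \<pi> a) (inv \<pi> b))"

lemma signs_perm_act: "signs (perm_act \<pi> x) = sign_act \<pi> (signs x)"
proof (intro ext)
  fix a b
  have "cdiff (perm_act \<pi> x) a b = cdiff x (inv \<pi> a) (inv \<pi> b)" by (simp add: fun_eq_iff cdiff_def perm_act_def)
  then show "signs (perm_act \<pi> x) a b = sign_act \<pi> (signs x) a b" by (simp add: signs_def sign_act_def)
qed

lemma sign_act_inv:
  assumes "\<pi> permutes UNIV"
  shows "sign_act (inv \<pi>) (sign_act \<pi> q) = q" "sign_act \<pi> (sign_act (inv \<pi>) q) = q"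
  using permutes_inverses[OF assms] permutes_inv_inv[OF assms] by (simp_all add: sign_act_def)

lemma pos_map:
  assumes "\<pi> permutes UNIV"
  shows "pos (map \<pi> \<sigma>) a = pos \<sigma> (inv \<pi> a)"
proof -
  have "k < length \<sigma> \<and> map \<pi> \<sigma> ! k = a \<longleftrightarrow> k < length \<sigma> \<and> \<sigma> ! k = inv \<pi> a" for k
    using permutes_inverses[OF assms] by auto
  then show ?thesis by (simp add: pos_def)
qed

lemma string_signs_str_act:
  assumes "\<pi> permutes UNIV"
  shows "string_signs d (str_act \<pi> c) = sign_act \<pi> (string_signs d c)"
proof (intro ext)
  fix a b
  have "a = b \<longleftrightarrow> inv \<pi> a = inv \<pi> b" using permutes_inverses[OF assms] by metis
  then show "string_signs d (str_act \<pi> c) a b = sign_act \<pi> (string_signs d c) a b"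
    by (simp add: string_signs_def sign_act_def str_act_def mval_def before_def Let_def pos_map[OF assms])
qed

lemma str_act_Pprime:
  assumes "\<pi> permutes (UNIV :: 'n::finite set)" "c \<in> Pprime D"
  shows "str_act \<pi> c \<in> Pprime D"
  using assms permutes_inj[OF assms(1)] permutes_image[OF assms(1)] 
  by (auto simp: Pprime_def str_act_def distinct_map intro: inj_on_subset)

lemma bij_betw_str_act:
  assumes "\<pi> permutes (UNIV :: 'n::finite set)"
  shows "bij_betw (str_act \<pi>) (Pprime D) (Pprime D)"
proof (rule bij_betwI[where g = "str_act (inv \<pi>)"])
  show "str_act \<pi> \<in> Pprime D \<rightarrow> Pprime D" "str_act (inv \<pi>) \<in> Pprime D \<rightarrow> Pprime D"
    using str_act_Pprime assms permutes_inv[OF assms] by blast+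
qed (use permutes_inv_o[OF assms] in \<open>simp_all add: str_act_def\<close>)

lemma vpt_str_act:
  assumes "\<pi> permutes (UNIV :: 'n::finite set)"
  shows "perm_act \<pi> (vpt c :: ('d::{finite,linorder},'n) mat) = vpt (str_act \<pi> c)"
proof -
  have v: "(vtilde (str_act \<pi> c) a :: (real,'d) vec) = vtilde c (inv \<pi> a)" for a
    by (simp add: vtilde_def str_act_def pos_map[OF assms])
  have "(\<Sum>b\<in>UNIV. vtilde c (inv \<pi> b) :: (real,'d) vec) = (\<Sum>b\<in>UNIV. vtilde c b)"
    by (rule sum.reindex_bij_betw) (rule permutes_imp_bij[OF permutes_inv[OF assms]])
  then show ?thesis by (simp add: perm_act_def vpt_def v vec_eq_iff)
qed

lemma sign_vec_sign_act:
  assumes \<pi>: "\<pi> permutes (UNIV :: 'n::finite set)"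
  shows "(sign_vec (sign_act \<pi> q) :: ('d::{finite,linorder},'n) mat) = perm_act \<pi> (sign_vec q)"
proof (cases "q \<in> string_signs CARD('d) ` Pprime TYPE('d)")
  case True
  then obtain c where c: "c \<in> Pprime TYPE('d)" "q = string_signs CARD('d) c" by blast
  then show ?thesis
    using sign_vec_string_signs[OF c(1)] sign_vec_string_signs[OF str_act_Pprime[OF \<pi> c(1)]]
    by (simp add: string_signs_str_act[OF \<pi>] vpt_str_act[OF \<pi>])
next
  case False
  have "sign_act \<pi> q \<notin> string_signs CARD('d) ` Pprime TYPE('d)"
  proof
    assume "sign_act \<pi> q \<in> string_signs CARD('d) ` Pprime TYPE('d)"
    then obtain c where c: "c \<in> Pprime TYPE('d)" "sign_act \<pi> q = string_signs CARD('d) c" by blast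
    then have "q = string_signs CARD('d) (str_act (inv \<pi>) c)"
      using sign_act_inv(1)[OF \<pi>, of q] string_signs_str_act[OF permutes_inv[OF \<pi>]] by simp
    then show False using False str_act_Pprime[OF permutes_inv[OF \<pi>] c(1)] by blast
  qed
  moreover have "card {c. q (inv \<pi> c) b = r} = card {c. q c b = r}" for b r
  proof -
    have "{c. q (inv \<pi> c) b = r} = \<pi> ` {c. q c b = r}"
    proof (intro equalityI subsetI)
      fix c assume "c \<in> {c. q (inv \<pi> c) b = r}"
      then show "c \<in> \<pi> ` {c. q c b = r}"
        using permutes_inverses(1)[OF \<pi>] by (intro image_eqI[of _ _ "inv \<pi> c"]) auto
    qed (use permutes_inverses(2)[OF \<pi>] in auto)
    then show ?thesis using permutes_inj[OF \<pi>] by (simp add: card_image inj_on_subset)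
  qed
  ultimately show ?thesis using False by (simp add: sign_vec_def count_vec_def perm_act_def sign_act_def vec_eq_iff)
qed

lemma linear_perm_act: "linear (perm_act \<pi>)"
  by (rule linearI) (simp_all add: perm_act_def vec_eq_iff)

text \<open>The zero pattern is the greatest one and the local signs at 0 are the signs themselves,
  so the stratification at 0 involves all patterns.\<close>

interpretation glob: cone_stratification "range (signs :: ('d::{finite,linorder},'n::finite) mat \<Rightarrow> _)" sle
  "signs (0 :: ('d,'n) mat)" "signs :: ('d,'n) mat \<Rightarrow> _" sign_vec "stratum_span (signs (0 :: ('d,'n) mat))"
proof -
  have Q: "{q \<in> range (signs :: ('d,'n) mat \<Rightarrow> _). sle q (signs (0 :: ('d,'n) mat))}
      = range (signs :: ('d,'n) mat \<Rightarrow> _)"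
    using sle_signs_zero by blast
  have strat: "local_signs (signs (0 :: ('d,'n) mat)) = (signs :: ('d,'n) mat \<Rightarrow> _)"
    using local_signs_zero by blast
  have "cone_stratification {q \<in> range (signs :: ('d,'n) mat \<Rightarrow> _). sle q (signs (0 :: ('d,'n) mat))} sle
    (signs (0 :: ('d,'n) mat)) (local_signs (signs (0 :: ('d,'n) mat))) (sign_vec :: _ \<Rightarrow> ('d,'n) mat)
    (stratum_span (signs (0 :: ('d,'n) mat)))"
    by (rule cone_stratification_signs[OF signs_sign_vec rangeI])
  then show "cone_stratification (range (signs :: ('d,'n) mat \<Rightarrow> _)) sle
    (signs (0 :: ('d,'n) mat)) (signs :: ('d,'n) mat \<Rightarrow> _) sign_vec (stratum_span (signs (0 :: ('d,'n) mat)))"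
    unfolding Q strat .
qed

text \<open>Permuting the expansion of \<open>x\<close> term by term gives an expansion of the
  permuted point, and expansions are unique.\<close>

lemma coef_perm_act:
  fixes x :: "('d::{finite,linorder},'n::finite) mat"
  assumes \<pi>: "\<pi> permutes UNIV"
  shows "glob.coef (perm_act \<pi> x) (sign_act \<pi> q) = glob.coef x q"
proof -
  let ?t = "\<lambda>q. glob.coef x (sign_act (inv \<pi>) q)"
  have sle_act: "sle (sign_act \<rho> p) (sign_act \<rho> p')" if "sle p p'" for \<rho> :: "'n \<Rightarrow> 'n" and p p'
    using that by (simp add: sle_def sign_act_def)
  have zero: "sign_act \<pi> (signs (0 :: ('d,'n) mat)) = signs (0 :: ('d,'n) mat)"
    unfolding signs_perm_act[symmetric] by (simp add: perm_act_def zero_vec_def)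
  have range: "sign_act \<pi> ` range (signs :: ('d,'n) mat \<Rightarrow> _) = range (signs :: ('d,'n) mat \<Rightarrow> _)"
  proof (intro equalityI subsetI)
    fix p assume "p \<in> sign_act \<pi> ` range (signs :: ('d,'n) mat \<Rightarrow> _)"
    then obtain y :: "('d,'n) mat" where "p = sign_act \<pi> (signs y)" by blast
    then have "p = signs (perm_act \<pi> y)" by (simp add: signs_perm_act)
    then show "p \<in> range (signs :: ('d,'n) mat \<Rightarrow> _)" by blast
  next
    fix p assume "p \<in> range (signs :: ('d,'n) mat \<Rightarrow> _)"
    then obtain y :: "('d,'n) mat" where "p = signs y" by blast
    then have "p = sign_act \<pi> (signs (perm_act (inv \<pi>) y))"
      using sign_act_inv(2)[OF \<pi>, of p] by (simp add: signs_perm_act)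
    then show "p \<in> sign_act \<pi> ` range (signs :: ('d,'n) mat \<Rightarrow> _)" by blast
  qed
  have inj: "inj_on (sign_act \<pi>) A" for A by (rule inj_onI) (metis sign_act_inv(1)[OF \<pi>])
  have sup: "{p. ?t p \<noteq> 0} = sign_act \<pi> ` {p. glob.coef x p \<noteq> 0}"
  proof (intro equalityI subsetI)
    fix p assume "p \<in> {p. ?t p \<noteq> 0}"
    then show "p \<in> sign_act \<pi> ` {p. glob.coef x p \<noteq> 0}"
      using sign_act_inv(2)[OF \<pi>, of p] by (intro image_eqI[of _ _ "sign_act (inv \<pi>) p"]) simp_all
  next
    fix p assume "p \<in> sign_act \<pi> ` {p. glob.coef x p \<noteq> 0}"
    then show "p \<in> {p. ?t p \<noteq> 0}" using sign_act_inv(1)[OF \<pi>] by auto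
  qed
  have "glob.rep (perm_act \<pi> x) ?t"
    unfolding glob.rep_def
  proof (intro conjI allI)
    show "{p. ?t p \<noteq> 0} \<subseteq> range (signs :: ('d,'n) mat \<Rightarrow> _) - {signs (0 :: ('d,'n) mat)}"
    proof -
      have "{p. glob.coef x p \<noteq> 0} \<subseteq> range (signs :: ('d,'n) mat \<Rightarrow> _) - {signs (0 :: ('d,'n) mat)}"
        using glob.coef_support by blast
      then have "{p. ?t p \<noteq> 0} \<subseteq> sign_act \<pi> ` (range (signs :: ('d,'n) mat \<Rightarrow> _) - {signs (0 :: ('d,'n) mat)})"
        unfolding sup by (rule image_mono)
      then show ?thesis using range zero by (simp add: inj_on_image_set_diff[OF inj[of UNIV]])
    qed
    show "glob.chain {p. ?t p \<noteq> 0}"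
      unfolding sup using glob.coef_chain[of x] sle_act unfolding glob.chain_def by blast
    have "(\<Sum>p\<in>range (signs :: ('d,'n) mat \<Rightarrow> _). ?t p *\<^sub>R sign_vec p)
      = (\<Sum>p\<in>sign_act \<pi> ` range (signs :: ('d,'n) mat \<Rightarrow> _). ?t p *\<^sub>R sign_vec p)"
      unfolding range ..
    also have "\<dots> = (\<Sum>p\<in>range (signs :: ('d,'n) mat \<Rightarrow> _). glob.coef x p *\<^sub>R perm_act \<pi> (sign_vec p :: ('d,'n) mat))"
      unfolding sum.reindex[OF inj] by (simp add: sign_act_inv[OF \<pi>] sign_vec_sign_act[OF \<pi>])
    also have "\<dots> = perm_act \<pi> (\<Sum>p\<in>range (signs :: ('d,'n) mat \<Rightarrow> _). glob.coef x p *\<^sub>R sign_vec p)"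
      by (simp add: linear_sum[OF linear_perm_act] linear_scale[OF linear_perm_act])
    finally have "perm_act \<pi> x - (\<Sum>p\<in>range (signs :: ('d,'n) mat \<Rightarrow> _). ?t p *\<^sub>R sign_vec p)
      = perm_act \<pi> (x - (\<Sum>p\<in>range (signs :: ('d,'n) mat \<Rightarrow> _). glob.coef x p *\<^sub>R sign_vec p))"
      by (simp add: linear_diff[OF linear_perm_act])
    also have "\<dots> \<in> stratum_span (signs (0 :: ('d,'n) mat))"
      using glob.coef_sum[of x] unfolding glob.mem_L signs_perm_act by (simp add: zero)
    finally show "perm_act \<pi> x - (\<Sum>p\<in>range (signs :: ('d,'n) mat \<Rightarrow> _). ?t p *\<^sub>R sign_vec p)
        \<in> stratum_span (signs (0 :: ('d,'n) mat))" .
  qed (rule glob.coef_nonneg)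
  from glob.coef_eqI[OF this] show ?thesis by (simp add: sign_act_inv[OF \<pi>])
qed

section \<open>The realization of the order complex\<close>

lemma string_signs_in_range:
  assumes "c \<in> Pprime (D :: 'd::{finite,linorder} itself)"
  shows "string_signs CARD('d) c \<in> range (signs :: ('d,'n::finite) mat \<Rightarrow> _)"
  unfolding signs_vpt[OF assms, symmetric] by (rule rangeI)

text \<open>Two letters are essential: with a single column the only string has the zero pattern,
  whose coefficient is lost modulo the diagonal.\<close>

lemma string_signs_nonzero:
  assumes "CARD('n::finite) \<ge> 2" "c \<in> Pprime (D :: 'd::{finite,linorder} itself)"
  shows "string_signs CARD('d) c \<noteq> signs (0 :: ('d,'n) mat)"
proof
  assume e: "string_signs CARD('d) c = signs (0 :: ('d,'n) mat)"
  have "\<not> (\<forall>a b :: 'n. a = b)"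
    using assms(1) card_le_Suc0_iff_eq[of "UNIV :: 'n set"] by auto
  then obtain a b :: 'n where ab: "a \<noteq> b" by blast
  have "signs (0 :: ('d,'n) mat) a b = (Suc CARD('d), False)"
    unfolding signs_def lead_iff by (simp add: cdiff_zero)
  then have "mval c a b = Suc CARD('d)"
    using fun_cong[OF fun_cong[OF e], of a b] ab by (simp add: string_signs_def)
  then show False using mval_bounds[OF assms(2) ab] by simp
qed

lemma string_signs_image:
  fixes D :: "'d::{finite,linorder} itself"
  assumes "CARD('n::finite) \<ge> 2" "C \<subseteq> Pprime D"
  shows "string_signs CARD('d) ` C \<subseteq> range (signs :: ('d,'n) mat \<Rightarrow> _) - {signs (0 :: ('d,'n) mat)}"
proof (rule image_subsetI)
  fix c assume "c \<in> C"
  then have "c \<in> Pprime D" using assms(2) by (rule rev_subsetD)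
  then show "string_signs CARD('d) c \<in> range (signs :: ('d,'n) mat \<Rightarrow> _) - {signs (0 :: ('d,'n) mat)}"
    using string_signs_in_range[of c D] string_signs_nonzero[OF assms(1), of c D] by simp
qed

lemma finite_Pprime: "finite (Pprime (D :: 'd::{finite,linorder} itself) :: 'n::finite string set)"
proof (rule inj_on_finite[OF string_signs_inj])
  show "string_signs CARD('d) ` Pprime D \<subseteq> range (signs :: ('d,'n) mat \<Rightarrow> _)"
    using string_signs_in_range by blast
qed (rule finite_range_signs)

lemma vpt_inj: "inj_on (vpt :: 'n string \<Rightarrow> ('d,'n) mat) (Pprime (D :: 'd::{finite,linorder} itself) :: 'n::finite string set)"
proof (rule inj_onI)
  fix c c' :: "'n string"
  assume c: "c \<in> Pprime D" "c' \<in> Pprime D" and e: "(vpt c :: ('d,'n) mat) = vpt c'"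
  have "string_signs CARD('d) c = string_signs CARD('d) c'"
    using signs_vpt[OF c(1)] signs_vpt[OF c(2)] e by simp
  then show "c = c'" using inj_onD[OF string_signs_inj _ c] by blast
qed

lemma chain_string_signs:
  assumes "C \<subseteq> Pprime (D :: 'd::{finite,linorder} itself)"
  shows "cone_stratification.chain sle (string_signs d ` C) \<longleftrightarrow> is_chain (C :: 'n::finite string set)"
proof -
  have "prec x y \<longleftrightarrow> sle (string_signs d x) (string_signs d y)" if "x \<in> C" "y \<in> C" for x y
    by (rule prec_iff_sle) (use that assms in auto)
  then show ?thesis unfolding glob.chain_def is_chain_def by simp
qed

lemma prec_refl: "prec c c" if "c \<in> Pprime (D :: 'd::{finite,linorder} itself)" for c :: "'n::finite string"
  using prec_iff_sle[OF that that] sle_refl by blast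

lemma prec_antisym:
  assumes "c \<in> Pprime (D :: 'd::{finite,linorder} itself)" "c' \<in> Pprime D" "prec c c'" "prec c' c"
  shows "c = (c' :: 'n::finite string)"
proof -
  have "string_signs 0 c = string_signs 0 c'"
    using assms(3,4) prec_iff_sle[OF assms(1,2)] prec_iff_sle[OF assms(2,1)] sle_antisym by blast
  then show ?thesis using inj_onD[OF string_signs_inj _ assms(1,2)] by blast
qed

lemma sum_sign_vec:
  assumes "C \<subseteq> Pprime (D :: 'd::{finite,linorder} itself)"
  shows "(\<Sum>q\<in>string_signs CARD('d) ` C. f q *\<^sub>R (sign_vec q :: ('d,'n::finite) mat))
    = (\<Sum>c\<in>C. f (string_signs CARD('d) c) *\<^sub>R vpt c)"
proof -
  have "(\<Sum>q\<in>string_signs CARD('d) ` C. f q *\<^sub>R (sign_vec q :: ('d,'n) mat))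
    = (\<Sum>c\<in>C. f (string_signs CARD('d) c) *\<^sub>R sign_vec (string_signs CARD('d) c))"
    using sum.reindex[OF inj_on_subset[OF string_signs_inj assms]] by (simp add: o_def)
  also have "\<dots> = (\<Sum>c\<in>C. f (string_signs CARD('d) c) *\<^sub>R vpt c)"
    by (rule sum.cong) (use sign_vec_string_signs assms in auto)
  finally show ?thesis .
qed

text \<open>The bridge from simplices to the global expansion: a nonnegative combination along a
  chain of strings is its own expansion, so \<open>coef\<close> returns the weights and no further
  pattern occurs.\<close>

lemma coef_sum_vpt:
  fixes C :: "'n::finite string set" and D :: "'d::{finite,linorder} itself"
  assumes n: "CARD('n) \<ge> 2" and C: "C \<subseteq> Pprime D" "is_chain C" and t: "\<forall>c\<in>C. 0 \<le> t c"
  defines "x \<equiv> (\<Sum>c\<in>C. t c *\<^sub>R vpt c) :: ('d,'n) mat"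
  shows "c \<in> Pprime D \<Longrightarrow> glob.coef x (string_signs CARD('d) c) = (if c \<in> C then t c else 0)"
    and "glob.coef x q \<noteq> 0 \<Longrightarrow> q \<in> string_signs CARD('d) ` C"
proof -
  let ?s = "string_signs CARD('d) :: 'n string \<Rightarrow> _"
  define f where "f q = t (the_inv_into (Pprime D) ?s q)" for q
  have f: "f (?s c) = t c" if "c \<in> Pprime D" for c
    unfolding f_def using the_inv_into_f_f[OF string_signs_inj that] by simp
  have "x = (\<Sum>c\<in>C. f (?s c) *\<^sub>R vpt c)"
    unfolding x_def using f C(1) by (intro sum.cong) auto
  also have "\<dots> = (\<Sum>q\<in>?s ` C. f q *\<^sub>R sign_vec q)" by (rule sum_sign_vec[OF C(1), symmetric])
  finally have x: "x = (\<Sum>q\<in>?s ` C. f q *\<^sub>R sign_vec q)" .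
  have coef: "glob.coef x q = (if q \<in> ?s ` C then f q else 0)" for q
    unfolding x
  proof (rule glob.coef_sum_v)
    show "?s ` C \<subseteq> range (signs :: ('d,'n) mat \<Rightarrow> _) - {signs (0 :: ('d,'n) mat)}"
      by (rule string_signs_image[OF n C(1)])
    show "glob.chain (?s ` C)" using chain_string_signs[OF C(1)] C(2) by blast
    show "0 \<le> f q" if "q \<in> ?s ` C" for q using that f t C(1) by auto
  qed
  show "q \<in> ?s ` C" if "glob.coef x q \<noteq> 0" using that coef by metis
  show "glob.coef x (?s c) = (if c \<in> C then t c else 0)" if c: "c \<in> Pprime D"
  proof -
    have "?s c \<in> ?s ` C \<longleftrightarrow> c \<in> C" using inj_on_image_mem_iff[OF string_signs_inj c C(1)] .
    then show ?thesis using coef f[OF c] by simp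
  qed
qed

lemma sum_vpt_unique:
  fixes C C' :: "'n::finite string set" and D :: "'d::{finite,linorder} itself"
  assumes n: "CARD('n) \<ge> 2" and C: "C \<subseteq> Pprime D" "is_chain C" "\<forall>c\<in>C. 0 \<le> t c"
    and C': "C' \<subseteq> Pprime D" "is_chain C'" "\<forall>c\<in>C'. 0 \<le> t' c"
    and e: "(\<Sum>c\<in>C. t c *\<^sub>R vpt c :: ('d,'n) mat) = (\<Sum>c\<in>C'. t' c *\<^sub>R vpt c)"
    and c: "c \<in> Pprime D"
  shows "(if c \<in> C then t c else 0) = (if c \<in> C' then t' c else 0)"
  using coef_sum_vpt(1)[OF n C c] coef_sum_vpt(1)[OF n C' c] e by simp

lemma hull_vpt:
  assumes "C \<subseteq> Pprime (D :: 'd::{finite,linorder} itself)"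
  shows "convex hull (vpt ` C) =
    {\<Sum>c\<in>C. u c *\<^sub>R (vpt c :: ('d,'n::finite) mat) | u. (\<forall>c\<in>C. 0 \<le> u c) \<and> sum u C = 1}"
  by (rule convex_hull_finite_image[OF finite_subset[OF assms finite_Pprime] inj_on_subset[OF vpt_inj assms]])

lemma hull_vptE:
  assumes "C \<subseteq> Pprime (D :: 'd::{finite,linorder} itself)" "(x :: ('d,'n::finite) mat) \<in> convex hull (vpt ` C)"
  obtains u where "x = (\<Sum>c\<in>C. u c *\<^sub>R vpt c)" "\<forall>c\<in>C. 0 \<le> u c" "sum u C = 1"
  using assms(2) unfolding hull_vpt[OF assms(1)] by blast

lemma chainsD:
  assumes "C \<in> chains (D :: 'd::{finite,linorder} itself)"
  shows "C \<subseteq> Pprime D" "is_chain C" "C \<noteq> ({} :: 'n::finite string set)" "finite C"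
  using assms finite_subset[OF _ finite_Pprime] unfolding chains_def by auto

text \<open>Two systems of barycentric weights for one point are both its coefficients, so they
  agree and vanish outside the common vertices.\<close>

lemma hull_vpt_Int:
  fixes D :: "'d::{finite,linorder} itself"
  assumes n: "CARD('n::finite) \<ge> 2" and C: "C \<in> chains D" and C': "C' \<in> chains D"
  shows "convex hull (vpt ` C) \<inter> convex hull (vpt ` C') = convex hull ((vpt :: 'n string \<Rightarrow> ('d,'n) mat) ` (C \<inter> C'))"
proof (intro equalityI subsetI)
  fix x :: "('d,'n) mat" assume x: "x \<in> convex hull (vpt ` C) \<inter> convex hull (vpt ` C')"
  obtain u where u: "x = (\<Sum>c\<in>C. u c *\<^sub>R vpt c)" "\<forall>c\<in>C. 0 \<le> u c" "sum u C = 1"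
    using hull_vptE[OF chainsD(1)[OF C], of x] x by blast
  obtain u' where u': "x = (\<Sum>c\<in>C'. u' c *\<^sub>R vpt c)" "\<forall>c\<in>C'. 0 \<le> u' c" "sum u' C' = 1"
    using hull_vptE[OF chainsD(1)[OF C'], of x] x by blast
  have z: "u c = 0" if "c \<in> C" "c \<notin> C'" for c
    using sum_vpt_unique[OF n chainsD(1,2)[OF C] u(2) chainsD(1,2)[OF C'] u'(2), of c] u(1) u'(1) that chainsD(1)[OF C]
    by auto
  have "x = (\<Sum>c\<in>C \<inter> C'. u c *\<^sub>R vpt c)" unfolding u(1)
    by (rule sum.mono_neutral_right) (use chainsD(4)[OF C] z in auto)
  moreover have "sum u (C \<inter> C') = 1" unfolding u(3)[symmetric]
    by (rule sum.mono_neutral_left) (use chainsD(4)[OF C] z in auto)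
  moreover have "C \<inter> C' \<subseteq> Pprime D" using chainsD(1)[OF C] by blast
  ultimately show "x \<in> convex hull (vpt ` (C \<inter> C'))" using u(2) by (subst hull_vpt) auto
next
  fix x :: "('d,'n) mat" assume "x \<in> convex hull (vpt ` (C \<inter> C'))"
  then show "x \<in> convex hull (vpt ` C) \<inter> convex hull (vpt ` C')"
    using hull_mono[of "vpt ` (C \<inter> C')" "vpt ` C" convex] hull_mono[of "vpt ` (C \<inter> C')" "vpt ` C'" convex] by blast
qed

text \<open>The points of a chain are even linearly independent modulo the diagonal.\<close>

lemma affine_independent_vpt:
  fixes D :: "'d::{finite,linorder} itself"
  assumes n: "CARD('n::finite) \<ge> 2" and C: "C \<in> chains D"
  shows "\<not> affine_dependent ((vpt :: 'n string \<Rightarrow> ('d,'n) mat) ` C)"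
proof
  let ?s = "string_signs CARD('d) :: 'n string \<Rightarrow> _"
  assume "affine_dependent ((vpt :: 'n string \<Rightarrow> ('d,'n) mat) ` C)"
  then obtain U c where U: "c \<in> C" "U (vpt c) \<noteq> (0::real)" "(\<Sum>x\<in>vpt ` C. U x *\<^sub>R x) = (0 :: ('d,'n) mat)"
    using chainsD(4)[OF C] by (auto simp: affine_dependent_explicit_finite)
  have "(\<Sum>q\<in>?s ` C. U (sign_vec q) *\<^sub>R (sign_vec q :: ('d,'n) mat))
      = (\<Sum>c\<in>C. U (sign_vec (?s c)) *\<^sub>R vpt c)"
    by (rule sum_sign_vec[OF chainsD(1)[OF C]])
  also have "\<dots> = (\<Sum>c\<in>C. U (vpt c) *\<^sub>R vpt c)"
    by (intro sum.cong refl) (simp add: sign_vec_string_signs[OF subsetD[OF chainsD(1)[OF C]]])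
  also have "\<dots> = 0"
    using U(3) sum.reindex[OF inj_on_subset[OF vpt_inj chainsD(1)[OF C]], of "\<lambda>x. U x *\<^sub>R x"] by (simp add: o_def)
  finally have "(\<Sum>q\<in>?s ` C. U (sign_vec q) *\<^sub>R (sign_vec q :: ('d,'n) mat)) \<in> stratum_span (signs (0 :: ('d,'n) mat))"
    using subspace_0[OF subspace_stratum_span] by metis
  moreover have "?s ` C \<subseteq> range (signs :: ('d,'n) mat \<Rightarrow> _) - {signs (0 :: ('d,'n) mat)}"
    by (rule string_signs_image[OF n chainsD(1)[OF C]])
  moreover have "glob.chain (?s ` C)" using chain_string_signs[OF chainsD(1)[OF C]] chainsD(2)[OF C] by blast
  ultimately have "U (sign_vec (?s c)) = 0"
    using glob.independent_mod_L[of "?s ` C" "\<lambda>q. U (sign_vec q)" "?s c"] U(1) by blast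
  then show False using U(1,2) sign_vec_string_signs[of c D] chainsD(1)[OF C] by auto
qed

lemma vpt_in_W_space: "(vpt c :: ('d::{finite,linorder},'n::finite) mat) \<in> W_space"
proof -
  have "(\<Sum>a\<in>UNIV. (vpt c :: ('d,'n) mat) $ a)
      = (\<Sum>b\<in>UNIV. vtilde c b) - real CARD('n) *\<^sub>R ((1 / real CARD('n)) *\<^sub>R (\<Sum>b\<in>UNIV. vtilde c b))"
    by (simp add: vpt_def sum_subtractf sum_constant_scaleR del: sum_constant)
  then show ?thesis by (simp add: W_space_def)
qed

lemma Delta_subset_W_space: "Delta D \<subseteq> (W_space :: ('d::{finite,linorder},'n::finite) mat set)"
proof -
  have "convex (W_space :: ('d,'n) mat set)"
    unfolding W_space_def by (auto simp: convex_def sum.distrib scaleR_sum_right[symmetric])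
  then show ?thesis
    unfolding Delta_def using vpt_in_W_space by (intro UN_least hull_minimal) auto
qed

text \<open>Convexity of strata keeps a straight-line homotopy inside the configuration space once
  both ends lie in the same stratum.\<close>

lemma signs_convex:
  fixes x y :: "('d::{finite,linorder},'n::finite) mat"
  assumes "signs x = signs y" "0 \<le> t" "t \<le> 1"
  shows "signs ((1 - t) *\<^sub>R x + t *\<^sub>R y) = signs x"
proof (intro ext)
  fix a b
  obtain m e where x: "signs x a b = (m, e)" by force
  then have y: "signs y a b = (m, e)" using assms(1) by simp
  have *: "(1 - t) * u + t * w \<noteq> 0 \<and> (e \<longleftrightarrow> 0 < (1 - t) * u + t * w)"
    if "u \<noteq> 0" "w \<noteq> 0" "e \<longleftrightarrow> 0 < u" "e \<longleftrightarrow> 0 < w" for u w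
  proof (cases e)
    case True
    then have "0 < (1 - t) * u + t * w"
      using that assms(2,3) by (cases "t = 0") (auto intro: add_nonneg_pos)
    then show ?thesis using True by simp
  next
    case False
    then have uw: "u < 0" "w < 0" using that by auto
    then have "(1 - t) * u + t * w < 0"
    proof (cases "t = 0")
      case False
      then have "t * w < 0" "(1 - t) * u \<le> 0"
        using uw assms(2,3) by (auto simp: mult_pos_neg mult_nonneg_nonpos)
      then show ?thesis by linarith
    qed simp
    then show ?thesis using False by simp
  qed
  have "signs ((1 - t) *\<^sub>R x + t *\<^sub>R y) a b = (m, e)"
    unfolding signs_def lead_iff cdiff_add cdiff_scaleR
    using signs_eqD[OF x] signs_eqD[OF y] *[of "cdiff x a b m" "cdiff y a b m"] by (cases "m \<le> CARD('d)") auto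
  then show "signs ((1 - t) *\<^sub>R x + t *\<^sub>R y) a b = signs x a b" using x by simp
qed

text \<open>The stratum of a point is the least pattern of its expansion, and on
  \<open>Delta\<close> all patterns of the expansion come from strings.\<close>

lemma Delta_subset_conf_space:
  fixes D :: "'d::{finite,linorder} itself"
  assumes n: "CARD('n::finite) \<ge> 2"
  shows "Delta D \<subseteq> (conf_space :: ('d,'n) mat set)"
proof
  fix x :: "('d,'n) mat" assume "x \<in> Delta D"
  then obtain C where C: "C \<in> chains D" "x \<in> convex hull (vpt ` C)" unfolding Delta_def by blast
  obtain u where u: "x = (\<Sum>c\<in>C. u c *\<^sub>R vpt c)" "\<forall>c\<in>C. 0 \<le> u c" "sum u C = 1"
    using hull_vptE[OF chainsD(1)[OF C(1)] C(2)] by blast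
  note coef = coef_sum_vpt[OF n chainsD(1,2)[OF C(1)] u(2), folded u(1)]
  have "\<exists>c\<in>C. u c \<noteq> 0" using u(3) by (metis sum.neutral zero_neq_one)
  then obtain c where c: "c \<in> C" "u c \<noteq> 0" by blast
  then have "glob.coef x (string_signs CARD('d) c) \<noteq> 0" using coef(1)[OF subsetD[OF chainsD(1)[OF C(1)] c(1)]] c by simp
  then have "glob.coef x (signs x) \<noteq> 0" using glob.rep_strat[OF glob.rep_coef[of x]] by blast
  then have "signs x \<in> string_signs CARD('d) ` Pprime D" using coef(2) chainsD(1)[OF C(1)] by blast
  then show "x \<in> conf_space" using conf_space_iff_string_signs by blast
qed

text \<open>The retraction discards the part of the barycentric expansion that is supported on strata
  with coinciding columns.\<close>

lemma equivariant_sdr_Delta: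
  fixes D :: "'d::{finite,linorder} itself"
  assumes n: "CARD('n::finite) \<ge> 2"
  shows "equivariant_sdr (Delta D) (conf_space :: ('d,'n) mat set)"
proof -
  let ?s = "string_signs CARD('d) :: 'n string \<Rightarrow> _"
  let ?P = "Pprime D :: 'n string set"
  let ?conf = "conf_space :: ('d,'n) mat set"
  \<comment> \<open>The weight carried by strings. It is positive on the configuration space, since
    the least pattern of the expansion is \<open>signs x\<close>, which comes from a string
    there.\<close>
  define g where "g x = (\<Sum>c\<in>?P. glob.coef x (?s c))" for x :: "('d,'n) mat"
  define r :: "('d,'n) mat \<Rightarrow> ('d,'n) mat" where "r x = (\<Sum>c\<in>?P. (glob.coef x (?s c) / g x) *\<^sub>R vpt c)" for x
  define H where "H = (\<lambda>(t, x). (1 - t) *\<^sub>R x + t *\<^sub>R r x)"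
  define S where "S x = {c\<in>?P. glob.coef x (?s c) \<noteq> 0}" for x :: "('d,'n) mat"
  have S: "S x \<subseteq> ?P" "is_chain (S x)" for x
  proof -
    show "S x \<subseteq> ?P" by (auto simp: S_def)
    have "glob.chain (?s ` S x)" using glob.coef_chain[of x] by (rule glob.chain_subset) (auto simp: S_def)
    then show "is_chain (S x)" using chain_string_signs[of "S x" D] by (auto simp: S_def)
  qed
  have conf_string: "\<exists>c. c \<in> ?P \<and> signs x = ?s c" if x: "x \<in> ?conf" for x
  proof -
    obtain c where "c \<in> ?P" "?s c = signs x" using string_signs_surj[OF x, of D] by (elim bexE)
    then show ?thesis by (intro exI[of _ c]) simp
  qed
  have least: "glob.coef x (signs x) \<noteq> 0" "glob.coef x q \<noteq> 0 \<Longrightarrow> sle (signs x) q" if x: "x \<in> ?conf" for x q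
  proof -
    have "signs x \<noteq> signs (0 :: ('d,'n) mat)"
      using conf_string[OF x] string_signs_nonzero[OF n, of _ D] by (elim exE conjE) simp
    then show "glob.coef x (signs x) \<noteq> 0" "glob.coef x q \<noteq> 0 \<Longrightarrow> sle (signs x) q"
      using glob.rep_strat[OF glob.rep_coef[of x]] by blast+
  qed
  have g_pos: "0 < g x" if x: "x \<in> ?conf" for x
  proof -
    obtain c where c: "c \<in> ?P" "signs x = ?s c" using conf_string[OF x] by (elim exE conjE)
    then have "0 < glob.coef x (?s c)" using least(1)[OF x] glob.coef_nonneg[of x "signs x"] by simp
    then show ?thesis unfolding g_def
      using finite_Pprime c(1) glob.coef_nonneg by (intro sum_pos2[of _ c]) auto
  qed
  have r_S: "r x = (\<Sum>c\<in>S x. (glob.coef x (?s c) / g x) *\<^sub>R vpt c)" for x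
    unfolding r_def by (rule sum.mono_neutral_right) (use finite_Pprime S_def in auto)
  have S_sum: "(\<Sum>c\<in>S x. glob.coef x (?s c) / g x) = 1" if x: "x \<in> ?conf" for x
  proof -
    have "(\<Sum>c\<in>S x. glob.coef x (?s c) / g x) = (\<Sum>c\<in>?P. glob.coef x (?s c) / g x)"
      by (rule sum.mono_neutral_left) (use finite_Pprime S_def in auto)
    also have "\<dots> = 1" using g_pos[OF x] by (simp add: sum_divide_distrib[symmetric] g_def)
    finally show ?thesis .
  qed
  have r_nonneg: "0 \<le> glob.coef x (?s c) / g x" if "x \<in> ?conf" for x c
    using g_pos[OF that] glob.coef_nonneg[of x] by simp
  have r_Delta: "r x \<in> Delta D" if x: "x \<in> ?conf" for x
  proof -
    have "r x \<in> convex hull (vpt ` S x)"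
      unfolding hull_vpt[OF S(1)] mem_Collect_eq using r_S[of x] S_sum[OF x] r_nonneg[OF x]
      by (intro exI[of _ "\<lambda>c. glob.coef x (?s c) / g x"]) simp
    moreover have "S x \<noteq> {}" using S_sum[OF x] by force
    then have "S x \<in> chains D" using S[of x] by (simp add: chains_def)
    ultimately show ?thesis unfolding Delta_def by blast
  qed
  \<comment> \<open>Each of \<open>signs x\<close> and \<open>signs (r x)\<close> occurs in the
    expansion of the other point, and each is least in its own, so they coincide.\<close>
  have signs_r: "signs (r x) = signs x" if x: "x \<in> ?conf" for x
  proof -
    have rx: "r x \<in> ?conf" using r_Delta[OF x] Delta_subset_conf_space[OF n] by blast
    have "\<forall>c\<in>S x. 0 \<le> glob.coef x (?s c) / g x" using r_nonneg[OF x] by blast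
    note coef = coef_sum_vpt[OF n S[of x] this, folded r_S]
    obtain c where c: "c \<in> ?P" "signs x = ?s c" using conf_string[OF x] by (elim exE conjE)
    then have cS: "c \<in> S x" using least(1)[OF x] by (simp add: S_def)
    then have "glob.coef (r x) (signs x) \<noteq> 0"
      using coef(1)[OF c(1)] c g_pos[OF x] least(1)[OF x] by simp
    then have "sle (signs (r x)) (signs x)" by (rule least(2)[OF rx])
    moreover have "glob.coef x (signs (r x)) \<noteq> 0"
      using coef(2)[OF least(1)[OF rx]] by (auto simp: S_def)
    then have "sle (signs x) (signs (r x))" by (rule least(2)[OF x])
    ultimately show ?thesis by (rule sle_antisym)
  qed
  \<comment> \<open>On \<open>Delta\<close> nothing is discarded: all weights sit on strings and
    already sum to 1.\<close>
  have r_fix: "r x = x" if x: "x \<in> Delta D" for x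
  proof -
    obtain C where C: "C \<in> chains D" "x \<in> convex hull (vpt ` C)" using x unfolding Delta_def by blast
    obtain u where u: "x = (\<Sum>c\<in>C. u c *\<^sub>R vpt c)" "\<forall>c\<in>C. 0 \<le> u c" "sum u C = 1"
      using hull_vptE[OF chainsD(1)[OF C(1)] C(2)] by blast
    note coef = coef_sum_vpt(1)[OF n chainsD(1,2)[OF C(1)] u(2), folded u(1)]
    have "g x = sum u C" unfolding g_def
      by (rule sum.mono_neutral_cong_right) (use finite_Pprime chainsD(1)[OF C(1)] coef in \<open>auto simp del: split_paired_All\<close>)
    then have g1: "g x = 1" using u(3) by simp
    show ?thesis unfolding r_def g1
      by (subst (2) u(1), rule sum.mono_neutral_cong_right)
        (use finite_Pprime chainsD(1)[OF C(1)] coef in auto)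
  qed
  have conf_perm: "perm_act \<pi> x \<in> ?conf" if "\<pi> permutes UNIV" "x \<in> ?conf" for \<pi> x
  proof -
    have "inv \<pi> j = inv \<pi> k \<longleftrightarrow> j = k" for j k using permutes_inverses(1)[OF that(1)] by metis
    then show ?thesis using that(2) by (simp add: conf_space_def perm_act_def)
  qed
  have r_perm: "r (perm_act \<pi> x) = perm_act \<pi> (r x)" if \<pi>: "\<pi> permutes UNIV" for \<pi> x
  proof -
    have coef: "glob.coef (perm_act \<pi> x) (?s (str_act \<pi> c)) = glob.coef x (?s c)" for c
      unfolding string_signs_str_act[OF \<pi>] by (rule coef_perm_act[OF \<pi>])
    note re = sum.reindex_bij_betw[OF bij_betw_str_act[OF \<pi>, of D], symmetric]
    have g: "g (perm_act \<pi> x) = g x" unfolding g_def by (subst re) (simp add: coef)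
    have "r (perm_act \<pi> x) = (\<Sum>c\<in>?P. (glob.coef x (?s c) / g x) *\<^sub>R vpt (str_act \<pi> c))"
      unfolding r_def g by (subst re) (simp add: coef)
    also have "\<dots> = perm_act \<pi> (r x)"
      unfolding r_def by (simp add: linear_sum[OF linear_perm_act] linear_scale[OF linear_perm_act] vpt_str_act[OF \<pi>])
    finally show ?thesis .
  qed
  have cont_coef: "continuous_on A (\<lambda>x. glob.coef x q)" for A :: "('d,'n) mat set" and q
    by (rule continuous_on_subset[OF glob.continuous_coef]) simp
  have cont_r: "continuous_on ?conf r"
    unfolding r_def g_def using g_pos unfolding g_def
    by (intro continuous_intros cont_coef) force
  have cont_H: "continuous_on ({0..1} \<times> ?conf) H"
    unfolding H_def case_prod_unfold
    by (intro continuous_intros continuous_on_compose2[OF cont_r]) auto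
  have H_conf: "H (t, x) \<in> ?conf" if "t \<in> {0..1}" "x \<in> ?conf" for t x
  proof -
    have "signs (H (t, x)) = signs x"
      unfolding H_def using signs_convex[OF signs_r[OF that(2), symmetric]] that(1) by simp
    then show ?thesis using that(2) unfolding conf_space_iff by simp
  qed
  \<comment> \<open>Points of \<open>Delta\<close> are fixed by \<open>r\<close>, which commutes
    with permutations and takes values in \<open>Delta\<close>; invariance of \<open>Delta\<close>
    follows.\<close>
  have r_in: "perm_act \<pi> x \<in> Delta D" if "\<pi> permutes UNIV" "x \<in> Delta D" for \<pi> :: "'n \<Rightarrow> 'n" and x :: "('d,'n) mat"
  proof -
    have "perm_act \<pi> x = r (perm_act \<pi> x)" using r_perm[OF that(1)] r_fix[OF that(2)] by simp
    then show ?thesis using r_Delta conf_perm[OF that(1)] that(2) Delta_subset_conf_space[OF n] by (metis subsetD)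
  qed
  show ?thesis unfolding equivariant_sdr_def
  proof (intro conjI exI[of _ H] allI impI ballI)
    show "Delta D \<subseteq> ?conf" by (rule Delta_subset_conf_space[OF n])
    show "perm_act \<pi> ` Delta D \<subseteq> (Delta D :: ('d,'n) mat set)" if "\<pi> permutes UNIV" for \<pi> :: "'n \<Rightarrow> 'n"
      using r_in[OF that] by blast
    show "continuous_on ({0..1} \<times> ?conf) H" by (rule cont_H)
    show "H ` ({0..1} \<times> ?conf) \<subseteq> ?conf" using H_conf by auto
    show "H (0, x) = x" "H (1, x) \<in> Delta D" if "x \<in> ?conf" for x
      using r_Delta[OF that] by (simp_all add: H_def)
    show "H (t, a) = a" if "a \<in> Delta D" for t a
      using r_fix[OF that] by (simp add: H_def algebra_simps)
    show "H (t, perm_act \<pi> x) = perm_act \<pi> (H (t, x))" if "\<pi> permutes UNIV \<and> t \<in> {0..1} \<and> x \<in> ?conf" for \<pi> t x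
      using r_perm[of \<pi> x] that
      by (simp add: H_def linear_add[OF linear_perm_act] linear_scale[OF linear_perm_act])
  qed
qed

section \<open>The cells\<close>

text \<open>Inner product with this vector gives coordinate \<open>k\<close> of the difference of
  the columns at positions \<open>j\<close> and \<open>Suc j\<close>. For \<open>k\<close> below the
  index of that step it vanishes on the stratum, and there are \<open>cdim\<close> such pairs
  \<open>(j, k)\<close>.\<close>

definition normal_gen :: "'n string \<Rightarrow> nat \<times> nat \<Rightarrow> ('d::{finite,linorder},'n::finite) mat" where
  "normal_gen c = (\<lambda>(j, k). axis (fst c ! Suc j) (axis (coord k) 1) - axis (fst c ! j) (axis (coord k) 1))"

definition normal_index :: "'n::finite string \<Rightarrow> (nat \<times> nat) set" where
  "normal_index c = (SIGMA j:{..<CARD('n) - 1}. {1..<snd c ! j})"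

definition stratum_normal :: "'n string \<Rightarrow> ('d::{finite,linorder},'n::finite) mat set" where
  "stratum_normal c = span (normal_gen c ` normal_index c)"

lemma inner_normal_gen:
  "(normal_gen c (j, k) :: ('d::{finite,linorder},'n::finite) mat) \<bullet> x = cdiff x (fst c ! j) (fst c ! Suc j) k"
  by (simp add: normal_gen_def cdiff_def inner_diff_left inner_axis')

lemma mval_nth:
  fixes \<sigma> :: "'n::finite list"
  assumes P: "(\<sigma>, i) \<in> Pprime (D :: 'd::{finite,linorder} itself)" and pq: "p < q" "q < CARD('n)"
  shows "mval (\<sigma>, i) (\<sigma> ! p) (\<sigma> ! q) = Min ((!) i ` {p..<q})"
  using P pq pos_nth[of \<sigma> p] pos_nth[of \<sigma> q] by (simp add: mval_def Pprime_iff)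

text \<open>Adjacent letters suffice: every index between two letters is at least their
  \<open>mval\<close>, so the equations for distant letters follow by telescoping.\<close>

lemma stratum_span_string_signs:
  fixes x :: "('d::{finite,linorder},'n::finite) mat"
  assumes P: "c \<in> Pprime (D :: 'd itself)"
  shows "x \<in> stratum_span (string_signs d c) \<longleftrightarrow>
    (\<forall>(j, k)\<in>normal_index c. cdiff x (fst c ! j) (fst c ! Suc j) k = 0)"
proof -
  obtain \<sigma> i where c: "c = (\<sigma>, i)" by force
  have P: "(\<sigma>, i) \<in> Pprime D" using P c by simp
  show ?thesis
  proof
    assume x: "x \<in> stratum_span (string_signs d c)"
    have "cdiff x (\<sigma> ! j) (\<sigma> ! Suc j) k = 0" if jk: "j < CARD('n) - 1" "1 \<le> k" "k < i ! j" for j k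
    proof -
      have j: "Suc j < CARD('n)" using jk by simp
      then have "\<sigma> ! j \<noteq> \<sigma> ! Suc j" using P by (simp add: Pprime_iff nth_eq_iff_index_eq)
      then have "fst (string_signs d c (\<sigma> ! j) (\<sigma> ! Suc j)) = i ! j"
        using mval_nth[OF P _ j, of j] by (simp add: string_signs_def c)
      then show ?thesis using x jk unfolding stratum_span_def by auto
    qed
    then show "\<forall>(j, k)\<in>normal_index c. cdiff x (fst c ! j) (fst c ! Suc j) k = 0"
      by (auto simp: normal_index_def c)
  next
    assume a: "\<forall>(j, k)\<in>normal_index c. cdiff x (fst c ! j) (fst c ! Suc j) k = 0"
    have step: "cdiff x (\<sigma> ! j) (\<sigma> ! Suc j) k = 0" if "j < CARD('n) - 1" "1 \<le> k" "k < i ! j" for j k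
      using bspec[OF a, of "(j, k)"] that by (simp add: normal_index_def c)
    have pq0: "cdiff x (\<sigma> ! p) (\<sigma> ! q) k = 0"
      if pq: "p < q" "q < CARD('n)" and k: "1 \<le> k" "k < mval c (\<sigma> ! p) (\<sigma> ! q)" for p q k
    proof -
      have "cdiff x (\<sigma> ! p) (\<sigma> ! q) k = (\<Sum>j\<in>{p..<q}. cdiff x (\<sigma> ! j) (\<sigma> ! Suc j) k)"
        unfolding cdiff_def using sum_Suc_diff'[of p q "\<lambda>j. x $ (\<sigma> ! j) $ coord k"] pq by simp
      also have "\<dots> = 0"
      proof (rule sum.neutral, rule ballI)
        fix j assume j: "j \<in> {p..<q}"
        then have "Min ((!) i ` {p..<q}) \<le> i ! j" by (intro Min_le) auto
        then have "k < i ! j" using k(2) mval_nth[OF P pq] by (simp add: c)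
        then show "cdiff x (\<sigma> ! j) (\<sigma> ! Suc j) k = 0" using j pq k(1) by (intro step) auto
      qed
      finally show ?thesis .
    qed
    have "cdiff x a b k = 0" if k: "1 \<le> k" "k < fst (string_signs d c a b)" for a b k
    proof (cases "a = b")
      case True
      then show ?thesis by (simp add: cdiff_self)
    next
      case False
      have m: "k < mval c a b" using k(2) False by (simp add: string_signs_def)
      have ab: "pos \<sigma> a < CARD('n)" "\<sigma> ! pos \<sigma> a = a" "pos \<sigma> b < CARD('n)" "\<sigma> ! pos \<sigma> b = b"
        using nth_pos[OF P] by auto
      consider "pos \<sigma> a < pos \<sigma> b" | "pos \<sigma> b < pos \<sigma> a" using ab False by (metis linorder_neqE_nat)
      then show ?thesis
      proof cases
        case 1
        then show ?thesis using pq0[of "pos \<sigma> a" "pos \<sigma> b" k] ab k(1) m by simp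
      next
        case 2
        then have "cdiff x b a k = 0" using pq0[of "pos \<sigma> b" "pos \<sigma> a" k] ab k(1) m by (simp add: mval_commute)
        then show ?thesis by (simp add: cdiff_swap[of x a b])
      qed
    qed
    then show "x \<in> stratum_span (string_signs d c)" by (simp add: stratum_span_def)
  qed
qed

lemma stratum_span_eq_orthogonal:
  assumes "c \<in> Pprime (D :: 'd::{finite,linorder} itself)"
  shows "(stratum_span (string_signs d c) :: ('d,'n::finite) mat set) = {x. \<forall>y\<in>stratum_normal c. y \<bullet> x = 0}"
proof (intro equalityI subsetI)
  fix x :: "('d,'n) mat" assume x: "x \<in> stratum_span (string_signs d c)"
  have base: "orthogonal x y" if "y \<in> normal_gen c ` normal_index c" for y
  proof -
    obtain j k where jk: "(j, k) \<in> normal_index c" "y = normal_gen c (j, k)" using \<open>y \<in> _\<close> by auto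
    then have "y \<bullet> x = 0" using x unfolding stratum_span_string_signs[OF assms] by (auto simp: inner_normal_gen)
    then show ?thesis by (simp add: orthogonal_def inner_commute)
  qed
  have "orthogonal x y" if y: "y \<in> stratum_normal c" for y
    by (rule orthogonal_to_span[OF y[unfolded stratum_normal_def]]) (rule base)
  then show "x \<in> {x. \<forall>y\<in>stratum_normal c. y \<bullet> x = 0}" by (simp add: orthogonal_def inner_commute)
next
  fix x :: "('d,'n) mat" assume x: "x \<in> {x. \<forall>y\<in>stratum_normal c. y \<bullet> x = 0}"
  have "cdiff x (fst c ! j) (fst c ! Suc j) k = 0" if "(j, k) \<in> normal_index c" for j k
  proof -
    have "normal_gen c (j, k) \<in> (stratum_normal c :: ('d,'n) mat set)"
      unfolding stratum_normal_def by (intro span_base imageI that)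
    then show ?thesis using x by (simp add: inner_normal_gen[symmetric])
  qed
  then show "x \<in> stratum_span (string_signs d c)" unfolding stratum_span_string_signs[OF assms] by auto
qed

lemma dim_span_biorthogonal:
  fixes u y :: "'i \<Rightarrow> 'a::euclidean_space"
  assumes I: "finite I" and b: "\<And>i j. i \<in> I \<Longrightarrow> j \<in> I \<Longrightarrow> u i \<bullet> y j = (if i = j then 1 else 0)"
  shows "dim (span (u ` I)) = card I"
proof -
  have inj: "inj_on u I" by (rule inj_onI) (metis b zero_neq_one)
  have "independent (u ` I)"
  proof
    assume "dependent (u ` I)"
    then obtain U j where U: "j \<in> I" "U (u j) \<noteq> 0" "(\<Sum>v\<in>u ` I. U v *\<^sub>R v) = 0"
      using I by (auto simp: dependent_finite)
    then have "0 = (\<Sum>i\<in>I. U (u i) *\<^sub>R u i) \<bullet> y j" by (simp add: sum.reindex[OF inj] o_def)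
    also have "\<dots> = (\<Sum>i\<in>I. U (u i) * (if i = j then 1 else 0))"
      using b U(1) by (simp add: inner_sum_left)
    also have "\<dots> = (\<Sum>i\<in>I. if i = j then U (u j) else 0)" by (rule sum.cong) auto
    also have "\<dots> = U (u j)" using I U(1) by simp
    finally show False using U(2) by simp
  qed
  then show ?thesis by (simp add: dim_eq_card_independent card_image[OF inj])
qed

lemma dim_stratum_normal:
  assumes P: "c \<in> Pprime (D :: 'd::{finite,linorder} itself)"
  shows "dim (stratum_normal c :: ('d,'n::finite) mat set) = cdim c"
proof -
  obtain \<sigma> i where c: "c = (\<sigma>, i)" by force
  have P: "(\<sigma>, i) \<in> Pprime D" using P c by simp
  \<comment> \<open>The unit vector of coordinate \<open>k\<close> in every column placed after
    position \<open>j\<close>. Consecutive columns then differ only at step \<open>j\<close>, so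
    this family is dual to \<open>normal_gen\<close>.\<close>
  define y :: "nat \<times> nat \<Rightarrow> ('d,'n) mat" where
    "y = (\<lambda>(j, k). \<chi> a. if j < pos \<sigma> a then axis (coord k) 1 else 0)"
  have bound: "j < CARD('n) - 1" "k \<in> {1..CARD('d)}" if "(j, k) \<in> normal_index c" for j k
  proof -
    show j: "j < CARD('n) - 1" using that by (simp add: normal_index_def)
    show "k \<in> {1..CARD('d)}" using Pprime_nth[OF P j] that by (auto simp: normal_index_def c)
  qed
  have bi: "(normal_gen c p :: ('d,'n) mat) \<bullet> y q = (if p = q then 1 else 0)"
    if pq: "p \<in> normal_index c" "q \<in> normal_index c" for p q
  proof -
    obtain j k j' k' where e: "p = (j, k)" "q = (j', k')" by (metis prod.collapse)
    have b: "j < CARD('n) - 1" "k \<in> {1..CARD('d)}" "j' < CARD('n) - 1" "k' \<in> {1..CARD('d)}"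
      using bound pq e by auto
    have pos: "pos \<sigma> (\<sigma> ! j) = j" "pos \<sigma> (\<sigma> ! Suc j) = Suc j"
      using P pos_nth[of \<sigma> j] pos_nth[of \<sigma> "Suc j"] b by (auto simp: Pprime_iff)
    have ax: "(axis (coord k') 1 :: (real,'d) vec) $ coord k = (if k = k' then 1 else 0)"
      using unitv_coord[OF b(4,2)] unfolding unitv_def .
    have "(normal_gen c p :: ('d,'n) mat) \<bullet> y q
        = (if j' < Suc j then if k = k' then 1 else 0 else 0) - (if j' < j then if k = k' then 1 else 0 else 0)"
      unfolding e inner_normal_gen by (simp add: cdiff_def y_def c pos ax if_distrib[of "\<lambda>v. v $ _"])
    then show ?thesis using e by auto
  qed
  have "dim (stratum_normal c :: ('d,'n) mat set) = card (normal_index c)"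
    unfolding stratum_normal_def by (rule dim_span_biorthogonal[OF _ bi]) (simp_all add: normal_index_def)
  also have "\<dots> = (\<Sum>j<CARD('n) - 1. i ! j - 1)"
    unfolding normal_index_def c by (subst card_SigmaI) auto
  also have "\<dots> = (\<Sum>j<CARD('n) - 1. i ! j) - (\<Sum>j<CARD('n) - 1. 1)"
    using Pprime_nth[OF P] by (intro sum_subtractf_nat) auto
  also have "\<dots> = cdim c"
    using P by (simp add: cdim_def c sum_list_sum_nth Pprime_iff atLeast0LessThan)
  finally show ?thesis .
qed

text \<open>Here \<open>cdim\<close> is the codimension of the span of the stratum. Going up shrinks
  this span, and properly: \<open>vpt c\<close> lies in the span belonging to \<open>c\<close> but
  not in the one belonging to \<open>c'\<close>.\<close>

lemma cdim_strict_mono: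
  assumes P: "c \<in> Pprime (D :: 'd::{finite,linorder} itself)" "c' \<in> Pprime D" and p: "prec c c'" "c \<noteq> c'"
  shows "cdim (c :: 'n::finite string) < cdim c'"
proof -
  let ?L = "\<lambda>c. stratum_span (string_signs CARD('d) c) :: ('d,'n) mat set"
  have s: "sle (string_signs CARD('d) c) (string_signs CARD('d) c')" using p(1) prec_iff_sle[OF P] by blast
  then have le: "fst (string_signs CARD('d) c a b) \<le> fst (string_signs CARD('d) c' a b)" for a b
    unfolding sle_def by (metis less_imp_le order_refl)
  have sub: "?L c' \<subseteq> ?L c"
    unfolding stratum_span_def using less_le_trans[OF _ le] by blast
  have "(vpt c :: ('d,'n) mat) \<in> ?L c"
    using stratum_span_iff[of "vpt c :: ('d,'n) mat" "vpt c :: ('d,'n) mat"]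
    unfolding signs_vpt[OF P(1)] by (simp add: local_signs_def signs_vpt[OF P(1)] fun_eq_iff)
  moreover have "(vpt c :: ('d,'n) mat) \<notin> ?L c'"
  proof
    assume "(vpt c :: ('d,'n) mat) \<in> ?L c'"
    then have "local_signs (string_signs CARD('d) c') (vpt c :: ('d,'n) mat) = string_signs CARD('d) c'"
      using stratum_span_iff[of "vpt c :: ('d,'n) mat" "vpt c' :: ('d,'n) mat"] unfolding signs_vpt[OF P(2)] by blast
    moreover have "local_signs (string_signs CARD('d) c') (vpt c :: ('d,'n) mat) = string_signs CARD('d) c"
    proof (intro ext)
      fix a b
      show "local_signs (string_signs CARD('d) c') (vpt c :: ('d,'n) mat) a b = string_signs CARD('d) c a b"
        using s[unfolded sle_def, rule_format, of a b] by (auto simp: local_signs_def signs_vpt[OF P(1)])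
    qed
    ultimately have "string_signs CARD('d) c = string_signs CARD('d) c'" by simp
    then show False using p(2) inj_onD[OF string_signs_inj _ P] by blast
  qed
  ultimately have "?L c' \<subset> ?L c" using sub by blast
  then have "span (?L c') \<subset> span (?L c)"
    by (simp only: span_eq_iff[THEN iffD2, OF subspace_stratum_span])
  then have "dim (?L c') < dim (?L c)" by (rule dim_psubset)
  moreover have "dim (?L e) + cdim e = DIM(('d,'n) mat)" if e: "e \<in> Pprime D" for e
  proof -
    have "?L e = {y \<in> UNIV. \<forall>x\<in>stratum_normal e. orthogonal x y}"
      unfolding stratum_span_eq_orthogonal[OF e] by (simp add: orthogonal_def)
    moreover have "subspace (stratum_normal e :: ('d,'n) mat set)" unfolding stratum_normal_def by (rule subspace_span)
    ultimately show ?thesis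
      using dim_subspace_orthogonal_to_vectors[of "stratum_normal e :: ('d,'n) mat set" UNIV] dim_stratum_normal[OF e]
      by simp
  qed
  from this[OF P(1)] this[OF P(2)] have "dim (?L c) + cdim c = dim (?L c') + cdim c'" by simp
  ultimately show ?thesis by linarith
qed


text \<open>The local stratification at \<open>s\<close>, transported through
  \<open>string_signs\<close>. Its apex is \<open>s\<close> itself, so the weight of
  \<open>s\<close> in the image of \<open>y\<close> is \<open>1 - norm y\<close>.\<close>

lemma cell_ball:
  fixes D :: "'d::{finite,linorder} itself"
  assumes s: "s \<in> (Pprime D :: 'n::finite string set)"
  shows "\<exists>h. (\<exists>g. homeomorphism (cball 0 1 \<inter> (stratum_normal s :: ('d,'n) mat set)) (cell D s :: ('d,'n) mat set) h g) \<and>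
    (\<forall>y\<in>cball 0 1 \<inter> (stratum_normal s :: ('d,'n) mat set). \<exists>w C. h y = (\<Sum>c\<in>C. w c *\<^sub>R vpt c) \<and> (\<forall>c. 0 \<le> w c) \<and> sum w C = 1
      \<and> C = {c \<in> Pprime D. w c \<noteq> 0} \<and> is_chain C \<and> (\<forall>c\<in>C. prec c s) \<and> w s = 1 - norm y)"
proof -
  let ?s = "string_signs CARD('d) :: 'n string \<Rightarrow> _"
  let ?P = "{c \<in> Pprime D. prec c s}"
  let ?Q = "{q \<in> range (signs :: ('d,'n) mat \<Rightarrow> _). sle q (?s s)}"
  have QP: "?Q = ?s ` ?P"
  proof (intro equalityI subsetI)
    fix q assume q: "q \<in> ?Q"
    then have "q \<in> ?s ` Pprime D" by (intro sle_string_signs_in[of q "?s s" D]) (use s in auto)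
    then obtain c where c: "c \<in> Pprime D" "q = ?s c" by (elim imageE)
    then have "prec c s" using q prec_iff_sle[OF c(1) s, of "CARD('d)"] by simp
    then show "q \<in> ?s ` ?P" using c by simp
  next
    fix q assume "q \<in> ?s ` ?P"
    then obtain c where c: "c \<in> Pprime D" "prec c s" "q = ?s c" by auto
    then show "q \<in> ?Q" using string_signs_in_range[OF c(1)] prec_iff_sle[OF c(1) s, of "CARD('d)"] by simp
  qed
  interpret loc: cone_stratification ?Q sle "?s s" "local_signs (?s s) :: ('d,'n) mat \<Rightarrow> _" sign_vec
      "stratum_span (?s s) :: ('d,'n) mat set"
    by (rule cone_stratification_signs[OF signs_sign_vec string_signs_in_range[OF s]])
  have "subspace (stratum_normal s :: ('d,'n) mat set)" unfolding stratum_normal_def by (rule subspace_span)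
  from loc.homeomorphism_ball_chain_complex[OF this stratum_span_eq_orthogonal[OF s]]
  obtain h g where hg: "homeomorphism (cball 0 1 \<inter> (stratum_normal s :: ('d,'n) mat set))
      (\<Union>C\<in>{C. C \<subseteq> ?Q \<and> C \<noteq> {} \<and> loc.chain C}. convex hull (sign_vec ` C :: ('d,'n) mat set)) h g"
    and w: "\<forall>y\<in>cball 0 1 \<inter> (stratum_normal s :: ('d,'n) mat set). \<exists>w. h y = (\<Sum>q\<in>?Q. w q *\<^sub>R sign_vec q) \<and> (\<forall>q. 0 \<le> w q) \<and> sum w ?Q = 1
          \<and> {q. w q \<noteq> 0} \<subseteq> ?Q \<and> loc.chain {q. w q \<noteq> 0} \<and> w (?s s) = 1 - norm y"
    by (elim exE conjE) (rule that, assumption+)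
  have im: "sign_vec ` ?s ` C = (vpt ` C :: ('d,'n) mat set)" if "C \<subseteq> Pprime D" for C
    unfolding image_image
    by (rule image_cong[OF refl]) (rule sign_vec_string_signs[OF subsetD[OF that]])
  have "(\<Union>C\<in>{C. C \<subseteq> ?Q \<and> C \<noteq> {} \<and> loc.chain C}. convex hull (sign_vec ` C :: ('d,'n) mat set)) = cell D s"
  proof (intro equalityI subsetI)
    fix x :: "('d,'n) mat"
    assume "x \<in> (\<Union>C\<in>{C. C \<subseteq> ?Q \<and> C \<noteq> {} \<and> loc.chain C}. convex hull (sign_vec ` C :: ('d,'n) mat set))"
    then obtain E where E: "E \<subseteq> ?s ` ?P" "E \<noteq> {}" "loc.chain E" "x \<in> convex hull (sign_vec ` E)"
      unfolding QP by (elim UN_E CollectE conjE) (rule that, assumption+)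
    from E(1) obtain C where C: "C \<subseteq> ?P" "E = ?s ` C" by (rule subset_imageE)
    have CP: "C \<subseteq> Pprime D" using C(1) by blast
    have "is_chain C" using E(3) chain_string_signs[OF CP] unfolding C(2) by blast
    then have "C \<in> {C \<in> chains D. \<forall>c\<in>C. prec c s}" using CP C E(2) unfolding chains_def by blast
    then show "x \<in> cell D s" unfolding cell_def using E(4) im[OF CP] C(2) by auto
  next
    fix x :: "('d,'n) mat" assume "x \<in> cell D s"
    then obtain C where C: "C \<in> chains D" "\<forall>c\<in>C. prec c s" "x \<in> convex hull (vpt ` C)"
      unfolding cell_def by blast
    have "?s ` C \<subseteq> ?Q" unfolding QP using C(2) chainsD(1)[OF C(1)] by blast
    moreover have "?s ` C \<noteq> {}" using chainsD(3)[OF C(1)] by blast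
    moreover have "loc.chain (?s ` C)" using chain_string_signs[OF chainsD(1)[OF C(1)]] chainsD(2)[OF C(1)] by blast
    moreover have "x \<in> convex hull (sign_vec ` ?s ` C)" using C(3) im[OF chainsD(1)[OF C(1)]] by simp
    ultimately show "x \<in> (\<Union>C\<in>{C. C \<subseteq> ?Q \<and> C \<noteq> {} \<and> loc.chain C}. convex hull (sign_vec ` C :: ('d,'n) mat set))"
      by (intro UN_I[of "?s ` C"]) simp_all
  qed
  with hg have "homeomorphism (cball 0 1 \<inter> (stratum_normal s :: ('d,'n) mat set)) (cell D s :: ('d,'n) mat set) h g" by simp
  moreover have "\<exists>w C. h y = (\<Sum>c\<in>C. w c *\<^sub>R vpt c) \<and> (\<forall>c. 0 \<le> w c) \<and> sum w C = 1
      \<and> C = {c \<in> Pprime D. w c \<noteq> 0} \<and> is_chain C \<and> (\<forall>c\<in>C. prec c s) \<and> w s = 1 - norm y"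
    if y: "y \<in> cball 0 1 \<inter> (stratum_normal s :: ('d,'n) mat set)" for y
  proof -
    obtain w where w: "h y = (\<Sum>q\<in>?Q. w q *\<^sub>R sign_vec q)" "\<forall>q. 0 \<le> w q" "sum w ?Q = 1"
        "{q. w q \<noteq> 0} \<subseteq> ?Q" "loc.chain {q. w q \<noteq> 0}" "w (?s s) = 1 - norm y"
      using bspec[OF w y] by (elim exE conjE) (rule that, assumption+)
    define C where "C = {c \<in> Pprime D. w (?s c) \<noteq> 0}"
    have CP: "C \<subseteq> Pprime D" by (auto simp: C_def)
    have fin: "finite ?P" using finite_Pprime by (rule rev_finite_subset) auto
    have Cs: "prec c s" if "c \<in> C" for c
    proof -
      have c: "c \<in> Pprime D" "?s c \<in> ?Q" using that w(4) by (auto simp: C_def)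
      then show ?thesis using prec_iff_sle[OF c(1) s, of "CARD('d)"] by simp
    qed
    have "h y = (\<Sum>c\<in>?P. w (?s c) *\<^sub>R vpt c)" unfolding w(1) QP by (rule sum_sign_vec) auto
    also have "\<dots> = (\<Sum>c\<in>C. w (?s c) *\<^sub>R vpt c)"
      by (rule sum.mono_neutral_right[OF fin]) (use Cs in \<open>auto simp: C_def\<close>)
    finally have 1: "h y = (\<Sum>c\<in>C. w (?s c) *\<^sub>R vpt c)" .
    have "inj_on ?s ?P" by (rule inj_on_subset[OF string_signs_inj[of _ D]]) auto
    from sum.reindex[OF this, of w] have "1 = (\<Sum>c\<in>?P. w (?s c))"
      using w(3) unfolding QP by (simp add: o_def)
    also have "\<dots> = (\<Sum>c\<in>C. w (?s c))"
      by (rule sum.mono_neutral_right[OF fin]) (use Cs in \<open>auto simp: C_def\<close>)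
    finally have 2: "(\<Sum>c\<in>C. w (?s c)) = 1" by simp
    have "loc.chain (?s ` C)" using w(5) by (rule loc.chain_subset) (auto simp: C_def)
    then have 3: "is_chain C" using chain_string_signs[OF CP] by blast
    show ?thesis
      by (rule exI[of _ "w \<circ> ?s"], rule exI[of _ C]) (use 1 2 3 w(2,6) Cs in \<open>auto simp: C_def o_def\<close>)
  qed
  ultimately show ?thesis by blast
qed

text \<open>The comparison goes through \<open>sle\<close> because \<open>finite_chain_least\<close>
  asks for transitivity on the whole type, which \<open>sle\<close> has without restriction to
  \<open>P'(d,n)\<close>.\<close>

lemma chain_greatest:
  fixes C :: "'n::finite string set"
  assumes C: "C \<subseteq> Pprime (D :: 'd::{finite,linorder} itself)" "is_chain C" "C \<noteq> {}"
  obtains m where "m \<in> C" "\<And>c. c \<in> C \<Longrightarrow> prec c m"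
proof (rule finite_chain_least[of C "\<lambda>x y. sle (string_signs 0 y) (string_signs 0 x)"])
  have eq: "prec x y \<longleftrightarrow> sle (string_signs 0 x) (string_signs 0 y)" if "x \<in> C" "y \<in> C" for x y
    by (rule prec_iff_sle[OF subsetD[OF C(1) that(1)] subsetD[OF C(1) that(2)]])
  show "finite C" using C(1) finite_Pprime by (rule finite_subset)
  show "C \<noteq> {}" by (rule C(3))
  show "sle (string_signs 0 y) (string_signs 0 x) \<or> sle (string_signs 0 x) (string_signs 0 y)" if "x \<in> C" "y \<in> C" for x y
    using C(2) that eq unfolding is_chain_def by blast
  show "sle (string_signs 0 z) (string_signs 0 x)"
    if "sle (string_signs 0 y) (string_signs 0 x)" "sle (string_signs 0 z) (string_signs 0 y)" for x y z
    using sle_trans[OF that(2,1)] .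
  show thesis if m: "m \<in> C" "\<And>x. x \<in> C \<Longrightarrow> sle (string_signs 0 x) (string_signs 0 m)" for m
    using that(1) eq[OF _ m(1)] m by (intro \<open>\<And>m. m \<in> C \<Longrightarrow> (\<And>c. c \<in> C \<Longrightarrow> prec c m) \<Longrightarrow> thesis\<close>[of m]) simp_all
qed

lemma prec_trans:
  assumes "c \<in> Pprime (D :: 'd::{finite,linorder} itself)" "c' \<in> Pprime D" "c'' \<in> Pprime D" "prec c c'" "prec c' c''"
  shows "prec c (c'' :: 'n::finite string)"
  using assms(4,5) sle_trans
  unfolding prec_iff_sle[OF assms(1,2), of 0] prec_iff_sle[OF assms(2,3), of 0] prec_iff_sle[OF assms(1,3), of 0]
  by blast

section \<open>Inclusion of cells and the cell structure\<close>

lemma vpt_in_cell: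
  assumes "c \<in> (Pprime D :: 'n::finite string set)"
  shows "(vpt c :: ('d::{finite,linorder},'n) mat) \<in> cell D c"
proof -
  have "{c} \<in> {C \<in> chains D. \<forall>e\<in>C. prec e c}"
    using assms prec_refl[OF assms] by (simp add: chains_def is_chain_def)
  then show ?thesis unfolding cell_def by (rule UN_I) simp
qed

text \<open>By uniqueness of weights, a simplex contains \<open>vpt c\<close> only if
  \<open>c\<close> is one of its vertices. The converse is transitivity of
  \<open>prec\<close>.\<close>

lemma cell_subset_iff:
  fixes D :: "'d::{finite,linorder} itself"
  assumes n: "CARD('n::finite) \<ge> 2" and P: "c \<in> Pprime D" "c' \<in> Pprime D"
  shows "cell D c \<subseteq> (cell D c' :: ('d,'n) mat set) \<longleftrightarrow> prec c c'"
proof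
  assume "cell D c \<subseteq> (cell D c' :: ('d,'n) mat set)"
  then have "(vpt c :: ('d,'n) mat) \<in> cell D c'" using vpt_in_cell[OF P(1)] by blast
  then obtain C where C: "C \<in> chains D" "\<forall>e\<in>C. prec e c'" "(vpt c :: ('d,'n) mat) \<in> convex hull (vpt ` C)"
    unfolding cell_def by blast
  obtain u where u: "(vpt c :: ('d,'n) mat) = (\<Sum>c\<in>C. u c *\<^sub>R vpt c)" "\<forall>c\<in>C. 0 \<le> u c" "sum u C = 1"
    using hull_vptE[OF chainsD(1)[OF C(1)] C(3)] by blast
  have "{c} \<subseteq> Pprime D" "is_chain {c}" using P(1) prec_refl[OF P(1)] by (simp_all add: is_chain_def)
  then have "(if c \<in> {c} then 1 else 0) = (if c \<in> C then u c else 0)"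
    by (rule sum_vpt_unique[OF n _ _ _ chainsD(1,2)[OF C(1)] u(2) _ P(1), where t = "\<lambda>_. 1"]) (use u(1) in auto)
  then have "c \<in> C" by (simp split: if_splits)
  then show "prec c c'" using C(2) by blast
next
  assume p: "prec c c'"
  show "cell D c \<subseteq> (cell D c' :: ('d,'n) mat set)"
  proof
    fix x :: "('d,'n) mat" assume "x \<in> cell D c"
    then obtain C where C: "C \<in> chains D" "\<forall>e\<in>C. prec e c" "x \<in> convex hull (vpt ` C)"
      unfolding cell_def by blast
    have "\<forall>e\<in>C. prec e c'" using prec_trans[OF _ P _ p] C(2) chainsD(1)[OF C(1)] by blast
    then show "x \<in> cell D c'" unfolding cell_def using C by blast
  qed
qed

text \<open>The greatest member of a chain names a cell containing its simplex.\<close>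

lemma Delta_eq_cells:
  "Delta D = (\<Union>c\<in>Pprime D. cell D c :: ('d::{finite,linorder},'n::finite) mat set)"
proof (intro equalityI subsetI)
  fix x :: "('d,'n) mat" assume "x \<in> Delta D"
  then obtain C where C: "C \<in> chains D" "x \<in> convex hull (vpt ` C)" unfolding Delta_def by blast
  obtain m where m: "m \<in> C" "\<And>c. c \<in> C \<Longrightarrow> prec c m" using chain_greatest[OF chainsD(1-3)[OF C(1)]] by blast
  then have "x \<in> cell D m" unfolding cell_def using C by blast
  then show "x \<in> (\<Union>c\<in>Pprime D. cell D c)" using m(1) chainsD(1)[OF C(1)] by blast
next
  fix x :: "('d,'n) mat" assume "x \<in> (\<Union>c\<in>Pprime D. cell D c)"
  then show "x \<in> Delta D" unfolding Delta_def cell_def by blast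
qed

text \<open>The weight at \<open>vpt s\<close> tells the boundary of the cell of \<open>s\<close>,
  where it is 0, from the interior, where it is positive.\<close>

lemma regular_cw_complex_Delta:
  fixes D :: "'d::{finite,linorder} itself"
  assumes n: "CARD('n::finite) \<ge> 2"
  shows "regular_cw_complex (Delta D :: ('d,'n) mat set) (Pprime D) (cell D) cdim"
proof -
  let ?T = "\<lambda>c. stratum_normal c :: ('d,'n) mat set"
  define ok where "ok s h y \<longleftrightarrow> (\<exists>w C. h y = (\<Sum>c\<in>C. w c *\<^sub>R vpt c) \<and> (\<forall>c. 0 \<le> w c) \<and> sum w C = 1
      \<and> C = {c \<in> Pprime D. w c \<noteq> 0} \<and> is_chain C \<and> (\<forall>c\<in>C. prec c s) \<and> w s = 1 - norm y)"
    for s and h :: "('d,'n) mat \<Rightarrow> ('d,'n) mat" and y :: "('d,'n) mat"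
  define good where "good s h \<longleftrightarrow> (\<exists>g. homeomorphism (cball 0 1 \<inter> ?T s) (cell D s) h g)
      \<and> (\<forall>y\<in>cball 0 1 \<inter> ?T s. ok s h y)" for s h
  \<comment> \<open>Disjointness of open cells compares parametrizations of different cells, so one
    is fixed for every string.\<close>
  define h where "h s = (SOME h. good s h)" for s
  have good: "good s (h s)" if "s \<in> Pprime D" for s
  proof -
    have "\<exists>h. good s h" unfolding good_def ok_def by (rule cell_ball[OF that])
    then show ?thesis unfolding h_def by (rule someI_ex)
  qed
  have hom: "\<exists>g. homeomorphism (cball 0 1 \<inter> ?T s) (cell D s) (h s) g" if "s \<in> Pprime D" for s
    using good[OF that] unfolding good_def by blast
  have ok: "ok s (h s) y" if "s \<in> Pprime D" "y \<in> cball 0 1 \<inter> ?T s" for s y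
    using good[OF that(1)] that(2) unfolding good_def by blast
  have sphere: "h s y \<in> (\<Union>c\<in>{c \<in> Pprime D. cdim c < cdim s}. cell D c)"
    if s: "s \<in> Pprime D" and y: "y \<in> sphere 0 1 \<inter> ?T s" for s y
  proof -
    have "ok s (h s) y" by (rule ok[OF s]) (use y in auto)
    then obtain w C where w: "h s y = (\<Sum>c\<in>C. w c *\<^sub>R vpt c)" "\<forall>c. 0 \<le> w c" "sum w C = 1"
      and C: "C = {c \<in> Pprime D. w c \<noteq> 0}" "is_chain C" "\<forall>c\<in>C. prec c s" and ws: "w s = 1 - norm y"
      unfolding ok_def by (elim exE conjE) (rule that, assumption+)
    \<comment> \<open>On the sphere the weight of \<open>s\<close> is 0, so the greatest member of
      the chain lies strictly below \<open>s\<close> and its cell has smaller dimension.\<close>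
    have sC: "s \<notin> C" using ws y C(1) by simp
    have CP: "C \<subseteq> Pprime D" "C \<noteq> {}" using C(1) by blast (use w(3) in force)
    obtain m where m: "m \<in> C" "\<And>c. c \<in> C \<Longrightarrow> prec c m" using chain_greatest[OF CP(1) C(2) CP(2)] by blast
    have mP: "m \<in> Pprime D" using m(1) CP(1) by blast
    have "C \<in> {C \<in> chains D. \<forall>c\<in>C. prec c m}" using CP C(2) m(2) by (simp add: chains_def)
    moreover have "h s y \<in> convex hull (vpt ` C)"
      unfolding hull_vpt[OF CP(1)] mem_Collect_eq using w(1,3) spec[OF w(2)] by (intro exI[of _ w]) simp
    ultimately have "h s y \<in> cell D m" unfolding cell_def by (rule UN_I)
    moreover have "cdim m < cdim s"
      by (rule cdim_strict_mono[OF mP s]) (use m(1) C(3) sC in auto)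
    ultimately show ?thesis using mP by (intro UN_I[of m]) simp_all
  qed
  have le: "prec s s'" if s: "s \<in> Pprime D" "s' \<in> Pprime D" and y: "y \<in> ball 0 1 \<inter> ?T s" "y' \<in> ball 0 1 \<inter> ?T s'"
    and e: "h s y = h s' y'" for s s' y y'
  proof -
    have "ok s (h s) y" "ok s' (h s') y'" using ok[OF s(1), of y] ok[OF s(2), of y'] y by auto
    then obtain w C w' C' where w: "h s y = (\<Sum>c\<in>C. w c *\<^sub>R vpt c)" "\<forall>c. 0 \<le> w c"
        "C = {c \<in> Pprime D. w c \<noteq> 0}" "is_chain C" "w s = 1 - norm y"
      and w': "h s' y' = (\<Sum>c\<in>C'. w' c *\<^sub>R vpt c)" "\<forall>c. 0 \<le> w' c"
        "C' = {c \<in> Pprime D. w' c \<noteq> 0}" "is_chain C'" "\<forall>c\<in>C'. prec c s'"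
      unfolding ok_def by (elim exE conjE) (rule that, assumption+)
    have CP: "C \<subseteq> Pprime D" "C' \<subseteq> Pprime D" using w(3) w'(3) by auto
    have "(if s \<in> C then w s else 0) = (if s \<in> C' then w' s else 0)"
      by (rule sum_vpt_unique[OF n CP(1) w(4) _ CP(2) w'(4) _ _ s(1)]) (use w(1) w'(1) spec[OF w(2)] spec[OF w'(2)] e in auto)
    \<comment> \<open>In the open ball \<open>s\<close> has positive weight, so uniqueness forces it
      into the other chain, all of whose members lie below \<open>s'\<close>. By symmetry two open
      cells can meet only if their indices agree.\<close>
    moreover have "w s > 0" "s \<in> C" using w(3,5) y(1) s(1) by auto
    ultimately have "s \<in> C'" by (simp split: if_splits)
    then show ?thesis using w'(5) by blast
  qed
  have disj: "h s ` (ball 0 1 \<inter> ?T s) \<inter> h s' ` (ball 0 1 \<inter> ?T s') = {}"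
    if s: "s \<in> Pprime D" "s' \<in> Pprime D" "s' \<noteq> s" for s s'
  proof (rule ccontr)
    assume "h s ` (ball 0 1 \<inter> ?T s) \<inter> h s' ` (ball 0 1 \<inter> ?T s') \<noteq> {}"
    then obtain y y' where y: "y \<in> ball 0 1 \<inter> ?T s" "y' \<in> ball 0 1 \<inter> ?T s'" "h s y = h s' y'"
      by blast
    have "prec s s'" "prec s' s" using le[OF s(1,2) y] le[OF s(2,1) y(2,1) y(3)[symmetric]] by auto
    then show False using prec_antisym[OF s(1,2)] s(3) by blast
  qed
  have main: "\<forall>c\<in>Pprime D. subspace (?T c) \<and> dim (?T c) = cdim c
      \<and> (\<exists>g. homeomorphism (cball 0 1 \<inter> ?T c) (cell D c) (h c) g)
      \<and> h c ` (sphere 0 1 \<inter> ?T c) \<subseteq> (\<Union>c'\<in>{c' \<in> Pprime D. cdim c' < cdim c}. cell D c')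
      \<and> (\<forall>c'\<in>Pprime D. c' \<noteq> c \<longrightarrow> h c ` (ball 0 1 \<inter> ?T c) \<inter> h c' ` (ball 0 1 \<inter> ?T c') = {})"
  proof (intro ballI conjI impI)
    fix c :: "'n string" assume c: "c \<in> Pprime D"
    show "subspace (?T c)" unfolding stratum_normal_def by (rule subspace_span)
    show "dim (?T c) = cdim c" by (rule dim_stratum_normal[OF c])
    show "\<exists>g. homeomorphism (cball 0 1 \<inter> ?T c) (cell D c) (h c) g" by (rule hom[OF c])
    show "h c ` (sphere 0 1 \<inter> ?T c) \<subseteq> (\<Union>c'\<in>{c' \<in> Pprime D. cdim c' < cdim c}. cell D c')"
      using sphere[OF c] by blast
    show "h c ` (ball 0 1 \<inter> ?T c) \<inter> h c' ` (ball 0 1 \<inter> ?T c') = {}" if "c' \<in> Pprime D" "c' \<noteq> c" for c'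
      by (rule disj[OF c that])
  qed
  show ?thesis
    unfolding regular_cw_complex_def
    by (intro conjI finite_Pprime Delta_eq_cells, rule exI[of _ ?T], rule exI[of _ h], rule main)
qed

section \<open>Counting cells\<close>

lemma Pprime_eq_Times:
  "Pprime (D :: 'd::{finite,linorder} itself) = permutations_of_set (UNIV :: 'n::finite set) \<times>
     {i. length i = CARD('n) - 1 \<and> set i \<subseteq> {1..CARD('d)}}"
  by (auto simp: Pprime_def permutations_of_set_def)

text \<open>The equality clause is what identifies the vertices as the strings with all indices
  1.\<close>

lemma sum_list_ge_length:
  "\<forall>x\<in>set xs. 1 \<le> (x::nat) \<Longrightarrow> length xs \<le> sum_list xs \<and> (sum_list xs = length xs \<longrightarrow> xs = replicate (length xs) 1)"
proof (induction xs)
  case (Cons x xs)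
  then have "length xs \<le> sum_list xs" "sum_list xs = length xs \<longrightarrow> xs = replicate (length xs) 1" "1 \<le> x" by auto
  then show ?case by auto
qed simp

lemma sum_list_le_mult:
  "\<forall>x\<in>set xs. x \<le> (d::nat) \<Longrightarrow> sum_list xs \<le> d * length xs \<and> (sum_list xs = d * length xs \<longrightarrow> xs = replicate (length xs) d)"
proof (induction xs)
  case (Cons x xs)
  then have "sum_list xs \<le> d * length xs" "sum_list xs = d * length xs \<longrightarrow> xs = replicate (length xs) d" "x \<le> d" by auto
  then show ?case by auto
qed simp

text \<open>A total deficit of one must sit in a single entry.\<close>

lemma sum_list_one_below:
  "\<forall>x\<in>set xs. x \<le> (d::nat) \<Longrightarrow> Suc (sum_list xs) = d * length xs \<Longrightarrow>
    \<exists>j<length xs. xs = (replicate (length xs) d)[j := d - 1]"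
proof (induction xs)
  case (Cons x xs)
  have b: "x \<le> d" "\<forall>x\<in>set xs. x \<le> d" using Cons.prems(1) by auto
  have le: "sum_list xs \<le> d * length xs" "sum_list xs = d * length xs \<longrightarrow> xs = replicate (length xs) d"
    using sum_list_le_mult[OF b(2)] by auto
  have s: "Suc (x + sum_list xs) = d + d * length xs" using Cons.prems(2) by simp
  show ?case
  proof (cases "x = d")
    case True
    then obtain j where "j < length xs" "xs = (replicate (length xs) d)[j := d - 1]"
      using Cons.IH[OF b(2)] s by auto
    then show ?thesis using True by (intro exI[of _ "Suc j"]) simp
  next
    case False
    then have "sum_list xs = d * length xs" "x = d - 1" using b(1) le(1) s by linarith+
    then show ?thesis using le(2) by (intro exI[of _ 0]) simp
  qed
qed simp

text \<open>A condition on the indices alone leaves the permutation free, whence the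
  factorial.\<close>

lemma card_cells:
  fixes D :: "'d::{finite,linorder} itself" and Q :: "nat list \<Rightarrow> bool"
  assumes "\<And>i. length i = CARD('n::finite) - 1 \<Longrightarrow> set i \<subseteq> {1..CARD('d)} \<Longrightarrow> Q i \<longleftrightarrow> i \<in> A"
    and "\<And>i. i \<in> A \<Longrightarrow> length i = CARD('n) - 1 \<and> set i \<subseteq> {1..CARD('d)}"
  shows "card {c \<in> (Pprime D :: 'n string set). Q (snd c)} = card A * fact CARD('n)"
proof -
  have "{c \<in> (Pprime D :: 'n string set). Q (snd c)} = permutations_of_set UNIV \<times> A"
    unfolding Pprime_eq_Times using assms by auto
  then show ?thesis by (simp add: card_cartesian_product)
qed

lemma replicate_in_index:
  "length (replicate m d) = m \<and> set (replicate m d) \<subseteq> {1..CARD('d)}" if "d \<in> {1..CARD('d::finite)}"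
  using that by auto

lemma cdim_le:
  fixes c :: "'n::finite string"
  assumes "c \<in> Pprime (D :: 'd::{finite,linorder} itself)"
  shows "cdim c \<le> (CARD('d) - 1) * (CARD('n) - 1)"
proof -
  have "length (snd c) = CARD('n) - 1" "\<forall>x\<in>set (snd c). x \<le> CARD('d)" using assms unfolding Pprime_eq_Times by auto
  then show ?thesis using sum_list_le_mult[of "snd c" "CARD('d)"] by (simp add: cdim_def diff_mult_distrib diff_le_mono)
qed

lemma cdim_replicate: "cdim (\<sigma>, replicate (CARD('n) - 1) d) = (d - 1) * (CARD('n) - 1)" for \<sigma> :: "'n::finite list"
  by (simp add: cdim_def sum_list_replicate diff_mult_distrib mult.commute)

lemma Max_cdim:
  fixes D :: "'d::{finite,linorder} itself"
  shows "Max (cdim ` (Pprime D :: 'n::finite string set)) = (CARD('d) - 1) * (CARD('n) - 1)"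
proof (rule Max_eqI)
  show "finite (cdim ` (Pprime D :: 'n string set))" using finite_Pprime by (rule finite_imageI)
  show "y \<le> (CARD('d) - 1) * (CARD('n) - 1)" if "y \<in> cdim ` (Pprime D :: 'n string set)" for y
    using that cdim_le by auto
  obtain \<sigma> where \<sigma>: "\<sigma> \<in> permutations_of_set (UNIV :: 'n set)" 
    using finite_distinct_list[of "UNIV :: 'n set"] by (auto simp: permutations_of_set_def)
  have "(\<sigma>, replicate (CARD('n) - 1) CARD('d)) \<in> Pprime D"
    unfolding Pprime_eq_Times using \<sigma> replicate_in_index[where 'd = 'd, of "CARD('d)"] by (simp add: Suc_leI)
  then show "(CARD('d) - 1) * (CARD('n) - 1) \<in> cdim ` (Pprime D :: 'n string set)"
    using cdim_replicate[of \<sigma> "CARD('d)"] by (metis image_eqI)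
qed

lemma card_vertices:
  fixes D :: "'d::{finite,linorder} itself"
  shows "card {c \<in> (Pprime D :: 'n::finite string set). cdim c = 0} = fact CARD('n)"
proof -
  have "card {c \<in> (Pprime D :: 'n string set). sum_list (snd c) - (CARD('n) - 1) = 0}
      = card {replicate (CARD('n) - 1) (1::nat)} * fact CARD('n)"
  proof (rule card_cells)
    fix i assume i: "length i = CARD('n) - 1" "set i \<subseteq> {1..CARD('d)}"
    then have "\<forall>x\<in>set i. 1 \<le> x" by auto
    \<comment> \<open>The subtraction is truncated, but the sum is at least
      \<open>CARD('n) - 1\<close>, so a zero difference means equality.\<close>
    from sum_list_ge_length[OF this] show "sum_list i - (CARD('n) - 1) = 0 \<longleftrightarrow> i \<in> {replicate (CARD('n) - 1) 1}"
      using i(1) by (auto simp: sum_list_replicate)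
  qed (auto simp: Suc_leI)
  then show ?thesis by (simp add: cdim_def)
qed

text \<open>Raising all indices to \<open>CARD('d)\<close> over the same permutation gives a cell
  above \<open>c\<close>. Conversely such a cell already has the largest dimension, and anything
  strictly above it would exceed this.\<close>

lemma card_maximal:
  fixes D :: "'d::{finite,linorder} itself"
  shows "card {c \<in> (Pprime D :: 'n::finite string set). \<forall>c'\<in>Pprime D. prec c c' \<longrightarrow> c' = c} = fact CARD('n)"
proof -
  let ?r = "replicate (CARD('n) - 1) CARD('d)"
  have "(\<forall>c'\<in>Pprime D. prec c c' \<longrightarrow> c' = c) \<longleftrightarrow> snd c = ?r" if c: "c \<in> Pprime D" for c :: "'n string"
  proof
    assume max: "\<forall>c'\<in>Pprime D. prec c c' \<longrightarrow> c' = c"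
    let ?c = "(fst c, ?r)"
    have P: "?c \<in> Pprime D" using c unfolding Pprime_eq_Times by (auto simp: Suc_leI)
    have "prec c ?c"
      unfolding prec_def
    proof (intro allI impI)
      fix a b assume ab: "a \<noteq> b \<and> before (fst ?c) a b"
      have "mval ?c a b = CARD('d)" using mval_in_set[OF P, of a b] ab by auto
      then show "before (fst c) a b \<and> mval c a b \<le> mval ?c a b \<or> before (fst c) b a \<and> mval c a b < mval ?c a b"
        using ab mval_bounds[OF c, of a b] by simp
    qed
    then show "snd c = ?r" using max P by (metis snd_conv)
  next
    assume r: "snd c = ?r"
    show "\<forall>c'\<in>Pprime D. prec c c' \<longrightarrow> c' = c"
    proof (intro ballI impI, rule ccontr)
      fix c' assume c': "c' \<in> Pprime D" "prec c c'" "c' \<noteq> c"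
      then have "cdim c < cdim c'" using cdim_strict_mono[OF c c'(1,2)] by simp
      moreover have "cdim c = (CARD('d) - 1) * (CARD('n) - 1)"
        using cdim_replicate[of "fst c" "CARD('d)"] r by (metis prod.collapse)
      ultimately show False using cdim_le[OF c'(1)] by simp
    qed
  qed
  then have "{c \<in> (Pprime D :: 'n string set). \<forall>c'\<in>Pprime D. prec c c' \<longrightarrow> c' = c}
      = {c \<in> Pprime D. snd c = ?r}" by blast
  also have "card \<dots> = card {?r} * fact CARD('n)"
    by (rule card_cells) (auto simp: Suc_leI)
  finally show ?thesis by simp
qed

lemma card_codim_one:
  fixes D :: "'d::{finite,linorder} itself"
  assumes n: "CARD('n::finite) \<ge> 2" and d: "CARD('d) \<ge> 2"
  shows "card {c \<in> (Pprime D :: 'n string set). cdim c = (CARD('d) - 1) * (CARD('n) - 1) - 1} = (CARD('n) - 1) * fact CARD('n)"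
proof -
  let ?n = "CARD('n) - 1" and ?d = "CARD('d)"
  \<comment> \<open>Exactly one index drops from \<open>?d\<close> to \<open>?d - 1\<close>, which
    is still a legal index because \<open>?d\<close> is at least 2.\<close>
  define f where "f j = (replicate ?n ?d)[j := ?d - 1]" for j
  have f_sum: "Suc (sum_list (f j)) = ?d * ?n" if "j < ?n" for j
  proof -
    have "?d \<le> ?n * ?d" using that by simp
    then show ?thesis using that d by (simp add: f_def sum_list_update sum_list_replicate mult.commute)
  qed
  have inj: "inj_on f {..<?n}"
  proof (rule inj_onI)
    fix j k assume jk: "j \<in> {..<?n}" "k \<in> {..<?n}" "f j = f k"
    then have "f j ! j = f k ! j" by simp
    then show "j = k" using jk(1,2) d by (simp add: f_def nth_list_update split: if_splits)
  qed
  have "card {c \<in> (Pprime D :: 'n string set). sum_list (snd c) - ?n = (?d - 1) * ?n - 1} = card (f ` {..<?n}) * fact CARD('n)"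
  proof (rule card_cells)
    fix i assume i: "length i = ?n" "set i \<subseteq> {1..?d}"
    have b: "\<forall>x\<in>set i. x \<le> ?d" "\<forall>x\<in>set i. 1 \<le> x" using i(2) by auto
    have ge: "?n \<le> sum_list i" using sum_list_ge_length[OF b(2)] i(1) by simp
    obtain e where e: "?d = Suc e" using d by (cases ?d) auto
    have dn: "?d * ?n = (?d - 1) * ?n + ?n" unfolding e by simp
    \<comment> \<open>Together with \<open>ge\<close> this makes both truncated subtractions genuine
      in the equivalence that follows.\<close>
    have "0 < (?d - 1) * ?n" using d n by simp
    have "sum_list i - ?n = (?d - 1) * ?n - 1 \<longleftrightarrow> Suc (sum_list i) = ?d * ?n"
      using ge dn \<open>0 < (?d - 1) * ?n\<close> by linarith
    also have "\<dots> \<longleftrightarrow> i \<in> f ` {..<?n}"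
    proof
      assume "Suc (sum_list i) = ?d * ?n"
      then have "\<exists>j<length i. i = (replicate (length i) ?d)[j := ?d - 1]"
        using sum_list_one_below[OF b(1)] i(1) by simp
      then show "i \<in> f ` {..<?n}" using i(1) by (auto simp: f_def)
    qed (use f_sum in auto)
    finally show "sum_list i - ?n = (?d - 1) * ?n - 1 \<longleftrightarrow> i \<in> f ` {..<?n}" .
  next
    fix i assume "i \<in> f ` {..<?n}"
    then obtain j where i: "i = f j" by blast
    have "set i \<subseteq> insert (?d - 1) (set (replicate ?n ?d))" unfolding i f_def by (rule set_update_subset_insert)
    also have "\<dots> \<subseteq> {1..?d}" using d by auto
    finally show "length i = ?n \<and> set i \<subseteq> {1..?d}" by (simp add: i f_def)
  qed
  then show ?thesis unfolding cdim_def card_image[OF inj] card_lessThan .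
qed

theorem theorem3p3:
  fixes D :: "('d::{finite,linorder}) itself" and N :: "('n::finite) itself"
  assumes "CARD('n) \<ge> 2"
  defines "P \<equiv> (Pprime D :: 'n string set)"
  defines "X \<equiv> (Delta D :: (('d,'n) mat) set)"
  shows
    "X \<subseteq> conf_space \<and> X \<subseteq> W_space \<and> equivariant_sdr X conf_space
     \<and> regular_cw_complex X P (cell D) cdim
     \<and> Max (cdim ` P) = (CARD('d) - 1) * (CARD('n) - 1)
     \<and> card {c\<in>P. cdim c = 0} = fact CARD('n)
     \<and> card {c\<in>P. \<forall>c'\<in>P. prec c c' \<longrightarrow> c' = c} = fact CARD('n)
     \<and> (CARD('d) \<ge> 2 \<longrightarrow>
          card {c\<in>P. cdim c = (CARD('d) - 1) * (CARD('n) - 1) - 1} = (CARD('n) - 1) * fact CARD('n))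
     \<and> (\<forall>c\<in>P. cell D c \<noteq> {})
     \<and> (\<forall>c\<in>P. \<forall>c'\<in>P. cell D c \<subseteq> cell D c' \<longleftrightarrow> prec c c')
     \<and> inj_on (vpt :: 'n string \<Rightarrow> ('d,'n) mat) P
     \<and> (\<forall>C\<in>chains D. \<not> affine_dependent ((vpt :: 'n string \<Rightarrow> ('d,'n) mat) ` C))
     \<and> (\<forall>C\<in>chains D. \<forall>C'\<in>chains D.
          convex hull ((vpt :: 'n string \<Rightarrow> ('d,'n) mat) ` C) \<inter> convex hull (vpt ` C')
          = convex hull (vpt ` (C \<inter> C')))
     \<and> (\<forall>\<pi>. \<pi> permutes (UNIV::'n set) \<longrightarrow>
          (\<forall>c\<in>P. str_act \<pi> c \<in> P
             \<and> perm_act \<pi> ((vpt :: 'n string \<Rightarrow> ('d,'n) mat) c) = vpt (str_act \<pi> c)))"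
  unfolding P_def X_def
proof (intro conjI ballI impI allI)
  note n = assms(1)
  show "Delta D \<subseteq> (conf_space :: ('d,'n) mat set)" by (rule Delta_subset_conf_space[OF n])
  show "Delta D \<subseteq> (W_space :: ('d,'n) mat set)" by (rule Delta_subset_W_space)
  show "equivariant_sdr (Delta D) (conf_space :: ('d,'n) mat set)" by (rule equivariant_sdr_Delta[OF n])
  show "regular_cw_complex (Delta D :: ('d,'n) mat set) (Pprime D) (cell D) cdim"
    by (rule regular_cw_complex_Delta[OF n])
  show "Max (cdim ` (Pprime D :: 'n string set)) = (CARD('d) - 1) * (CARD('n) - 1)" by (rule Max_cdim)
  show "card {c \<in> (Pprime D :: 'n string set). cdim c = 0} = fact CARD('n)" by (rule card_vertices)
  show "card {c \<in> (Pprime D :: 'n string set). \<forall>c'\<in>Pprime D. prec c c' \<longrightarrow> c' = c} = fact CARD('n)"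
    by (rule card_maximal)
  show "card {c \<in> (Pprime D :: 'n string set). cdim c = (CARD('d) - 1) * (CARD('n) - 1) - 1}
      = (CARD('n) - 1) * fact CARD('n)" if "CARD('d) \<ge> 2"
    by (rule card_codim_one[OF n that])
  show "(cell D c :: ('d,'n) mat set) \<noteq> {}" if "c \<in> Pprime D" for c
    using vpt_in_cell[OF that] by blast
  show "cell D c \<subseteq> (cell D c' :: ('d,'n) mat set) \<longleftrightarrow> prec c c'" if "c \<in> Pprime D" "c' \<in> Pprime D" for c c'
    by (rule cell_subset_iff[OF n that])
  show "inj_on (vpt :: 'n string \<Rightarrow> ('d,'n) mat) (Pprime D)" by (rule vpt_inj)
  show "\<not> affine_dependent ((vpt :: 'n string \<Rightarrow> ('d,'n) mat) ` C)" if "C \<in> chains D" for C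
    by (rule affine_independent_vpt[OF n that])
  show "convex hull ((vpt :: 'n string \<Rightarrow> ('d,'n) mat) ` C) \<inter> convex hull (vpt ` C') = convex hull (vpt ` (C \<inter> C'))"
    if "C \<in> chains D" "C' \<in> chains D" for C C'
    by (rule hull_vpt_Int[OF n that])
  show "str_act \<pi> c \<in> Pprime D" if "\<pi> permutes UNIV" "c \<in> Pprime D" for \<pi> and c :: "'n string"
    by (rule str_act_Pprime[OF that])
  show "perm_act \<pi> ((vpt :: 'n string \<Rightarrow> ('d,'n) mat) c) = vpt (str_act \<pi> c)" if "\<pi> permutes UNIV" for \<pi> c
    by (rule vpt_str_act[OF that])
qed

end
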